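(* Let $n\geq 2$, let $\mathfrak{w}$ be a real subspace of $\mathfrak{g}_\alpha$ and let $V$ be a subspace of $\mathfrak{a}$ (so either $V=\{0\}$ or $V=\mathfrak{a}$). Let $S_{V,\mathfrak{w}}$ be the connected subgroup of $AN$ whose Lie algebra is $\mathfrak{s}_{V,\mathfrak{w}}=V\oplus(\mathfrak{g}_\alpha\ominus\mathfrak{w})\oplus\mathfrak{g}_{2\alpha}$. Then $S_{V,\mathfrak{w}}$ induces a homogeneous polar foliation of $\mathbb{C}H^n$; that is, the orbits of $S_{V,\mathfrak{w}}$ form a foliation of $\mathbb{C}H^n$ and the action of $S_{V,\mathfrak{w}}$ on $\mathbb{C}H^n$ is polar.
   Context: An isometric action of a connected Lie group $H$ on a Riemannian manifold $M$ is polar if there is a connected closed submanifold $\mathcal{S}$ of $M$ (a section) that meets every orbit and satisfies $T_p\mathcal{S}\subset\nu_p(H\cdot p)$ (the normal space of the orbit at $p$) for all $p\in\mathcal{S}$. $\mathbb{C}H^n=G/K$ is complex hyperbolic space with holomorphic sectional curvature $-1$, $G=SU(1,n)$, $K=S(U(1)U(n))$ the isotropy group at a fixed point $o$. Let $\mathfrak{g}=\mathfrak{k}\oplus\mathfrak{p}$ be the Cartan decomposition, $\theta$ the Cartan involution, and $\langle X,Y\rangle=-\mathcal{B}(\theta X,Y)$ the inner product on $\mathfrak{g}$ obtained from the Killing form $\mathcal{B}$. Identify $\mathfrak{p}\cong T_o\mathbb{C}H^n$, with complex structure $i$. Let $\mathfrak{a}\subset\mathfrak{p}$ be a maximal abelian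 subspace (one-dimensional), with restricted root space decomposition $\mathfrak{g}=\mathfrak{g}_{-2\alpha}\oplus\mathfrak{g}_{-\alpha}\oplus\mathfrak{g}_0\oplus\mathfrak{g}_\alpha\oplus\mathfrak{g}_{2\alpha}$, where $\mathfrak{g}_\lambda=\{X\in\mathfrak{g}:[H,X]=\lambda(H)X\ \forall H\in\mathfrak{a}\}$, and $\alpha,2\alpha$ are chosen positive. Put $\mathfrak{n}=\mathfrak{g}_\alpha\oplus\mathfrak{g}_{2\alpha}$ and let $AN$ be the connected subgroup of $G$ with Lie algebra $\mathfrak{a}\oplus\mathfrak{n}$. The complex structure $J$ on $\mathfrak{g}_\alpha$ is determined by $i(1-\theta)U=(1-\theta)JU$. A subspace $\mathfrak{w}\subset\mathfrak{g}_\alpha$ is called real if it is totally real, i.e. it is an $\mathbb{R}$-linear subspace with $J\mathfrak{w}\perp\mathfrak{w}$. The symbol $\ominus$ denotes orthogonal complement. *)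

theory Defs
  imports "HOL-Analysis.Analysis"
begin

section \<open>Smooth maps, submanifolds and foliations\<close>

text \<open>All manifolds below live in an open subset of a Euclidean space. Smoothness is only
  used on open sets, where the Frechet derivative is unique.\<close>

fun k_times_differentiable_on ::
    "nat \<Rightarrow> 'a::euclidean_space set \<Rightarrow> ('a \<Rightarrow> 'b::euclidean_space) \<Rightarrow> bool" where
  "k_times_differentiable_on 0 U f \<longleftrightarrow> continuous_on U f"
| "k_times_differentiable_on (Suc k) U f \<longleftrightarrow>
     (\<forall>x\<in>U. f differentiable (at x)) \<and>
     (\<forall>v. k_times_differentiable_on k U (\<lambda>x. frechet_derivative f (at x) v))"

definition smooth_on :: "'a::euclidean_space set \<Rightarrow> ('a \<Rightarrow> 'b::euclidean_space) \<Rightarrow> bool" where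
  "smooth_on U f \<longleftrightarrow> (\<forall>k. k_times_differentiable_on k U f)"

definition diffeomorphism ::
    "'a::euclidean_space set \<Rightarrow> 'a set \<Rightarrow> ('a \<Rightarrow> 'a) \<Rightarrow> ('a \<Rightarrow> 'a) \<Rightarrow> bool" where
  "diffeomorphism U V \<phi> \<psi> \<longleftrightarrow>
     open U \<and> open V \<and> homeomorphism U V \<phi> \<psi> \<and> smooth_on U \<phi> \<and> smooth_on V \<psi>"

text \<open>The slice of \<open>V\<close> on which the coordinates outside \<open>B\<close> are frozen at their values in \<open>c\<close>;
  its dimension is \<open>card B\<close>.\<close>

definition coordinate_slice :: "'a::euclidean_space set \<Rightarrow> 'a set \<Rightarrow> 'a \<Rightarrow> 'a set" where
  "coordinate_slice B V c = {x\<in>V. \<forall>b\<in>Basis - B. x \<bullet> b = c \<bullet> b}"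

definition embedded_submanifold :: "nat \<Rightarrow> 'a::euclidean_space set \<Rightarrow> bool" where
  "embedded_submanifold k S \<longleftrightarrow>
     (\<forall>p\<in>S. \<exists>U V \<phi> \<psi> B c. p \<in> U \<and> diffeomorphism U V \<phi> \<psi> \<and> B \<subseteq> Basis \<and> card B = k \<and>
        \<phi> ` (S \<inter> U) = coordinate_slice B V c)"

text \<open>An immersed submanifold carries its own (second countable) topology \<open>T\<close>, possibly finer than
  the subspace topology; locally with respect to \<open>T\<close> it is an embedded submanifold. The Hausdorff
  property is automatic, since the inclusion is continuous.\<close>

definition connected_immersed_submanifold :: "nat \<Rightarrow> 'a::euclidean_space set \<Rightarrow> bool" where
  "connected_immersed_submanifold k L \<longleftrightarrow>
     (\<exists>T. topspace T = L \<and> connected_space T \<and>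
       (\<exists>\<B>. countable \<B> \<and> (\<forall>W\<in>\<B>. openin T W) \<and>
            (\<forall>W x. openin T W \<and> x \<in> W \<longrightarrow> (\<exists>W'\<in>\<B>. x \<in> W' \<and> W' \<subseteq> W))) \<and>
       (\<forall>p\<in>L. \<exists>W. openin T W \<and> p \<in> W \<and> embedded_submanifold k W \<and>
            subtopology T W = top_of_set W))"

text \<open>A regular foliation: a partition into connected immersed submanifolds of one common dimension,
  such that around every point there is a flat chart, in which each leaf is a (possibly empty)
  countable union of parallel slices.\<close>

definition foliation :: "'a::euclidean_space set \<Rightarrow> 'a set set \<Rightarrow> bool" where
  "foliation M \<F> \<longleftrightarrow>
     \<Union>\<F> = M \<and> disjoint \<F> \<and>
     (\<exists>k. (\<forall>L\<in>\<F>. L \<noteq> {} \<and> connected_immersed_submanifold k L) \<and>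
        (\<forall>p\<in>M. \<exists>U a b \<phi> \<psi> B. p \<in> U \<and> U \<subseteq> M \<and> diffeomorphism U (box a b) \<phi> \<psi> \<and>
           B \<subseteq> Basis \<and> card B = k \<and>
           (\<forall>L\<in>\<F>. \<exists>C. countable C \<and>
              \<phi> ` (L \<inter> U) = (\<Union>c\<in>C. coordinate_slice B (box a b) c))))"

text \<open>Velocities at \<open>p\<close> of smooth curves inside \<open>S\<close>. This is the usual tangent space for embedded
  submanifolds, and also for orbits of Lie groups, as these are weakly embedded: a smooth curve of
  the ambient space lying in an orbit is smooth as a curve of the orbit.\<close>

definition tangent_space :: "'a::euclidean_space set \<Rightarrow> 'a \<Rightarrow> 'a set" where
  "tangent_space S p =
     {v. \<exists>\<gamma> (e::real). e > 0 \<and> smooth_on {-e<..<e} \<gamma> \<and> \<gamma> ` {-e<..<e} \<subseteq> S \<and> \<gamma> 0 = p \<and>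
         (\<gamma> has_vector_derivative v) (at 0)}"

text \<open>A Riemannian metric is represented as \<open>g p v w\<close>, for tangent vectors \<open>v\<close>, \<open>w\<close> at \<open>p\<close>.\<close>

definition normal_space ::
    "('a \<Rightarrow> 'a \<Rightarrow> 'a \<Rightarrow> real) \<Rightarrow> 'a::euclidean_space set \<Rightarrow> 'a \<Rightarrow> 'a set" where
  "normal_space g S p = {v. \<forall>w\<in>tangent_space S p. g p v w = 0}"

definition riemannian_isometry ::
    "'a::euclidean_space set \<Rightarrow> ('a \<Rightarrow> 'a \<Rightarrow> 'a \<Rightarrow> real) \<Rightarrow> ('a \<Rightarrow> 'a) \<Rightarrow> bool" where
  "riemannian_isometry M g f \<longleftrightarrow>
     (\<exists>f'. diffeomorphism M M f f') \<and>
     (\<forall>p\<in>M. \<forall>v w. g (f p) (frechet_derivative f (at p) v) (frechet_derivative f (at p) w) = g p v w)"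


section \<open>Connected Lie subgroups of matrix groups\<close>

definition bracket :: "complex^'m^'m \<Rightarrow> complex^'m^'m \<Rightarrow> complex^'m^'m" where
  "bracket X Y = X ** Y - Y ** X"

definition mexp :: "complex^'m^'m \<Rightarrow> complex^'m^'m" where
  "mexp X = (\<Sum>k. (1 / fact k) *\<^sub>R (((**) X ^^ k) (mat 1)))"

definition lie_algebra :: "(complex^'m^'m) set \<Rightarrow> (complex^'m^'m) set" where
  "lie_algebra H = {X. \<forall>t::real. mexp (t *\<^sub>R X) \<in> H}"

text \<open>\<open>H\<close> is a connected Lie (not necessarily closed) subgroup of the matrix Lie group \<open>G\<close>:
  \<open>lie_algebra H\<close> is a real Lie algebra, whose exponentials generate \<open>H\<close>.\<close>

definition connected_lie_subgroup :: "(complex^'m^'m) set \<Rightarrow> (complex^'m^'m) set \<Rightarrow> bool" where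
  "connected_lie_subgroup G H \<longleftrightarrow>
     H \<subseteq> G \<and>
     mat 1 \<in> H \<and> (\<forall>A\<in>H. \<forall>B\<in>H. A ** B \<in> H) \<and> (\<forall>A\<in>H. invertible A \<and> matrix_inv A \<in> H) \<and>
     subspace (lie_algebra H) \<and>
     (\<forall>X\<in>lie_algebra H. \<forall>Y\<in>lie_algebra H. bracket X Y \<in> lie_algebra H) \<and>
     (\<forall>A\<in>H. \<exists>Xs. set Xs \<subseteq> lie_algebra H \<and> A = foldr (**) (map mexp Xs) (mat 1))"


section \<open>Polar actions\<close>

definition orbit :: "('g \<Rightarrow> 'a \<Rightarrow> 'a) \<Rightarrow> 'g set \<Rightarrow> 'a \<Rightarrow> 'a set" where
  "orbit act H p = (\<lambda>h. act h p) ` H"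

definition orbits :: "('g \<Rightarrow> 'a \<Rightarrow> 'a) \<Rightarrow> 'g set \<Rightarrow> 'a set \<Rightarrow> 'a set set" where
  "orbits act H M = orbit act H ` M"

text \<open>Continuity suffices: a continuous action of a Lie group by isometries is smooth.\<close>

definition isometric_action ::
    "'a::euclidean_space set \<Rightarrow> ('a \<Rightarrow> 'a \<Rightarrow> 'a \<Rightarrow> real) \<Rightarrow>
     (complex^'m^'m \<Rightarrow> 'a \<Rightarrow> 'a) \<Rightarrow> (complex^'m^'m) set \<Rightarrow> bool" where
  "isometric_action M g act H \<longleftrightarrow>
     connected_lie_subgroup {A. invertible A} H \<and>
     (\<forall>p\<in>M. act (mat 1) p = p) \<and>
     (\<forall>A\<in>H. \<forall>B\<in>H. \<forall>p\<in>M. act (A ** B) p = act A (act B p)) \<and>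
     continuous_on (H \<times> M) (\<lambda>(A, p). act A p) \<and>
     (\<forall>A\<in>H. riemannian_isometry M g (act A))"

definition polar_action ::
    "'a::euclidean_space set \<Rightarrow> ('a \<Rightarrow> 'a \<Rightarrow> 'a \<Rightarrow> real) \<Rightarrow>
     (complex^'m^'m \<Rightarrow> 'a \<Rightarrow> 'a) \<Rightarrow> (complex^'m^'m) set \<Rightarrow> bool" where
  "polar_action M g act H \<longleftrightarrow>
     isometric_action M g act H \<and>
     (\<exists>\<Sigma> k. \<Sigma> \<subseteq> M \<and> connected \<Sigma> \<and> closedin (top_of_set M) \<Sigma> \<and> embedded_submanifold k \<Sigma> \<and>
        (\<forall>p\<in>M. \<Sigma> \<inter> orbit act H p \<noteq> {}) \<and>
        (\<forall>p\<in>\<Sigma>. tangent_space \<Sigma> p \<subseteq> normal_space g (orbit act H p) p))"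


section \<open>Complex hyperbolic space\<close>

text \<open>\<open>\<complex>H\<^sup>n\<close> is realised as the unit ball of \<open>\<complex>\<^sup>n\<close>, where \<open>n = CARD('n)\<close>. The index type \<open>'n option\<close>
  has \<open>n + 1\<close> elements; \<open>None\<close> is the timelike coordinate of \<open>\<complex>\<^sup>1\<^sup>,\<^sup>n\<close>. A point \<open>z\<close> of the ball
  corresponds to the negative complex line through \<open>(1, z)\<close>.\<close>

definition CH :: "(complex^'n) set" where
  "CH = ball 0 1"

definition cinner :: "complex^'n \<Rightarrow> complex^'n \<Rightarrow> complex" where
  "cinner v w = (\<Sum>j\<in>UNIV. v $ j * cnj (w $ j))"

text \<open>The Bergman metric, normalised to have holomorphic sectional curvature \<open>-1\<close>.\<close>

definition CH_metric :: "complex^'n \<Rightarrow> complex^'n \<Rightarrow> complex^'n \<Rightarrow> real" where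
  "CH_metric z v w =
     4 * Re (complex_of_real (1 - (norm z)\<^sup>2) * cinner v w + cinner v z * cinner z w)
       / (1 - (norm z)\<^sup>2)\<^sup>2"

definition herm_form :: "complex^('n::finite option) \<Rightarrow> complex^('n option) \<Rightarrow> complex" where
  "herm_form x y = - x $ None * cnj (y $ None) + (\<Sum>j\<in>UNIV. x $ Some j * cnj (y $ Some j))"

definition SU :: "(complex^('n::finite option)^('n option)) set" where
  "SU = {A. det A = 1 \<and> (\<forall>x y. herm_form (A *v x) (A *v y) = herm_form x y)}"

definition su :: "(complex^('n::finite option)^('n option)) set" where
  "su = {X. trace X = 0 \<and> (\<forall>x y. herm_form (X *v x) y + herm_form x (X *v y) = 0)}"

definition homogeneous_coords :: "complex^'n::finite \<Rightarrow> complex^('n option)" where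
  "homogeneous_coords z = (\<chi> i. case i of None \<Rightarrow> 1 | Some j \<Rightarrow> z $ j)"

text \<open>The action of \<open>SU(1,n)\<close>; the isotropy group at \<open>o = 0\<close> is \<open>S(U(1)U(n))\<close>.\<close>

definition CH_act :: "complex^('n::finite option)^('n option) \<Rightarrow> complex^'n \<Rightarrow> complex^'n" where
  "CH_act A z = (\<chi> j. (A *v homogeneous_coords z) $ Some j / (A *v homogeneous_coords z) $ None)"


section \<open>The Lie algebra of \<open>SU(1,n)\<close>\<close>

text \<open>Trace of an endomorphism \<open>f\<close> of a real subspace \<open>V\<close>; it does not depend on the basis.\<close>

definition trace_on :: "'a::euclidean_space set \<Rightarrow> ('a \<Rightarrow> 'a) \<Rightarrow> real" where
  "trace_on V f =
     (let B = (SOME B. independent B \<and> span B = V) in \<Sum>b\<in>B. representation B (f b) b)"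

definition killing_form ::
    "complex^('n::finite option)^('n option) \<Rightarrow> complex^('n option)^('n option) \<Rightarrow> real" where
  "killing_form X Y = trace_on su (\<lambda>Z. bracket X (bracket Y Z))"

text \<open>The Cartan involution that fixes the Lie algebra of the isotropy group at \<open>o = 0\<close>.\<close>

definition cartan_inv :: "complex^'m^'m \<Rightarrow> complex^'m^'m" where
  "cartan_inv X = - map_matrix cnj (transpose X)"

definition ip ::
    "complex^('n::finite option)^('n option) \<Rightarrow> complex^('n option)^('n option) \<Rightarrow> real" where
  "ip X Y = - killing_form (cartan_inv X) Y"

definition cartan_p :: "(complex^('n::finite option)^('n option)) set" where
  "cartan_p = {X\<in>su. cartan_inv X = - X}"

text \<open>The identification of \<open>cartan_p\<close> with the tangent space \<open>\<complex>\<^sup>n\<close> at \<open>o = 0\<close>.\<close>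

definition p_to_tangent :: "complex^('n::finite option)^('n option) \<Rightarrow> complex^'n" where
  "p_to_tangent X = vector_derivative (\<lambda>t::real. CH_act (mexp (t *\<^sub>R X)) 0) (at 0)"

definition abelian_in_p :: "(complex^('n::finite option)^('n option)) set \<Rightarrow> bool" where
  "abelian_in_p \<aa> \<longleftrightarrow> subspace \<aa> \<and> \<aa> \<subseteq> cartan_p \<and> (\<forall>X\<in>\<aa>. \<forall>Y\<in>\<aa>. bracket X Y = 0)"

definition maximal_abelian_in_p :: "(complex^('n::finite option)^('n option)) set \<Rightarrow> bool" where
  "maximal_abelian_in_p \<aa> \<longleftrightarrow>
     abelian_in_p \<aa> \<and> (\<forall>\<bb>. abelian_in_p \<bb> \<and> \<aa> \<subseteq> \<bb> \<longrightarrow> \<bb> = \<aa>)"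

definition root_space ::
    "(complex^('n::finite option)^('n option)) set \<Rightarrow>
     (complex^('n option)^('n option) \<Rightarrow> real) \<Rightarrow> (complex^('n option)^('n option)) set" where
  "root_space \<aa> \<mu> = {X\<in>su. \<forall>H\<in>\<aa>. bracket H X = \<mu> H *\<^sub>R X}"

definition restricted_root ::
    "(complex^('n::finite option)^('n option)) set \<Rightarrow>
     (complex^('n option)^('n option) \<Rightarrow> real) \<Rightarrow> bool" where
  "restricted_root \<aa> \<mu> \<longleftrightarrow> (\<exists>H\<in>\<aa>. \<mu> H \<noteq> 0) \<and> root_space \<aa> \<mu> \<noteq> {0}"

text \<open>Linear functionals on \<open>\<aa>\<close> are represented by linear functionals on the whole matrix space, of
  which only the values on \<open>\<aa>\<close> matter.\<close>

definition restricted_root_decomposition ::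
    "(complex^('n::finite option)^('n option)) set \<Rightarrow>
     (complex^('n option)^('n option) \<Rightarrow> real) \<Rightarrow> bool" where
  "restricted_root_decomposition \<aa> \<alpha> \<longleftrightarrow>
     linear \<alpha> \<and>
     (\<forall>c\<in>{-2, -1, 1, 2}. restricted_root \<aa> (\<lambda>H. c * \<alpha> H)) \<and>
     su = root_space \<aa> (\<lambda>H. -2 * \<alpha> H) + root_space \<aa> (\<lambda>H. - \<alpha> H) + root_space \<aa> (\<lambda>H. 0)
        + root_space \<aa> \<alpha> + root_space \<aa> (\<lambda>H. 2 * \<alpha> H)"

text \<open>The element \<open>JU\<close> of \<open>\<gg>\<^sub>\<alpha>\<close> with \<open>(1 - \<theta>)JU = \<i>(1 - \<theta>)U\<close>, the right-hand side being computed
  in the tangent space at \<open>o\<close>.\<close>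

definition root_J ::
    "(complex^('n::finite option)^('n option)) set \<Rightarrow>
     (complex^('n option)^('n option) \<Rightarrow> real) \<Rightarrow>
     complex^('n option)^('n option) \<Rightarrow> complex^('n option)^('n option)" where
  "root_J \<aa> \<alpha> U =
     (THE W. W \<in> root_space \<aa> \<alpha> \<and>
        p_to_tangent (W - cartan_inv W) = \<i> *s p_to_tangent (U - cartan_inv U))"

definition real_root_subspace ::
    "(complex^('n::finite option)^('n option)) set \<Rightarrow>
     (complex^('n option)^('n option) \<Rightarrow> real) \<Rightarrow>
     (complex^('n option)^('n option)) set \<Rightarrow> bool" where
  "real_root_subspace \<aa> \<alpha> \<ww> \<longleftrightarrow>
     subspace \<ww> \<and> \<ww> \<subseteq> root_space \<aa> \<alpha> \<and> (\<forall>X\<in>\<ww>. \<forall>Y\<in>\<ww>. ip (root_J \<aa> \<alpha> X) Y = 0)"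

definition ominus ::
    "(complex^('n::finite option)^('n option)) set \<Rightarrow>
     (complex^('n option)^('n option)) set \<Rightarrow> (complex^('n option)^('n option)) set" where
  "ominus \<vv> \<ww> = {X\<in>\<vv>. \<forall>Y\<in>\<ww>. ip X Y = 0}"

text \<open>The Lie algebras \<open>\<aa> \<oplus> \<nn>\<close> and \<open>\<ss>\<^sub>V\<^sub>,\<^sub>\<ww>\<close>; the sums of root spaces are automatically direct.\<close>

definition an_algebra ::
    "(complex^('n::finite option)^('n option)) set \<Rightarrow>
     (complex^('n option)^('n option) \<Rightarrow> real) \<Rightarrow> (complex^('n option)^('n option)) set" where
  "an_algebra \<aa> \<alpha> = \<aa> + (root_space \<aa> \<alpha> + root_space \<aa> (\<lambda>H. 2 * \<alpha> H))"

definition s_algebra ::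
    "(complex^('n::finite option)^('n option)) set \<Rightarrow>
     (complex^('n option)^('n option) \<Rightarrow> real) \<Rightarrow>
     (complex^('n option)^('n option)) set \<Rightarrow>
     (complex^('n option)^('n option)) set \<Rightarrow> (complex^('n option)^('n option)) set" where
  "s_algebra \<aa> \<alpha> V \<ww> = V + ominus (root_space \<aa> \<alpha>) \<ww> + root_space \<aa> (\<lambda>H. 2 * \<alpha> H)"

end

theory Submission
  imports Defs
begin

text \<open>Let \<open>\<aa> = \<real> A\<close> with \<open>\<alpha> A = 1\<close>; then \<open>A\<close> is the transvection along a unit
  vector \<open>u \<in> \<complex>\<^sup>n\<close>, and \<open>AN\<close> fixes the boundary point \<open>u\<close>. In Siegel coordinates at \<open>u\<close> a point has a
  height \<open>h > 0\<close>, an imaginary part and a vector part \<open>v \<in> u\<^sup>\<bottom>\<close>; \<open>\<gg>\<^sub>2\<^sub>\<alpha>\<close> translates the imaginary part,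
  \<open>\<gg>\<^sub>\<alpha> \<cong> u\<^sup>\<bottom>\<close> translates \<open>v\<close>, and \<open>\<aa>\<close> scales \<open>v\<close> and \<open>\<surd>h\<close> by the same factor. Hence, if \<open>W \<subseteq> u\<^sup>\<bottom>\<close>
  corresponds to \<open>\<ww>\<close>, the orbits are the level sets of \<open>h\<close> and the \<open>W\<close>-part of \<open>v\<close> for \<open>V = 0\<close>, and of the
  \<open>W\<close>-part of \<open>v / \<surd>h\<close> for \<open>V = \<aa>\<close>. In suitable global coordinates on a half-space these are parallel
  affine slices. A section is the intersection \<open>\<Sigma>\<close> of the ball with the totally real subspace
  \<open>\<real>u \<oplus> W\<close> or \<open>W\<close>, respectively: differentiating the invariants at a point of \<open>\<Sigma>\<close> shows that the
  velocities of curves in the orbit are Euclidean-orthogonal to this subspace, and for a totally real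
  subspace the Bergman metric yields the same condition.\<close>

section \<open>Smooth maps\<close>

text \<open>\<open>S\<close> is known only through the exponentials that generate it, and a closed
  form for the exponential of a general element of \<aa> + \<nn> is unwieldy. The proof dualises
  instead: for w orthogonal to u, every X in \<aa> + \<nn> carries both functionals
  \<open>herm_form _ (hc 1 u)\<close> and \<open>herm_form _ (hc 0 w)\<close> into multiples of the
  first one. Their values on \<open>mexp X *v y\<close> are therefore elementary, and the invariants
  of an orbit are built from such values. That orbits lie in level sets reduces to single
  exponentials, because having equal invariants is a transitive relation; that they fill level sets
  needs just the exponentials of \<open>pmat u\<close>, \<open>zmat u b\<close> and
  \<open>qmat u\<close>. A second obstacle is that J and \<open>ip\<close> are given abstractly, by
  a definite description and by a trace over an unspecified basis. In the parameter b of
  \<open>zmat u b\<close>, J is multiplication by \<i> and \<open>ip\<close> a positive multiple of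
  the Euclidean product, so a real \<ww> becomes a W with real Hermitian products.\<close>

lemma k_times_differentiable_on_cong:
  assumes "open U" "\<And>x. x \<in> U \<Longrightarrow> f x = g x"
  shows "k_times_differentiable_on k U f = k_times_differentiable_on k U g"
  using assms(2)
proof (induction k arbitrary: f g)
  case 0
  then show ?case by (simp cong: continuous_on_cong)
next
  case (Suc k)
  have eq: "(f has_derivative f') (at x) = (g has_derivative f') (at x)" if "x \<in> U" for x f'
    using has_derivative_transform_within_open[OF _ assms(1) that] Suc.prems by metis
  have "f differentiable at x \<longleftrightarrow> g differentiable at x" if "x \<in> U" for x
    using eq[OF that] by (simp add: differentiable_def)
  moreover have "frechet_derivative f (at x) = frechet_derivative g (at x)" if "x \<in> U" for x
    using eq[OF that] by (simp add: frechet_derivative_def)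
  ultimately show ?case
    using Suc.IH[of "\<lambda>x. frechet_derivative f (at x) v" "\<lambda>x. frechet_derivative g (at x) v" for v]
    by auto
qed

text \<open>Replaces the choice-based \<open>frechet_derivative\<close> by a derivative computed by
  hand; most inductions on the order of differentiability run through this form.\<close>

lemma k_times_differentiable_on_Suc_iff:
  assumes "open U" "\<And>x. x \<in> U \<Longrightarrow> (f has_derivative f' x) (at x)"
  shows "k_times_differentiable_on (Suc k) U f \<longleftrightarrow>
    (\<forall>v. k_times_differentiable_on k U (\<lambda>x. f' x v))"
proof -
  have "frechet_derivative f (at x) = f' x" if "x \<in> U" for x
    using frechet_derivative_at[OF assms(2)[OF that]] by simp
  then have "k_times_differentiable_on k U (\<lambda>x. frechet_derivative f (at x) v)
      = k_times_differentiable_on k U (\<lambda>x. f' x v)" for v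
    by (intro k_times_differentiable_on_cong assms) auto
  then show ?thesis
    using assms(2) by (auto simp: differentiable_def)
qed

lemma k_times_differentiable_on_has_derivative:
  assumes "k_times_differentiable_on (Suc k) U f" "x \<in> U"
  shows "(f has_derivative frechet_derivative f (at x)) (at x)"
  using assms by (simp add: frechet_derivative_works)

lemma k_times_differentiable_on_SucD:
  "k_times_differentiable_on (Suc k) U f \<Longrightarrow> k_times_differentiable_on k U f"
proof (induction k arbitrary: f)
  case 0
  then show ?case
    by (auto intro!: continuous_at_imp_continuous_on differentiable_imp_continuous_within)
qed auto

lemma k_times_differentiable_on_const: "open U \<Longrightarrow> k_times_differentiable_on k U (\<lambda>x. c)"
proof (induction k arbitrary: c)
  case (Suc k)
  then show ?case
    by (subst k_times_differentiable_on_Suc_iff[where f' = "\<lambda>_ _. 0"]) auto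
qed simp

lemma k_times_differentiable_on_bounded_linear:
  "open U \<Longrightarrow> bounded_linear f \<Longrightarrow> k_times_differentiable_on k U f"
proof (cases k)
  case 0
  assume "bounded_linear f"
  then show ?thesis using 0 by (simp add: linear_continuous_on)
next
  case (Suc m)
  assume "open U" "bounded_linear f"
  then show ?thesis unfolding Suc
    by (subst k_times_differentiable_on_Suc_iff[where f' = "\<lambda>_. f"])
      (auto intro: k_times_differentiable_on_const bounded_linear_imp_has_derivative)
qed

lemma k_times_differentiable_on_linear_compose:
  assumes "open U" "bounded_linear g"
  shows "k_times_differentiable_on k U f \<Longrightarrow> k_times_differentiable_on k U (\<lambda>x. g (f x))"
proof (induction k arbitrary: f)
  case 0
  then show ?case using bounded_linear.continuous_on[OF assms(2)] by simp
next
  case (Suc k)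
  have "((\<lambda>x. g (f x)) has_derivative (\<lambda>v. g (frechet_derivative f (at x) v))) (at x)" if "x \<in> U" for x
    using k_times_differentiable_on_has_derivative[OF Suc.prems that]
      bounded_linear.has_derivative[OF assms(2)] by blast
  then show ?case
    using Suc by (subst k_times_differentiable_on_Suc_iff[OF assms(1)]) auto
qed

lemma k_times_differentiable_on_add:
  assumes "open U"
  shows "k_times_differentiable_on k U f \<Longrightarrow> k_times_differentiable_on k U g \<Longrightarrow>
    k_times_differentiable_on k U (\<lambda>x. f x + g x)"
proof (induction k arbitrary: f g)
  case 0
  then show ?case by (simp add: continuous_on_add)
next
  case (Suc k)
  have "((\<lambda>x. f x + g x) has_derivative
      (\<lambda>v. frechet_derivative f (at x) v + frechet_derivative g (at x) v)) (at x)" if "x \<in> U" for x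
    using Suc.prems that by (intro has_derivative_add k_times_differentiable_on_has_derivative)
  then show ?case
    using Suc by (subst k_times_differentiable_on_Suc_iff[OF assms]) auto
qed

lemma k_times_differentiable_on_bilinear:
  assumes "open U" "bounded_bilinear b"
  shows "k_times_differentiable_on k U f \<Longrightarrow> k_times_differentiable_on k U g \<Longrightarrow>
    k_times_differentiable_on k U (\<lambda>x. b (f x) (g x))"
proof (induction k arbitrary: f g)
  case 0
  then show ?case by (simp add: bounded_bilinear.continuous_on[OF assms(2)])
next
  case (Suc k)
  have "((\<lambda>x. b (f x) (g x)) has_derivative
      (\<lambda>v. b (f x) (frechet_derivative g (at x) v) + b (frechet_derivative f (at x) v) (g x))) (at x)"
    if "x \<in> U" for x
    using Suc.prems that
    by (intro bounded_bilinear.FDERIV[OF assms(2)] k_times_differentiable_on_has_derivative)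
  \<comment> \<open>The product rule keeps one factor undifferentiated, so each factor is also
    needed at order k.\<close>
  moreover have "k_times_differentiable_on k U f" "k_times_differentiable_on k U g"
    using Suc.prems k_times_differentiable_on_SucD by auto
  ultimately show ?case
    using Suc by (subst k_times_differentiable_on_Suc_iff[OF assms(1)])
      (auto intro!: k_times_differentiable_on_add[OF assms(1)])
qed

lemma k_times_differentiable_on_sum:
  assumes "open U" "\<And>i. i \<in> I \<Longrightarrow> k_times_differentiable_on k U (f i)"
  shows "k_times_differentiable_on k U (\<lambda>x. \<Sum>i\<in>I. f i x)"
  using assms(2)
  by (induction I rule: infinite_finite_induct)
    (auto intro: k_times_differentiable_on_const k_times_differentiable_on_add assms(1))

text \<open>The recursion controls derivatives in fixed directions, whereas the chain rule evaluates
  the derivative of g in a direction that moves with x. Expanding that direction in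
  \<open>Basis\<close> leaves scalar functions times derivatives in fixed directions.\<close>

lemma k_times_differentiable_on_compose:
  assumes "open U" "open V" "f ` U \<subseteq> V"
  shows "k_times_differentiable_on k U f \<Longrightarrow> k_times_differentiable_on k V g \<Longrightarrow>
    k_times_differentiable_on k U (\<lambda>x. g (f x))"
proof (induction k arbitrary: g)
  case 0
  then show ?case using continuous_on_compose2 assms(3) by auto
next
  case (Suc k)
  define D where "D x v = (\<Sum>b\<in>Basis. (frechet_derivative f (at x) v \<bullet> b) *\<^sub>R frechet_derivative g (at (f x)) b)"
    for x v
  have "((\<lambda>x. g (f x)) has_derivative D x) (at x)" if "x \<in> U" for x
  proof -
    have g: "(g has_derivative frechet_derivative g (at (f x))) (at (f x))"
      using assms that by (intro k_times_differentiable_on_has_derivative[OF Suc.prems(2)]) auto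
    then have lin: "linear (frechet_derivative g (at (f x)))"
      using has_derivative_linear by blast
    have "D x v = frechet_derivative g (at (f x)) (frechet_derivative f (at x) v)" for v
    proof -
      have "D x v = frechet_derivative g (at (f x)) (\<Sum>b\<in>Basis. (frechet_derivative f (at x) v \<bullet> b) *\<^sub>R b)"
        unfolding D_def by (simp add: linear_sum[OF lin] linear_cmul[OF lin])
      then show ?thesis by (simp only: euclidean_representation)
    qed
    then show ?thesis
      using has_derivative_compose[OF k_times_differentiable_on_has_derivative[OF Suc.prems(1) that] g]
      by presburger
  qed
  moreover have "k_times_differentiable_on k U (\<lambda>x. D x v)" for v
    unfolding D_def
  proof (intro k_times_differentiable_on_sum assms
        k_times_differentiable_on_bilinear[OF assms(1) bounded_bilinear_scaleR]
        k_times_differentiable_on_linear_compose[OF assms(1) bounded_linear_inner_left])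
    show "k_times_differentiable_on k U (\<lambda>x. frechet_derivative f (at x) v)"
      using Suc.prems(1) by simp
    show "k_times_differentiable_on k U (\<lambda>x. frechet_derivative g (at (f x)) b)" for b
      using Suc.prems k_times_differentiable_on_SucD by (intro Suc.IH) auto
  qed
  ultimately show ?case
    by (subst k_times_differentiable_on_Suc_iff[OF assms(1)]) auto
qed

lemma smooth_on_const: "open U \<Longrightarrow> smooth_on U (\<lambda>x. c)"
  by (simp add: smooth_on_def k_times_differentiable_on_const)

lemma smooth_on_linear: "open U \<Longrightarrow> linear f \<Longrightarrow> smooth_on U f"
  by (simp add: smooth_on_def k_times_differentiable_on_bounded_linear linear_conv_bounded_linear)

lemma smooth_on_linear_compose:
  "open U \<Longrightarrow> linear g \<Longrightarrow> smooth_on U f \<Longrightarrow> smooth_on U (\<lambda>x. g (f x))"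
  by (simp add: smooth_on_def k_times_differentiable_on_linear_compose linear_conv_bounded_linear)

lemma smooth_on_add:
  "open U \<Longrightarrow> smooth_on U f \<Longrightarrow> smooth_on U g \<Longrightarrow> smooth_on U (\<lambda>x. f x + g x)"
  by (simp add: smooth_on_def k_times_differentiable_on_add)

lemma smooth_on_bilinear:
  "open U \<Longrightarrow> bounded_bilinear b \<Longrightarrow> smooth_on U f \<Longrightarrow> smooth_on U g \<Longrightarrow>
    smooth_on U (\<lambda>x. b (f x) (g x))"
  by (simp add: smooth_on_def k_times_differentiable_on_bilinear)

lemma smooth_on_diff:
  "open U \<Longrightarrow> smooth_on U f \<Longrightarrow> smooth_on U g \<Longrightarrow> smooth_on U (\<lambda>x. f x - g x)"
  using smooth_on_add[of U f "\<lambda>x. - g x"] smooth_on_linear_compose[of U uminus g]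
  by (simp add: bounded_linear.linear bounded_linear_minus)

lemma smooth_on_compose:
  "open U \<Longrightarrow> open V \<Longrightarrow> f ` U \<subseteq> V \<Longrightarrow> smooth_on U f \<Longrightarrow> smooth_on V g \<Longrightarrow>
    smooth_on U (\<lambda>x. g (f x))"
  by (auto simp: smooth_on_def intro: k_times_differentiable_on_compose)

lemma smooth_on_subset: "smooth_on V f \<Longrightarrow> open U \<Longrightarrow> open V \<Longrightarrow> U \<subseteq> V \<Longrightarrow> smooth_on U f"
  using smooth_on_compose[of U V "\<lambda>x. x" f] smooth_on_linear[of U "\<lambda>x. x"]
  by (auto simp: linear_iff)

lemma smooth_on_cong:
  "open U \<Longrightarrow> (\<And>x. x \<in> U \<Longrightarrow> f x = g x) \<Longrightarrow> smooth_on U f \<longleftrightarrow> smooth_on U g"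
  unfolding smooth_on_def using k_times_differentiable_on_cong by blast

lemma smooth_on_imp_continuous_on: "smooth_on U f \<Longrightarrow> continuous_on U f"
  unfolding smooth_on_def using k_times_differentiable_on.simps(1) by blast

text \<open>The derivative is a polynomial expression in \<open>inverse\<close> itself, so the
  induction on the order feeds on its own hypothesis. The square root works alike: its derivative is
  half the inverse of the root.\<close>

lemma smooth_on_inverse_id:
  "smooth_on (- {0}) (inverse :: 'a \<Rightarrow> 'a::{euclidean_space, real_normed_field})"
proof -
  have "k_times_differentiable_on k (- {0}) (inverse :: 'a \<Rightarrow> 'a)" for k
  proof (induction k)
    case (Suc k)
    have "((inverse :: 'a \<Rightarrow> 'a) has_derivative (\<lambda>v. - (inverse x * v * inverse x))) (at x)"
      if "x \<in> - {0}" for x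
      using that has_derivative_inverse' by blast
    moreover have "k_times_differentiable_on k (- {0}) (\<lambda>x::'a. - (inverse x * v * inverse x))" for v
      using Suc
      by (intro k_times_differentiable_on_linear_compose[OF _ bounded_linear_minus[OF bounded_linear_ident]]
        k_times_differentiable_on_bilinear[OF _ bounded_bilinear_mult] k_times_differentiable_on_const) auto
    ultimately show ?case
      by (subst k_times_differentiable_on_Suc_iff) auto
  qed (auto intro!: continuous_intros)
  then show ?thesis by (simp add: smooth_on_def)
qed

lemma smooth_on_sqrt: "smooth_on {0<..} sqrt"
proof -
  have "k_times_differentiable_on k {0<..} sqrt" for k
  proof (induction k)
    case (Suc k)
    have "(sqrt has_derivative (\<lambda>v. v * (inverse (sqrt x) / 2))) (at x)" if "x \<in> {0<..}" for x
    proof (rule has_derivative_eq_rhs)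
      show "(sqrt has_derivative (*) (inverse (sqrt x) / 2)) (at x)"
        using DERIV_real_sqrt[of x] that by (simp add: has_field_derivative_def)
      show "(*) (inverse (sqrt x) / 2) = (\<lambda>v. v * (inverse (sqrt x) / 2))"
        by (rule ext) (rule mult.commute)
    qed
    moreover have "k_times_differentiable_on k {0<..} (\<lambda>x. v * (inverse (sqrt x) / 2))" for v
    proof -
      have "k_times_differentiable_on k {0<..} (\<lambda>x. inverse (sqrt x))"
      proof (rule k_times_differentiable_on_compose[OF _ _ _ Suc])
        show "k_times_differentiable_on k (- {0}) (inverse :: real \<Rightarrow> real)"
          using smooth_on_inverse_id[where 'a = real] by (simp add: smooth_on_def)
      qed auto
      moreover have "bounded_linear (\<lambda>y::real. v * (y / 2))"
        unfolding linear_conv_bounded_linear[symmetric] by (rule linearI) (simp_all add: algebra_simps)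
      ultimately show ?thesis
        by (rule k_times_differentiable_on_linear_compose[OF open_greaterThan, rotated])
    qed
    ultimately show ?case
      by (subst k_times_differentiable_on_Suc_iff) auto
  qed (auto intro!: continuous_intros)
  then show ?thesis by (simp add: smooth_on_def)
qed

lemma smooth_on_inverse:
  fixes f :: "'a::euclidean_space \<Rightarrow> 'b::{euclidean_space, real_normed_field}"
  assumes "open U" "smooth_on U f" "\<And>x. x \<in> U \<Longrightarrow> f x \<noteq> 0"
  shows "smooth_on U (\<lambda>x. inverse (f x))"
  using assms smooth_on_inverse_id by (auto intro: smooth_on_compose[of U "- {0}" f inverse])

lemma smooth_on_mult:
  fixes f g :: "'a::euclidean_space \<Rightarrow> 'b::{euclidean_space, real_normed_field}"
  shows "open U \<Longrightarrow> smooth_on U f \<Longrightarrow> smooth_on U g \<Longrightarrow> smooth_on U (\<lambda>x. f x * g x)"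
  by (rule smooth_on_bilinear[OF _ bounded_bilinear_mult])

lemma smooth_on_divide:
  fixes f g :: "'a::euclidean_space \<Rightarrow> 'b::{euclidean_space, real_normed_field}"
  assumes "open U" "smooth_on U f" "smooth_on U g" "\<And>x. x \<in> U \<Longrightarrow> g x \<noteq> 0"
  shows "smooth_on U (\<lambda>x. f x / g x)"
  unfolding divide_inverse using assms by (intro smooth_on_mult smooth_on_inverse)

lemma smooth_on_inner:
  "open U \<Longrightarrow> smooth_on U f \<Longrightarrow> smooth_on U g \<Longrightarrow> smooth_on U (\<lambda>x. f x \<bullet> g x)"
  by (rule smooth_on_bilinear[OF _ bounded_bilinear_inner])

section \<open>Diffeomorphisms and the flattening of linear subspaces\<close>

lemma diffeomorphism_linear:
  assumes "linear f" "linear g" "\<And>x. g (f x) = x" "\<And>x. f (g x) = x" "open U"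
  shows "diffeomorphism U (f ` U) f g"
proof -
  have "bij f"
    using assms(3,4) by (intro bij_betw_byWitness[where f' = g]) auto
  then have "open (f ` U)"
    using open_bijective_linear_image_eq[OF assms(1)] assms(5) by blast
  moreover have "homeomorphism U (f ` U) f g"
    using assms by (auto simp: homeomorphism_def image_image linear_continuous_on linear_linear)
  ultimately show ?thesis
    unfolding diffeomorphism_def using assms(1,2,5) by (simp add: smooth_on_linear)
qed

lemma diffeomorphism_compose:
  assumes "diffeomorphism U V f f'" "diffeomorphism V W g g'"
  shows "diffeomorphism U W (g \<circ> f) (f' \<circ> g')"
proof -
  have "homeomorphism U W (g \<circ> f) (f' \<circ> g')"
    using homeomorphism_compose assms unfolding diffeomorphism_def by blast
  moreover have "smooth_on U (g \<circ> f)" "smooth_on W (f' \<circ> g')"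
    using assms smooth_on_compose[of U V f g] smooth_on_compose[of W V g' f']
    unfolding diffeomorphism_def comp_def homeomorphism_def by blast+
  ultimately show ?thesis
    using assms unfolding diffeomorphism_def by blast
qed

lemma diffeomorphism_restrict:
  assumes "diffeomorphism U V f g" "open V'" "V' \<subseteq> V"
  shows "diffeomorphism (g ` V') V' f g"
proof -
  have h: "homeomorphism U V f g" using assms by (simp add: diffeomorphism_def)
  then have fg: "\<And>x. x \<in> U \<Longrightarrow> g (f x) = x" "\<And>y. y \<in> V \<Longrightarrow> f (g y) = y" "f ` U = V" "g ` V = U"
    by (auto simp: homeomorphism_def)
  have sub: "g ` V' \<subseteq> U" using fg(4) assms(3) by blast
  have "g ` V' = U \<inter> f -` V'"
  proof
    show "g ` V' \<subseteq> U \<inter> f -` V'" using sub fg(2) assms(3) by auto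
    show "U \<inter> f -` V' \<subseteq> g ` V'"
    proof
      fix x assume "x \<in> U \<inter> f -` V'"
      then show "x \<in> g ` V'" using fg(1)[of x] by (intro image_eqI[of _ _ "f x"]) auto
    qed
  qed
  moreover have "open (U \<inter> f -` V')"
    using assms h unfolding diffeomorphism_def
    by (intro continuous_open_preimage) (auto simp: homeomorphism_def)
  ultimately have op: "open (g ` V')" by simp
  have "f ` g ` V' = V'"
    using fg(2) assms(3) by (simp add: image_image subset_eq)
  then have "homeomorphism (g ` V') V' f g"
    by (rule homeomorphism_of_subsets[OF h sub assms(3)])
  then show ?thesis
    using assms op sub smooth_on_subset[of U f "g ` V'"] smooth_on_subset[of V g V']
    unfolding diffeomorphism_def by simp
qed

text \<open>\<open>coordinate_slice\<close> freezes standard coordinates, so a general subspace must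
  first be moved to a coordinate subspace: a basis of K is completed to one of the whole space and
  matched with \<open>Basis\<close>.\<close>

lemma linear_flattening:
  fixes K :: "'a::euclidean_space set"
  assumes "subspace K"
  obtains f g :: "'a \<Rightarrow> 'a" and B where "linear f" "linear g" "\<And>x. g (f x) = x" "\<And>x. f (g x) = x"
    "B \<subseteq> Basis" "card B = dim K" "\<And>x. x \<in> K \<longleftrightarrow> (\<forall>b\<in>Basis - B. f x \<bullet> b = 0)"
proof -
  obtain C where C: "C \<subseteq> K" "independent C" "K \<subseteq> span C" "card C = dim K"
    by (rule basis_exists)
  obtain D where D: "C \<subseteq> D" "independent D" "span D = UNIV"
    using maximal_independent_subset_extend[of C UNIV] C(2) by (metis subset_UNIV top.extremum_uniqueI)
  have fin: "finite D" using D(2) by (rule finiteI_independent)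
  have "card D = card (Basis :: 'a set)"
    using D dim_eq_card_independent[OF D(2)] by (metis dim_UNIV dim_span)
  then obtain \<pi> where \<pi>: "bij_betw \<pi> D (Basis :: 'a set)"
    using fin finite_Basis finite_same_card_bij by blast
  define B where "B = \<pi> ` C"
  obtain f where f: "linear f" "\<And>x. x \<in> D \<Longrightarrow> f x = \<pi> x"
    using linear_independent_extend[OF D(2)] by metis
  obtain g where g: "linear g" "\<And>x. x \<in> Basis \<Longrightarrow> g x = inv_into D \<pi> x"
    using linear_independent_extend[OF independent_Basis] by metis
  have "g (f x) = x" if "x \<in> D" for x
    using that f(2) g(2) \<pi> by (metis bij_betwE bij_betw_inv_into_left)
  then have gf: "g (f x) = x" for x
    using linear_eq_on[OF linear_compose[OF f(1) g(1)] linear_id, of x D] D(3) by simp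
  have "f (g x) = x" if "x \<in> Basis" for x
    using that f(2) g(2) \<pi> by (metis bij_betw_def bij_betw_inv_into_right inv_into_into)
  then have fg: "f (g x) = x" for x
    using linear_eq_on[OF linear_compose[OF g(1) f(1)] linear_id, of x Basis] by simp
  have B: "B \<subseteq> Basis" using \<pi> D(1) unfolding B_def bij_betw_def by blast
  have "card B = dim K"
    unfolding B_def using C(4) D(1) \<pi> by (metis bij_betw_def card_image inj_on_subset)
  have fK: "f ` K = span B"
  proof -
    have "K = span C" using C assms by (meson span_minimal subset_antisym)
    then show ?thesis
      using f D(1) unfolding B_def by (metis image_cong linear_span_image subsetD)
  qed
  have "x \<in> K \<longleftrightarrow> (\<forall>b\<in>Basis - B. f x \<bullet> b = 0)" for x
  proof -
    have "x \<in> K \<longleftrightarrow> f x \<in> span B" using fK gf by (metis image_iff)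
    also have "\<dots> \<longleftrightarrow> (\<forall>b\<in>Basis - B. f x \<bullet> b = 0)"
      using span_substd_basis[OF B] by auto
    finally show ?thesis .
  qed
  then show ?thesis
    using f(1) g(1) gf fg B \<open>card B = dim K\<close> by (intro that[of f g B]) simp_all
qed

section \<open>Foliations with a global flat chart\<close>

text \<open>For an embedded leaf the subspace topology serves as leaf topology; the traces of a
  countable ambient base make it second countable, and W = L works at every point.\<close>

lemma connected_immersed_submanifold_embedded:
  assumes "embedded_submanifold k L" "connected L"
  shows "connected_immersed_submanifold k L"
proof -
  obtain \<B> :: "'a set set" where \<B>: "countable \<B>" "topological_basis \<B>"
    using ex_countable_basis by blast
  let ?C = "(\<lambda>W. L \<inter> W) ` \<B>"
  have "countable ?C" using \<B>(1) by simp
  moreover have "\<forall>W\<in>?C. openin (top_of_set L) W"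
    using topological_basis_open[OF \<B>(2)] by auto
  moreover have "\<exists>W'\<in>?C. x \<in> W' \<and> W' \<subseteq> W" if W: "openin (top_of_set L) W" "x \<in> W" for W x
  proof -
    obtain T where T: "open T" "W = L \<inter> T" using W(1) openin_open by blast
    obtain B where "B \<in> \<B>" "x \<in> B" "B \<subseteq> T"
      using topological_basisE[OF \<B>(2) T(1), of x] W(2) T(2) by blast
    then show ?thesis using T(2) W(2) by (intro bexI[of _ "L \<inter> B"]) auto
  qed
  moreover have "\<exists>W. openin (top_of_set L) W \<and> p \<in> W \<and> embedded_submanifold k W \<and>
      subtopology (top_of_set L) W = top_of_set W" if "p \<in> L" for p
    using that assms(1) by (intro exI[of _ L]) (simp add: subtopology_subtopology)
  ultimately show ?thesis
    unfolding connected_immersed_submanifold_def using assms(2)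
    by (intro exI[of _ "top_of_set L"] conjI exI[of _ ?C]) (auto simp: connectedin_def simp flip: connectedin_iff_connected)
qed

text \<open>After flattening K, the one chart sends every leaf to a single slice of a convex set.
  Convexity makes the leaf connected, and over a box the leaf is a single plaque.\<close>

lemma foliation_by_flat_leaves:
  fixes M :: "'a::euclidean_space set"
  assumes diffeo: "diffeomorphism M \<Omega> \<Phi> \<Psi>" and "convex \<Omega>" and K: "subspace K"
    and leaf: "\<And>p. p \<in> M \<Longrightarrow> L p = {q \<in> M. \<Phi> q - \<Phi> p \<in> K}"
  shows "foliation M (L ` M)"
proof -
  obtain f g :: "'a \<Rightarrow> 'a" and B where fg: "linear f" "linear g" "\<And>x. g (f x) = x" "\<And>x. f (g x) = x"
    and B: "B \<subseteq> Basis" "\<And>x. x \<in> K \<longleftrightarrow> (\<forall>b\<in>Basis - B. f x \<bullet> b = 0)"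
    using linear_flattening[OF K] by metis
  define F where "F = f \<circ> \<Phi>"
  define G where "G = \<Psi> \<circ> g"
  define \<Omega>' where "\<Omega>' = f ` \<Omega>"
  have "open \<Omega>" using diffeo by (simp add: diffeomorphism_def)
  then have FG: "diffeomorphism M \<Omega>' F G"
    unfolding F_def G_def \<Omega>'_def
    using diffeomorphism_compose[OF diffeo diffeomorphism_linear[OF fg]] by blast
  then have inv: "\<And>x. x \<in> M \<Longrightarrow> G (F x) = x" "\<And>y. y \<in> \<Omega>' \<Longrightarrow> F (G y) = y"
    and img: "G ` \<Omega>' = M" "F ` M = \<Omega>'" and "open \<Omega>'" and contG: "continuous_on \<Omega>' G"
    by (auto simp: diffeomorphism_def homeomorphism_def)
  have "convex \<Omega>'"
    unfolding \<Omega>'_def using fg(1) \<open>convex \<Omega>\<close> by (rule convex_linear_image)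
  have in_leaf: "q \<in> L p \<longleftrightarrow> q \<in> M \<and> (\<forall>b\<in>Basis - B. F q \<bullet> b = F p \<bullet> b)" if "p \<in> M" for p q
    using that leaf by (auto simp: B(2) F_def linear_diff[OF fg(1)] inner_diff_left)
  have slice: "F ` (L p \<inter> G ` W) = coordinate_slice B W (F p)" if "p \<in> M" "W \<subseteq> \<Omega>'" for p W
  proof
    show "F ` (L p \<inter> G ` W) \<subseteq> coordinate_slice B W (F p)"
      using that inv(2) in_leaf by (auto simp: coordinate_slice_def subset_eq)
    show "coordinate_slice B W (F p) \<subseteq> F ` (L p \<inter> G ` W)"
    proof
      fix y assume y: "y \<in> coordinate_slice B W (F p)"
      then have "y \<in> W" "y \<in> \<Omega>'" using that by (auto simp: coordinate_slice_def)
      moreover have "G y \<in> L p"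
        using y that img inv(2)[OF \<open>y \<in> \<Omega>'\<close>] \<open>y \<in> \<Omega>'\<close> by (auto simp: in_leaf coordinate_slice_def)
      ultimately show "y \<in> F ` (L p \<inter> G ` W)" using inv(2) by (metis IntI image_eqI)
    qed
  qed
  have sub: "L p \<subseteq> M" if "p \<in> M" for p using leaf[OF that] by auto
  have emb: "embedded_submanifold (card B) (L p)" if p: "p \<in> M" for p
    unfolding embedded_submanifold_def
  proof
    fix q assume "q \<in> L p"
    then show "\<exists>U V \<phi> \<psi> B' c. q \<in> U \<and> diffeomorphism U V \<phi> \<psi> \<and> B' \<subseteq> Basis \<and> card B' = card B \<and>
        \<phi> ` (L p \<inter> U) = coordinate_slice B' V c"
      using FG B(1) slice[OF p, of \<Omega>'] sub[OF p] unfolding img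
      by (intro exI[of _ M] exI[of _ \<Omega>'] exI[of _ F] exI[of _ G] exI[of _ B] exI[of _ "F p"]) auto
  qed
  have conn: "connected (L p)" if p: "p \<in> M" for p
  proof -
    have "coordinate_slice B \<Omega>' (F p) = \<Omega>' \<inter> (\<Inter>b\<in>Basis - B. {x. b \<bullet> x = F p \<bullet> b})"
      by (auto simp: coordinate_slice_def inner_commute)
    then have "convex (coordinate_slice B \<Omega>' (F p))"
      using \<open>convex \<Omega>'\<close> by (auto intro!: convex_Int convex_INT convex_hyperplane)
    moreover have "L p = G ` coordinate_slice B \<Omega>' (F p)"
    proof -
      have "F ` L p = coordinate_slice B \<Omega>' (F p)"
        using slice[OF p, of \<Omega>'] sub[OF p] by (simp add: img Int_absorb2)
      then have "G ` coordinate_slice B \<Omega>' (F p) = (\<lambda>x. G (F x)) ` L p"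
        by (metis image_image)
      also have "\<dots> = L p"
        using inv(1) sub[OF p] by (simp add: subset_eq)
      finally show ?thesis ..
    qed
    moreover have "continuous_on (coordinate_slice B \<Omega>' (F p)) G"
      using contG by (rule continuous_on_subset) (auto simp: coordinate_slice_def)
    ultimately show ?thesis
      by (simp add: connected_continuous_image convex_connected)
  qed
  have chart: "\<exists>U a b \<phi> \<psi> B'. p \<in> U \<and> U \<subseteq> M \<and> diffeomorphism U (box a b) \<phi> \<psi> \<and>
      B' \<subseteq> Basis \<and> card B' = card B \<and>
      (\<forall>X\<in>L ` M. \<exists>C. countable C \<and> \<phi> ` (X \<inter> U) = (\<Union>c\<in>C. coordinate_slice B' (box a b) c))"
    if p: "p \<in> M" for p
  proof -
    have "F p \<in> \<Omega>'" using img p by blast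
    then obtain a b where ab: "F p \<in> box a b" "box a b \<subseteq> \<Omega>'"
      using open_contains_cbox[OF \<open>open \<Omega>'\<close>] box_subset_cbox by (metis subset_trans)
    have "p \<in> G ` box a b" using ab(1) inv(1)[OF p] by (metis image_eqI)
    moreover have "G ` box a b \<subseteq> M" using ab(2) img(1) by blast
    moreover have "diffeomorphism (G ` box a b) (box a b) F G"
      using FG ab(2) by (intro diffeomorphism_restrict) (auto simp: open_box)
    moreover have "\<exists>C. countable C \<and> F ` (X \<inter> G ` box a b) = (\<Union>c\<in>C. coordinate_slice B (box a b) c)"
      if X: "X \<in> L ` M" for X
    proof -
      obtain q where "q \<in> M" "X = L q" using X by blast
      \<comment> \<open>A leaf meets the box in one slice, possibly an empty one, so a single
        parameter serves as the countable family.\<close>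
      then show ?thesis by (intro exI[of _ "{F q}"]) (simp add: slice[OF _ ab(2)])
    qed
    ultimately show ?thesis
      using B(1) by (intro exI[of _ "G ` box a b"] exI[of _ a] exI[of _ b] exI[of _ F] exI[of _ G] exI[of _ B]) simp
  qed
  have "disjoint (L ` M)"
  proof (rule disjointI)
    fix X Y assume "X \<in> L ` M" "Y \<in> L ` M" "X \<noteq> Y"
    then obtain p q where pq: "p \<in> M" "q \<in> M" "X = L p" "Y = L q" by blast
    show "X \<inter> Y = {}"
    proof (rule ccontr)
      assume "X \<inter> Y \<noteq> {}"
      then obtain x where "x \<in> L p" "x \<in> L q" using pq by blast
      then have "L p = L q" using in_leaf pq(1,2) by auto
      then show False using \<open>X \<noteq> Y\<close> pq by simp
    qed
  qed
  moreover have "\<Union>(L ` M) = M" using sub in_leaf by auto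
  moreover have "L p \<noteq> {}" if "p \<in> M" for p using in_leaf[OF that] that by blast
  moreover have "connected_immersed_submanifold (card B) (L p)" if "p \<in> M" for p
    using emb[OF that] conn[OF that] by (rule connected_immersed_submanifold_embedded)
  ultimately show ?thesis
    unfolding foliation_def using chart by (intro conjI exI[of _ "card B"]) auto
qed

lemma embedded_submanifold_subspace_Int:
  fixes K :: "'a::euclidean_space set"
  assumes "subspace K" "open M"
  shows "embedded_submanifold (dim K) (M \<inter> K)"
proof -
  obtain f g :: "'a \<Rightarrow> 'a" and B where fg: "linear f" "linear g" "\<And>x. g (f x) = x" "\<And>x. f (g x) = x"
    and B: "B \<subseteq> Basis" "card B = dim K" "\<And>x. x \<in> K \<longleftrightarrow> (\<forall>b\<in>Basis - B. f x \<bullet> b = 0)"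
    using linear_flattening[OF assms(1)] by metis
  have "f ` (M \<inter> K \<inter> M) = coordinate_slice B (f ` M) 0"
    by (auto simp: coordinate_slice_def B(3))
  then show ?thesis
    unfolding embedded_submanifold_def
    using diffeomorphism_linear[OF fg assms(2)] B(1,2) by blast
qed

text \<open>Pairing with a vector orthogonal to K annihilates the whole curve, hence its velocity;
  and K is its own double orthogonal complement.\<close>

lemma tangent_space_subset_subspace:
  fixes K :: "'a::euclidean_space set"
  assumes "subspace K" "S \<subseteq> K"
  shows "tangent_space S p \<subseteq> K"
proof
  fix v assume "v \<in> tangent_space S p"
  then obtain \<gamma> e where \<gamma>: "(e::real) > 0" "\<gamma> ` {-e<..<e} \<subseteq> S" "(\<gamma> has_vector_derivative v) (at 0)"
    unfolding tangent_space_def by blast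
  have "orthogonal v q" if q: "q \<in> orthogonal_comp K" for q
  proof -
    have "((\<lambda>t. \<gamma> t \<bullet> q) has_vector_derivative (v \<bullet> q)) (at 0)"
      by (rule bounded_linear.has_vector_derivative[OF bounded_linear_inner_left \<gamma>(3)])
    moreover have "((\<lambda>t. \<gamma> t \<bullet> q) has_vector_derivative 0) (at 0)"
    proof (rule has_vector_derivative_transform_within_open[of "\<lambda>_. 0" _ _ "{-e<..<e}"])
      fix t assume "t \<in> {-e<..<e}"
      then have "\<gamma> t \<in> K" using \<gamma>(2) assms(2) by blast
      then show "0 = \<gamma> t \<bullet> q" using q by (simp add: orthogonal_comp_def orthogonal_def)
    qed (use \<gamma>(1) in auto)
    ultimately show ?thesis
      unfolding orthogonal_def using vector_derivative_unique_at by blast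
  qed
  then have "v \<in> orthogonal_comp (orthogonal_comp K)"
    by (auto simp: orthogonal_comp_def orthogonal_commute)
  then show "v \<in> K" using orthogonal_comp_self[OF assms(1)] by simp
qed

section \<open>The matrix exponential\<close>

lemma matrix_power_vec: "((**) X ^^ k) (mat 1) *v y = ((*v) X ^^ k) y"
  for X :: "complex^'m^'m"
  by (induction k) (simp_all flip: matrix_vector_mul_assoc)

lemma bounded_bilinear_matrix_mult:
  "bounded_bilinear ((**) :: complex^'m^'m \<Rightarrow> complex^'m^'m \<Rightarrow> complex^'m^'m)"
  unfolding bilinear_conv_bounded_bilinear[symmetric] bilinear_def
  by (intro conjI allI linearI)
    (simp_all add: matrix_matrix_mult_def vec_eq_iff sum.distrib distrib_left distrib_right scaleR_sum_right)

lemma matrix_power_bound: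
  fixes X :: "complex^'m^'m"
  obtains C M where "C \<ge> 0" "M \<ge> 0" "\<And>k. norm (((**) X ^^ k) (mat 1)) \<le> C * M ^ k"
proof -
  \<comment> \<open>Boundedness of the bilinear product gives submultiplicativity up to a constant
    K, which is absorbed into the base of the geometric bound.\<close>
  obtain K where K: "K > 0" "\<And>(A :: complex^'m^'m) (B :: complex^'m^'m). norm (A ** B) \<le> norm A * norm B * K"
    using bounded_bilinear.pos_bounded[OF bounded_bilinear_matrix_mult[where 'm = 'm]] by metis
  have "norm (((**) X ^^ k) (mat 1)) \<le> norm (mat 1 :: complex^'m^'m) * (norm X * K) ^ k" for k
  proof (induction k)
    case (Suc k)
    have "norm (((**) X ^^ Suc k) (mat 1)) \<le> norm X * norm (((**) X ^^ k) (mat 1)) * K"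
      using K(2) by simp
    also have "\<dots> = norm (((**) X ^^ k) (mat 1)) * (norm X * K)" by simp
    also have "\<dots> \<le> (norm (mat 1 :: complex^'m^'m) * (norm X * K) ^ k) * (norm X * K)"
      using K(1) by (intro mult_right_mono Suc.IH) simp
    finally show ?case by (simp add: algebra_simps)
  qed simp
  then show ?thesis using K(1) by (intro that[of "norm (mat 1 :: complex^'m^'m)" "norm X * K"]) auto
qed

text \<open>\<open>mexp\<close> is an infinite sum of matrices: the geometric bound on the powers
  gives convergence, and only then may a linear map be applied term by term.\<close>

lemma mexp_sums:
  fixes X :: "complex^'m^'m" and f :: "complex^'m^'m \<Rightarrow> 'b::euclidean_space"
  assumes "linear f"
  shows "(\<lambda>k. (1 / fact k) *\<^sub>R f (((**) X ^^ k) (mat 1))) sums f (mexp X)"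
proof -
  obtain C M where CM: "C \<ge> 0" "M \<ge> 0" "\<And>k. norm (((**) X ^^ k) (mat 1)) \<le> C * M ^ k"
    using matrix_power_bound by metis
  have "summable (\<lambda>k. C * (inverse (fact k) * M ^ k))"
    by (intro summable_mult summable_exp)
  then have "summable (\<lambda>k. (1 / fact k) *\<^sub>R ((**) X ^^ k) (mat 1))"
  proof (rule summable_comparison_test'[where N = 0])
    show "norm ((1 / fact k) *\<^sub>R ((**) X ^^ k) (mat 1)) \<le> C * (inverse (fact k) * M ^ k)" for k
      using mult_right_mono[OF CM(3)[of k], of "inverse (fact k)"]
      by (simp add: divide_inverse mult_ac)
  qed
  then have "(\<lambda>k. (1 / fact k) *\<^sub>R ((**) X ^^ k) (mat 1)) sums mexp X"
    unfolding mexp_def by (rule summable_sums)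
  then have "(\<lambda>k. f ((1 / fact k) *\<^sub>R ((**) X ^^ k) (mat 1))) sums f (mexp X)"
    by (rule bounded_linear.sums[OF assms[unfolded linear_conv_bounded_linear]])
  then show ?thesis by (simp add: linear_cmul[OF assms])
qed

lemma mexp_vec_sums:
  fixes X :: "complex^'m^'m" and l :: "complex^'m \<Rightarrow> 'b::euclidean_space"
  assumes "linear l"
  shows "(\<lambda>k. (1 / fact k) *\<^sub>R l (((*v) X ^^ k) y)) sums l (mexp X *v y)"
proof -
  have "linear (\<lambda>A::complex^'m^'m. A *v y)"
    by (rule linearI)
      (simp_all add: matrix_vector_mult_def vec_eq_iff sum.distrib distrib_right scaleR_sum_right)
  then have "linear (\<lambda>A. l (A *v y))"
    using linear_compose[OF _ assms, of "\<lambda>A. A *v y"] by (simp add: comp_def)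
  then show ?thesis
    using mexp_sums[of "\<lambda>A. l (A *v y)" X] by (simp only: matrix_power_vec)
qed

text \<open>Functionals that \<open>X\<close> multiplies by a scalar, or sends to such functionals, can be evaluated
  on \<open>mexp X\<close> without a closed form of the exponential.\<close>

lemma mexp_eigenfunctional:
  fixes X :: "complex^'m^'m" and l :: "complex^'m \<Rightarrow> complex"
  assumes "linear l" "\<And>y. l (X *v y) = c * l y"
  shows "l (mexp X *v y) = exp c * l y"
proof -
  have "l (((*v) X ^^ k) y) = c ^ k * l y" for k
    by (induction k) (simp_all add: assms(2))
  then have "(\<lambda>k. (c ^ k /\<^sub>R fact k) * l y) sums l (mexp X *v y)"
    using mexp_vec_sums[OF assms(1), of X y] by (simp add: divide_inverse)
  moreover have "(\<lambda>k. (c ^ k /\<^sub>R fact k) * l y) sums (exp c * l y)"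
    by (intro sums_mult2 exp_converges)
  ultimately show ?thesis by (rule sums_unique2)
qed

text \<open>The entire function (exp s - 1) / s with its singularity at 0 filled in. It is the
  factor by which a translation grows along a flow that also scales.\<close>

definition exp_quot :: "real \<Rightarrow> real" where
  "exp_quot s = (\<Sum>k. s ^ k / fact (Suc k))"

lemma exp_quot_0: "exp_quot 0 = 1"
proof -
  have "exp_quot 0 = (\<Sum>k. (1 / fact (Suc k)) * 0 ^ k)"
    by (simp add: exp_quot_def)
  also have "\<dots> = 1"
    by (subst powser_zero) simp
  finally show ?thesis .
qed

lemma mexp_second_order_functional:
  fixes X :: "complex^'m^'m" and l m :: "complex^'m \<Rightarrow> complex"
  assumes "linear l" "\<And>y. l (X *v y) = b * m y" "\<And>y. m (X *v y) = of_real s * m y"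
  shows "l (mexp X *v y) = l y + of_real (exp_quot s) * (b * m y)"
proof -
  have m: "m (((*v) X ^^ k) y) = of_real s ^ k * m y" for k
    by (induction k) (simp_all add: assms(3))
  have "summable (\<lambda>k. s ^ k / fact (Suc k))"
  proof (rule summable_comparison_test'[where N = 0])
    show "summable (\<lambda>k. inverse (fact k) * \<bar>s\<bar> ^ k)" by (rule summable_exp)
    show "norm (s ^ k / fact (Suc k)) \<le> inverse (fact k) * \<bar>s\<bar> ^ k" for k
    proof -
      have "\<bar>s\<bar> ^ k / fact (Suc k) \<le> \<bar>s\<bar> ^ k / fact k"
        by (intro divide_left_mono fact_mono) simp_all
      then show ?thesis
        by (simp add: power_abs abs_mult divide_inverse_commute del: fact_Suc)
    qed
  qed
  then have "(\<lambda>k. s ^ k / fact (Suc k)) sums exp_quot s"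
    unfolding exp_quot_def by (rule summable_sums)
  then have "(\<lambda>k. of_real (s ^ k / fact (Suc k)) * (b * m y)) sums (of_real (exp_quot s) * (b * m y))"
    by (intro sums_mult2 sums_of_real)
  \<comment> \<open>Off by one: the first application of X turns l into b * m, and only the
    remaining k of the \<open>Suc k\<close> factors act by s. The term of index 0, which is l y, is
    added back by \<open>sums_Suc\<close>.\<close>
  moreover have "(1 / fact (Suc k)) *\<^sub>R l (((*v) X ^^ Suc k) y)
      = of_real (s ^ k / fact (Suc k)) * (b * m y)" for k
    by (simp add: assms(2) m scaleR_conv_of_real del: fact_Suc)
  ultimately have "(\<lambda>k. (1 / fact (Suc k)) *\<^sub>R l (((*v) X ^^ Suc k) y)) sums (of_real (exp_quot s) * (b * m y))"
    by presburger
  then have "(\<lambda>k. (1 / fact k) *\<^sub>R l (((*v) X ^^ k) y)) sums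
      (of_real (exp_quot s) * (b * m y) + (1 / fact 0) *\<^sub>R l (((*v) X ^^ 0) y))"
    by (rule sums_Suc)
  then have "l (mexp X *v y) = of_real (exp_quot s) * (b * m y) + (1 / fact 0) *\<^sub>R l (((*v) X ^^ 0) y)"
    using mexp_vec_sums[OF assms(1), of X y] by (rule sums_unique2[rotated])
  then show ?thesis by simp
qed

text \<open>Each entry is an everywhere convergent power series in t, so it may be differentiated
  termwise in a complex variable and then restricted to real t. At 0 only the coefficient of t
  survives.\<close>

lemma mexp_has_vector_derivative:
  fixes X :: "complex^'m^'m"
  shows "((\<lambda>t. mexp (t *\<^sub>R X) *v y) has_vector_derivative X *v y) (at 0)"
proof -
  have "((\<lambda>t. (mexp (t *\<^sub>R X) *v y) $ i) has_vector_derivative (X *v y) $ i) (at 0)" for i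
  proof -
    define c where "c k = (((*v) X ^^ k) y $ i) / fact k" for k
    obtain C M where CM: "C \<ge> 0" "M \<ge> 0" "\<And>k. norm (((**) X ^^ k) (mat 1)) \<le> C * M ^ k"
      using matrix_power_bound by metis
    have "linear (\<lambda>A::complex^'m^'m. (A *v y) $ i)"
      by (rule linearI)
        (simp_all add: matrix_vector_mult_def sum.distrib distrib_right scaleR_sum_right)
    then obtain K where K: "K \<ge> 0" "\<And>A::complex^'m^'m. norm ((A *v y) $ i) \<le> norm A * K"
      unfolding linear_conv_bounded_linear using bounded_linear.nonneg_bounded by metis
    have "summable (\<lambda>k. c k * x ^ k)" for x
    proof (rule summable_comparison_test'[where N = 0])
      show "summable (\<lambda>k. (C * K) * (inverse (fact k) * (M * norm x) ^ k))"
        by (intro summable_mult summable_exp)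
      fix k
      have "norm (((*v) X ^^ k) y $ i) \<le> C * M ^ k * K"
        using K(2)[of "((**) X ^^ k) (mat 1)"] mult_right_mono[OF CM(3)[of k] K(1)]
        by (simp add: matrix_power_vec)
      then have "norm (((*v) X ^^ k) y $ i) * (norm x ^ k / fact k) \<le> (C * M ^ k * K) * (norm x ^ k / fact k)"
        by (rule mult_right_mono) simp
      then show "norm (c k * x ^ k) \<le> (C * K) * (inverse (fact k) * (M * norm x) ^ k)"
        by (simp add: c_def norm_mult norm_divide norm_power field_simps)
    qed
    then have "((\<lambda>x. \<Sum>k. c k * x ^ k) has_field_derivative (\<Sum>k. diffs c k * 0 ^ k)) (at (of_real 0))"
      using termdiffs_strong_converges_everywhere[of c 0] by simp
    then have "((\<lambda>t. \<Sum>k. c k * of_real t ^ k) has_vector_derivative (\<Sum>k. diffs c k * 0 ^ k)) (at 0)"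
      by (rule has_vector_derivative_real_field)
    moreover have "(\<Sum>k. diffs c k * 0 ^ k) = (X *v y) $ i"
      by (simp add: powser_zero diffs_def c_def)
    moreover have "(\<Sum>k. c k * of_real t ^ k) = (mexp (t *\<^sub>R X) *v y) $ i" for t
    proof -
      have sc: "(r *\<^sub>R X) *v z = r *\<^sub>R (X *v z)" "X *v (r *\<^sub>R z) = r *\<^sub>R (X *v z)" for r z
        by (simp_all add: matrix_vector_mult_def vec_eq_iff scaleR_sum_right)
      have "((*v) (t *\<^sub>R X) ^^ k) y = (t ^ k) *\<^sub>R ((*v) X ^^ k) y" for k
        by (induction k) (simp_all add: sc)
      then have "(1 / fact k) *\<^sub>R (((*v) (t *\<^sub>R X) ^^ k) y $ i) = c k * of_real t ^ k" for k
        by (simp only: vector_scaleR_component c_def) (simp add: scaleR_conv_of_real)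
      moreover have "linear (\<lambda>v::complex^'m. v $ i)"
        by (rule linearI) simp_all
      ultimately have "(\<lambda>k. c k * of_real t ^ k) sums (mexp (t *\<^sub>R X) *v y) $ i"
        using mexp_vec_sums[of "\<lambda>v. v $ i" "t *\<^sub>R X" y] by presburger
      then show ?thesis by (rule sums_unique[symmetric])
    qed
    ultimately show ?thesis by simp
  qed
  then have "((\<lambda>t. (mexp (t *\<^sub>R X) *v y) $ i \<bullet> b) has_derivative (\<lambda>t. (t *\<^sub>R (X *v y) $ i) \<bullet> b)) (at 0)" for i b
    unfolding has_vector_derivative_def by (rule has_derivative_inner_left)
  then have "((\<lambda>t. (mexp (t *\<^sub>R X) *v y) \<bullet> axis i b) has_derivative (\<lambda>t. (t *\<^sub>R (X *v y)) \<bullet> axis i b)) (at 0)" for i b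
    by (simp only: inner_axis vector_scaleR_component)
  then have "\<forall>e\<in>Basis. ((\<lambda>t. (mexp (t *\<^sub>R X) *v y) \<bullet> e) has_derivative (\<lambda>t. (t *\<^sub>R (X *v y)) \<bullet> e)) (at 0)"
    unfolding Basis_vec_def by blast
  then show ?thesis
    unfolding has_vector_derivative_def by (rule has_derivative_componentwise_within[THEN iffD2])
qed

section \<open>The action of SU(1,n) on the ball\<close>

text \<open>Homogeneous coordinates with a free time coordinate: \<open>hc 1 z\<close> lifts a
  point, \<open>hc 0 v\<close> a tangent vector, and for |u| = 1 the null vector
  \<open>hc 1 u\<close> represents a boundary point.\<close>

definition hc :: "complex \<Rightarrow> complex^'n::finite \<Rightarrow> complex^('n option)" where
  "hc c z = (\<chi> i. case i of None \<Rightarrow> c | Some j \<Rightarrow> z $ j)"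

lemma hc_nth [simp]: "hc c z $ None = c" "hc c z $ Some j = z $ j"
  by (simp_all add: hc_def)

lemma homogeneous_coords_eq: "homogeneous_coords z = hc 1 z"
  by (simp add: homogeneous_coords_def hc_def)

lemma vec_option_eq_iff: "x = y \<longleftrightarrow> x $ None = y $ None \<and> (\<forall>j. x $ Some j = y $ Some j)"
  by (auto simp: vec_eq_iff split: option.split) (metis option.exhaust)

lemma hc_eq_iff [simp]: "hc c z = hc d w \<longleftrightarrow> c = d \<and> z = w"
  by (auto simp: vec_option_eq_iff) (simp add: vec_eq_iff)

lemma hc_cases: obtains c z where "y = hc c z"
  using that[of "y $ None" "\<chi> j. y $ Some j"] by (simp add: vec_option_eq_iff)

lemma hc_add: "hc c z + hc d w = hc (c + d) (z + w)"
  and hc_diff: "hc c z - hc d w = hc (c - d) (z - w)"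
  and hc_smult: "a *s hc c z = hc (a * c) (a *s z)"
  and hc_scaleR: "r *\<^sub>R hc c z = hc (r *\<^sub>R c) (r *\<^sub>R z)"
  and hc_0: "hc 0 0 = 0"
  by (simp_all add: vec_option_eq_iff)

lemma cinner_add_left: "cinner (x + y) z = cinner x z + cinner y z"
  and cinner_add_right: "cinner z (x + y) = cinner z x + cinner z y"
  and cinner_diff_left: "cinner (x - y) z = cinner x z - cinner y z"
  and cinner_diff_right: "cinner z (x - y) = cinner z x - cinner z y"
  and cinner_smult_left: "cinner (c *s x) z = c * cinner x z"
  and cinner_smult_right: "cinner z (c *s x) = cnj c * cinner z x"
  and cinner_scaleR_left: "cinner (r *\<^sub>R x) z = of_real r * cinner x z"
  and cinner_scaleR_right: "cinner z (r *\<^sub>R x) = of_real r * cinner z x"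
  and cinner_minus_left: "cinner (- x) z = - cinner x z"
  and cinner_minus_right: "cinner z (- x) = - cinner z x"
  and cinner_0_left: "cinner 0 z = 0"
  and cinner_0_right: "cinner z 0 = 0"
  by (simp_all add: cinner_def sum.distrib sum_subtractf sum_distrib_left sum_negf algebra_simps
      scaleR_conv_of_real[where 'a = complex])

lemma cnj_cinner: "cnj (cinner x y) = cinner y x"
  by (simp add: cinner_def mult.commute)

lemma Re_cinner: "Re (cinner x y) = x \<bullet> y"
  by (simp add: cinner_def inner_vec_def inner_complex_def)

lemma cinner_self: "cinner x x = of_real ((norm x)\<^sup>2)"
proof (rule complex_eqI)
  show "Re (cinner x x) = Re (of_real ((norm x)\<^sup>2))"
    by (simp add: Re_cinner power2_norm_eq_inner)
  show "Im (cinner x x) = Im (of_real ((norm x)\<^sup>2))"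
    using arg_cong[OF cnj_cinner[of x x], of Im] by simp
qed

lemmas cinner_simps = cinner_add_left cinner_add_right cinner_diff_left cinner_diff_right
  cinner_smult_left cinner_smult_right cinner_scaleR_left cinner_scaleR_right cinner_minus_left
  cinner_minus_right cinner_0_left cinner_0_right

lemma herm_form_hc: "herm_form (hc c z) (hc d w) = cinner z w - c * cnj d"
  by (simp add: herm_form_def cinner_def)

lemma herm_form_add_left: "herm_form (x + y) z = herm_form x z + herm_form y z"
  and herm_form_add_right: "herm_form z (x + y) = herm_form z x + herm_form z y"
  and herm_form_diff_left: "herm_form (x - y) z = herm_form x z - herm_form y z"
  and herm_form_diff_right: "herm_form z (x - y) = herm_form z x - herm_form z y"
  and herm_form_smult_left: "herm_form (c *s x) z = c * herm_form x z"
  and herm_form_smult_right: "herm_form z (c *s x) = cnj c * herm_form z x"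
  and herm_form_scaleR_left: "herm_form (r *\<^sub>R x) z = of_real r * herm_form x z"
  and herm_form_0_left: "herm_form 0 z = 0"
  and herm_form_0_right: "herm_form z 0 = 0"
  by (simp_all add: herm_form_def sum.distrib sum_subtractf sum_distrib_left algebra_simps
      scaleR_conv_of_real[where 'a = complex])

lemmas herm_form_simps = herm_form_add_left herm_form_add_right herm_form_diff_left
  herm_form_diff_right herm_form_smult_left herm_form_smult_right herm_form_scaleR_left
  herm_form_0_left herm_form_0_right

lemma cnj_herm_form: "cnj (herm_form x y) = herm_form y x"
  by (simp add: herm_form_def mult.commute)

lemma linear_herm_form: "linear (\<lambda>x. herm_form x y)"
  by (rule linearI) (simp_all add: herm_form_simps scaleR_conv_of_real[where 'a = complex])

lemma herm_form_point: "herm_form (hc 1 z) (hc 1 z) = of_real ((norm z)\<^sup>2 - 1)"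
  by (simp add: herm_form_hc cinner_self)

lemma matrix_vector_smult: "A *v (c *s x) = c *s (A *v x)"
  for A :: "complex^'m^'n"
  by (simp add: matrix_vector_mult_def vec_eq_iff sum_distrib_left mult_ac)

lemma SU_herm_form: "A \<in> SU \<Longrightarrow> herm_form (A *v x) (A *v y) = herm_form x y"
  by (simp add: SU_def)

lemma mem_CH: "z \<in> CH \<longleftrightarrow> (norm z)\<^sup>2 < 1"
  by (simp add: CH_def power2_eq_square abs_square_less_1[unfolded power2_eq_square])

text \<open>The image of \<open>hc 1 z\<close> is again negative for the form, so its time
  coordinate c cannot vanish: the quotient in \<open>CH_act\<close> is genuine and lies in the
  ball.\<close>

lemma CH_act_lift:
  assumes "A \<in> SU" "z \<in> CH"
  obtains c where "c \<noteq> 0" "A *v hc 1 z = c *s hc 1 (CH_act A z)" "CH_act A z \<in> CH"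
    "c = (A *v hc 1 z) $ None"
proof -
  obtain c w where cw: "A *v hc 1 z = hc c w" using hc_cases by metis
  have h: "herm_form (hc c w) (hc c w) = of_real ((norm z)\<^sup>2 - 1)"
    using SU_herm_form[OF assms(1)] herm_form_point by (metis cw)
  then have r: "(norm w)\<^sup>2 - (cmod c)\<^sup>2 = (norm z)\<^sup>2 - 1"
    by (simp add: herm_form_hc cinner_self complex_norm_square[symmetric] flip: of_real_diff
        del: of_real_power)
  moreover have "(norm z)\<^sup>2 < 1" using assms(2) by (simp add: mem_CH)
  ultimately have lt: "(norm w)\<^sup>2 < (cmod c)\<^sup>2" by simp
  then have "c \<noteq> 0" by auto
  have eq: "CH_act A z = (1 / c) *s w"
    by (simp add: CH_act_def homogeneous_coords_eq cw vec_eq_iff)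
  then have "hc c w = c *s hc 1 (CH_act A z)"
    using \<open>c \<noteq> 0\<close> by (simp add: hc_smult)
  moreover have "CH_act A z \<in> CH"
  proof -
    have "of_real ((norm (CH_act A z))\<^sup>2) = cinner w w / of_real ((cmod c)\<^sup>2)"
      unfolding eq cinner_self[symmetric]
      by (simp add: cinner_simps complex_norm_square mult.commute del: of_real_power)
    then have "(norm (CH_act A z))\<^sup>2 = (norm w)\<^sup>2 / (cmod c)\<^sup>2"
      unfolding cinner_self of_real_divide[symmetric] of_real_eq_iff .
    then show ?thesis using lt \<open>c \<noteq> 0\<close> by (simp add: mem_CH)
  qed
  ultimately show ?thesis
    using \<open>c \<noteq> 0\<close> cw by (intro that[of c]) simp_all
qed

lemma CH_act_eqI:
  assumes "A *v hc 1 z = c *s hc 1 w" "c \<noteq> 0"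
  shows "CH_act A z = w"
  using assms by (simp add: CH_act_def homogeneous_coords_eq hc_smult vec_eq_iff)

lemma CH_act_mem: "A \<in> SU \<Longrightarrow> z \<in> CH \<Longrightarrow> CH_act A z \<in> CH"
  by (erule (1) CH_act_lift)

lemma CH_act_mat_1: "CH_act (mat 1) z = z"
  by (rule CH_act_eqI[where c = 1]) simp_all

lemma CH_act_mult:
  assumes "A \<in> SU" "B \<in> SU" "z \<in> CH"
  shows "CH_act (A ** B) z = CH_act A (CH_act B z)"
proof -
  obtain c where c: "c \<noteq> 0" "B *v hc 1 z = c *s hc 1 (CH_act B z)" "CH_act B z \<in> CH"
    using CH_act_lift[OF assms(2,3)] by metis
  obtain d where d: "d \<noteq> 0" "A *v hc 1 (CH_act B z) = d *s hc 1 (CH_act A (CH_act B z))"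
    using CH_act_lift[OF assms(1) c(3)] by metis
  have "(A ** B) *v hc 1 z = (c * d) *s hc 1 (CH_act A (CH_act B z))"
    by (simp add: c(2) d(2) matrix_vector_smult flip: matrix_vector_mul_assoc)
  then show ?thesis by (rule CH_act_eqI) (use c(1) d(1) in simp)
qed

lemma bounded_bilinear_smult: "bounded_bilinear ((*s) :: complex \<Rightarrow> complex^'n \<Rightarrow> complex^'n)"
  unfolding bilinear_conv_bounded_bilinear[symmetric] bilinear_def
  by (intro conjI allI linearI) (simp_all add: vec_eq_iff distrib_left distrib_right)

lemma linear_matrix_hc_None: "linear (\<lambda>z. (A *v hc 0 z) $ None)"
  and linear_matrix_hc_Some: "linear (\<lambda>z. \<chi> j. (A *v hc 0 z) $ Some j)"
proof -
  have add: "A *v hc 0 (x + y) = A *v hc 0 x + A *v hc 0 y" for x y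
    using hc_add[of 0 x 0 y] by (simp flip: matrix_vector_right_distrib)
  have "hc 0 (r *\<^sub>R x) = of_real r *s hc 0 x" for r and x :: "complex^'a"
    by (simp add: vec_option_eq_iff scaleR_conv_of_real[where 'a = complex])
  then have scale: "A *v hc 0 (r *\<^sub>R x) = of_real r *s (A *v hc 0 x)" for r x
    by (simp add: matrix_vector_smult)
  show "linear (\<lambda>z. (A *v hc 0 z) $ None)" "linear (\<lambda>z. \<chi> j. (A *v hc 0 z) $ Some j)"
    by (auto intro!: linearI simp: add scale vec_eq_iff scaleR_conv_of_real[where 'a = complex])
qed

lemma matrix_hc_1: "A *v hc 1 z = A *v hc 1 0 + A *v hc 0 z"
  by (simp add: hc_add flip: matrix_vector_right_distrib)

lemma matrix_hc_1_None: "(A *v hc 1 z) $ None = (A *v hc 1 0) $ None + (A *v hc 0 z) $ None"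
  and matrix_hc_1_Some: "(\<chi> j. (A *v hc 1 z) $ Some j)
    = (\<chi> j. (A *v hc 1 0) $ Some j) + (\<chi> j. (A *v hc 0 z) $ Some j)"
  by (subst matrix_hc_1, simp add: vec_eq_iff)+

lemma CH_act_altdef:
  "CH_act A z = inverse ((A *v hc 1 z) $ None) *s (\<chi> j. (A *v hc 1 z) $ Some j)"
  by (simp add: CH_act_def homogeneous_coords_eq vec_eq_iff divide_inverse mult.commute)

lemma open_CH: "open CH"
  by (simp add: CH_def)

lemma smooth_on_CH_act:
  assumes "A \<in> SU"
  shows "smooth_on CH (CH_act A)"
proof -
  have N: "smooth_on CH (\<lambda>z. (A *v hc 1 z) $ None)"
    by (subst matrix_hc_1_None)
      (intro smooth_on_add open_CH smooth_on_const smooth_on_linear linear_matrix_hc_None)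
  have S: "smooth_on CH (\<lambda>z. \<chi> j. (A *v hc 1 z) $ Some j)"
    by (subst matrix_hc_1_Some)
      (intro smooth_on_add open_CH smooth_on_const smooth_on_linear linear_matrix_hc_Some)
  have "smooth_on CH (\<lambda>z. inverse ((A *v hc 1 z) $ None) *s (\<chi> j. (A *v hc 1 z) $ Some j))"
  proof (rule smooth_on_bilinear[OF open_CH bounded_bilinear_smult _ S])
    show "smooth_on CH (\<lambda>z. inverse ((A *v hc 1 z) $ None))"
      using CH_act_lift[OF assms] by (intro smooth_on_inverse open_CH N) metis
  qed
  then show ?thesis by (subst smooth_on_cong[OF open_CH CH_act_altdef])
qed

text \<open>The quotient rule on lifts: \<open>D v\<close> lifts to the image of the lift of v
  divided by c, up to a multiple of the lift of the image point. This multiple is the ambiguity that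
  \<open>gram\<close> does not see.\<close>

lemma CH_act_has_derivative:
  assumes "A \<in> SU" "z \<in> CH"
  obtains D c where "(CH_act A has_derivative D) (at z)" "c \<noteq> 0"
    "A *v hc 1 z = c *s hc 1 (CH_act A z)" "CH_act A z \<in> CH"
    "\<And>v. \<exists>\<mu>. hc 0 (D v) = inverse c *s (A *v hc 0 v) - \<mu> *s hc 1 (CH_act A z)"
proof -
  obtain c where c: "c \<noteq> 0" "A *v hc 1 z = c *s hc 1 (CH_act A z)" "CH_act A z \<in> CH"
    "c = (A *v hc 1 z) $ None"
    using CH_act_lift[OF assms] by metis
  let ?N = "\<lambda>v. (A *v hc 0 v) $ None"
  let ?S = "\<lambda>v. \<chi> j. (A *v hc 0 v) $ Some j"
  have N: "((\<lambda>z. (A *v hc 1 z) $ None) has_derivative ?N) (at z)"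
    using has_derivative_add[OF has_derivative_const linear_imp_has_derivative[OF linear_matrix_hc_None]]
    by (subst matrix_hc_1_None) simp
  have S: "((\<lambda>z. \<chi> j. (A *v hc 1 z) $ Some j) has_derivative ?S) (at z)"
    using has_derivative_add[OF has_derivative_const linear_imp_has_derivative[OF linear_matrix_hc_Some]]
    by (subst matrix_hc_1_Some) simp
  define D where "D v = inverse c *s ?S v + (- (inverse c * ?N v * inverse c)) *s (\<chi> j. (A *v hc 1 z) $ Some j)" for v
  have "((\<lambda>z. inverse ((A *v hc 1 z) $ None) *s (\<chi> j. (A *v hc 1 z) $ Some j)) has_derivative D) (at z)"
    unfolding D_def
    using bounded_bilinear.FDERIV[OF bounded_bilinear_smult Deriv.has_derivative_inverse[OF _ N] S] c(1,4)
    by simp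
  then have "(CH_act A has_derivative D) (at z)"
    by (simp flip: CH_act_altdef)
  moreover have "hc 0 (D v) = inverse c *s (A *v hc 0 v) - (?N v / c) *s hc 1 (CH_act A z)" for v
    using c(1) by (simp add: D_def vec_option_eq_iff c(2) divide_inverse mult.commute)
  ultimately show ?thesis using c(1-3) by (intro that[of D c]) auto
qed

text \<open>The metric in terms of homogeneous lifts \<open>x\<close> of a point and \<open>a\<close>, \<open>b\<close> of tangent vectors.
  Replacing \<open>a\<close> or \<open>b\<close> by a lift that differs by a multiple of \<open>x\<close> does not change \<open>gram x a b\<close>, so the
  invariance of \<open>herm_form\<close> under \<open>SU\<close> suffices.\<close>

definition gram :: "complex^('n::finite option) \<Rightarrow> complex^('n option) \<Rightarrow> complex^('n option) \<Rightarrow> complex"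
  where "gram x a b = herm_form a x * herm_form x b - herm_form x x * herm_form a b"

lemma gram_shift: "gram x (c *s a - \<mu> *s x) (c *s b - \<nu> *s x) = (c * cnj c) * gram x a b"
  by (simp add: gram_def herm_form_simps algebra_simps)

lemma gram_smult: "gram (c *s x) a b = (c * cnj c) * gram x a b"
  by (simp add: gram_def herm_form_simps algebra_simps)

lemma gram_SU: "A \<in> SU \<Longrightarrow> gram (A *v x) (A *v a) (A *v b) = gram x a b"
  by (simp add: gram_def SU_herm_form)

lemma CH_metric_gram:
  "CH_metric z v w = 4 * Re (gram (hc 1 z) (hc 0 v) (hc 0 w)) / (Re (herm_form (hc 1 z) (hc 1 z)))\<^sup>2"
  by (simp add: CH_metric_def gram_def herm_form_hc cinner_self power2_commute algebra_simps)

lemma riemannian_isometry_CH_act: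
  assumes A: "A \<in> SU" "A' \<in> SU" "A ** A' = mat 1" "A' ** A = mat 1"
  shows "riemannian_isometry CH CH_metric (CH_act A)"
proof -
  have inv: "CH_act A' (CH_act A z) = z" "CH_act A (CH_act A' z) = z" if "z \<in> CH" for z
    using CH_act_mult[OF A(2,1) that] CH_act_mult[OF A(1,2) that] A(3,4) CH_act_mat_1 by metis+
  have "homeomorphism CH CH (CH_act A) (CH_act A')"
    using A inv smooth_on_imp_continuous_on[OF smooth_on_CH_act]
    by (intro homeomorphismI) (auto intro: CH_act_mem)
  then have "diffeomorphism CH CH (CH_act A) (CH_act A')"
    using A smooth_on_CH_act open_CH by (auto simp: diffeomorphism_def)
  moreover have "CH_metric (CH_act A p) (frechet_derivative (CH_act A) (at p) v)
      (frechet_derivative (CH_act A) (at p) w) = CH_metric p v w" if "p \<in> CH" for p v w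
  proof -
    obtain D c where D: "(CH_act A has_derivative D) (at p)" "c \<noteq> 0"
      "A *v hc 1 p = c *s hc 1 (CH_act A p)" "CH_act A p \<in> CH"
      "\<And>v. \<exists>\<mu>. hc 0 (D v) = inverse c *s (A *v hc 0 v) - \<mu> *s hc 1 (CH_act A p)"
      using CH_act_has_derivative[OF A(1) \<open>p \<in> CH\<close>] by metis
    let ?x = "hc 1 p" and ?y = "hc 1 (CH_act A p)"
    obtain \<mu> \<nu> where *: "hc 0 (D v) = inverse c *s (A *v hc 0 v) - \<mu> *s ?y"
      "hc 0 (D w) = inverse c *s (A *v hc 0 w) - \<nu> *s ?y"
      using D(5) by metis
    \<comment> \<open>The lift factor enters \<open>gram\<close> once through the tangent vectors
      and once through the base point, in total as the square of \<open>inverse r\<close>. The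
      squared \<open>herm_form\<close> in the denominator of the metric scales in the same
      way.\<close>
    define r where "r = (cmod c)\<^sup>2"
    have r: "c * cnj c = of_real r" "inverse c * cnj (inverse c) = of_real (inverse r)" "r > 0"
    proof -
      show 1: "c * cnj c = of_real r" by (simp only: r_def complex_norm_square)
      show "inverse c * cnj (inverse c) = of_real (inverse r)"
        unfolding of_real_inverse 1[symmetric] by simp
      show "r > 0" using D(2) by (simp add: r_def)
    qed
    have "gram ?y (hc 0 (D v)) (hc 0 (D w)) = of_real (inverse r) * gram ?y (A *v hc 0 v) (A *v hc 0 w)"
      unfolding * gram_shift r(2) ..
    also have "gram ?y (A *v hc 0 v) (A *v hc 0 w) = of_real (inverse r) * gram ?x (hc 0 v) (hc 0 w)"
      using gram_SU[OF A(1), of ?x "hc 0 v" "hc 0 w"] r(3) unfolding D(3) gram_smult r(1)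
      by (simp add: field_simps)
    finally have g: "Re (gram ?y (hc 0 (D v)) (hc 0 (D w))) = inverse r * (inverse r * Re (gram ?x (hc 0 v) (hc 0 w)))"
      by (simp del: of_real_inverse)
    have "herm_form ?x ?x = of_real r * herm_form ?y ?y"
      using SU_herm_form[OF A(1), of ?x ?x]
      unfolding D(3) herm_form_simps r(1)[symmetric] by (simp add: mult_ac)
    then have h: "Re (herm_form ?x ?x) = r * Re (herm_form ?y ?y)" by simp
    have fd: "frechet_derivative (CH_act A) (at p) = D"
      using frechet_derivative_at[OF D(1)] by simp
    show ?thesis
      unfolding CH_metric_gram fd g h using r(3) by (simp add: power_mult_distrib power2_eq_square field_simps)
  qed
  ultimately show ?thesis unfolding riemannian_isometry_def by blast
qed

lemma continuous_on_CH_act: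
  "continuous_on ((SU :: (complex^('n::finite option)^('n option)) set) \<times> CH) (\<lambda>(A, p). CH_act A p)"
proof -
  have "continuous_on ((SU :: (complex^('n option)^('n option)) set) \<times> CH)
      (\<lambda>x. \<Sum>j\<in>UNIV. fst x $ i $ j * homogeneous_coords (snd x) $ j)" for i
  proof (rule continuous_on_sum)
    fix j :: "'n option"
    show "continuous_on ((SU :: (complex^('n option)^('n option)) set) \<times> CH)
        (\<lambda>x. fst x $ i $ j * homogeneous_coords (snd x) $ j)"
      by (cases j) (auto simp: homogeneous_coords_def intro!: continuous_intros)
  qed
  moreover have "(A *v homogeneous_coords z) $ None \<noteq> 0" if "A \<in> SU" "z \<in> CH" for A and z :: "complex^'n"
    using CH_act_lift[OF that] by (metis homogeneous_coords_eq)
  ultimately show ?thesis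
    unfolding CH_act_def case_prod_beta matrix_vector_mult_def
    by (intro continuous_on_vec_lambda continuous_on_divide) auto
qed

lemma isometric_action_CH:
  assumes "connected_lie_subgroup G S" "G \<subseteq> SU"
  shows "isometric_action CH CH_metric CH_act S"
proof -
  have S: "S \<subseteq> SU" "\<And>A. A \<in> S \<Longrightarrow> invertible A \<and> matrix_inv A \<in> S"
    using assms by (auto simp: connected_lie_subgroup_def)
  have "connected_lie_subgroup {A. invertible A} S"
    using assms(1) by (auto simp: connected_lie_subgroup_def)
  moreover have "riemannian_isometry CH CH_metric (CH_act A)" if "A \<in> S" for A
  proof (rule riemannian_isometry_CH_act)
    show "A \<in> SU" "matrix_inv A \<in> SU" using S that by auto
    show "A ** matrix_inv A = mat 1" "matrix_inv A ** A = mat 1"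
      using someI_ex[of "\<lambda>B. A ** B = mat 1 \<and> B ** A = mat 1"] S(2)[OF that]
      by (simp_all add: matrix_inv_def invertible_def)
  qed
  moreover have "continuous_on (S \<times> CH) (\<lambda>(A, p). CH_act A p)"
    using continuous_on_CH_act by (rule continuous_on_subset) (use S(1) in auto)
  ultimately show ?thesis
    unfolding isometric_action_def using S(1) by (auto simp: CH_act_mat_1 intro: CH_act_mult)
qed

section \<open>Horospherical coordinates\<close>

lemma norm_cinner_decomp:
  assumes "norm u = 1"
  shows "(norm (z - cinner z u *s u))\<^sup>2 = (norm z)\<^sup>2 - (cmod (cinner z u))\<^sup>2"
proof -
  have "cinner u u = 1" using assms by (simp add: cinner_self)
  then have "cinner (z - cinner z u *s u) (z - cinner z u *s u) = cinner z z - cinner z u * cnj (cinner z u)"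
    by (simp add: cinner_simps cnj_cinner algebra_simps)
  then show ?thesis
    unfolding cinner_self complex_norm_square[symmetric] of_real_diff[symmetric] of_real_eq_iff .
qed

text \<open>Cauchy-Schwarz, read off from \<open>norm_cinner_decomp\<close>. It keeps the
  denominators \<open>1 - cinner z u\<close> away from 0 inside the ball.\<close>

lemma cinner_lt_1:
  assumes "norm u = 1" "z \<in> CH"
  shows "cmod (cinner z u) < 1"
proof -
  have "0 \<le> (norm z)\<^sup>2 - (cmod (cinner z u))\<^sup>2"
    unfolding norm_cinner_decomp[OF assms(1), symmetric] by simp
  then have "(cmod (cinner z u))\<^sup>2 \<le> (norm z)\<^sup>2" by simp
  then have "cmod (cinner z u) \<le> norm z"
    by (rule power2_le_imp_le) simp
  then show ?thesis using assms(2) by (simp add: CH_def)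
qed

lemma one_minus_cinner_nz:
  assumes "norm u = 1" "z \<in> CH"
  shows "1 - cinner z u \<noteq> 0"
  using cinner_lt_1[OF assms] by auto

lemma norm_add_sq_orth:
  assumes "cinner v u = 0" "norm u = 1"
  shows "(norm (c *s u + v))\<^sup>2 = (cmod c)\<^sup>2 + (norm v)\<^sup>2"
proof -
  have uv: "cinner u v = 0"
    unfolding cnj_cinner[of v u, symmetric] assms(1) by simp
  have uu: "cinner u u = 1"
    using assms(2) by (simp add: cinner_self)
  have "cinner (c *s u + v) (c *s u + v) = c * cnj c + cinner v v"
    by (simp add: cinner_simps uv uu assms(1))
  then show ?thesis
    unfolding cinner_self complex_norm_square[symmetric] of_real_add[symmetric] of_real_eq_iff .
qed

text \<open>Siegel coordinates at the boundary point \<open>u\<close>: write \<open>(1, z) = x\<^sub>+ (1, u) + x\<^sub>- (1, -u) + (0, v)\<close>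
  with \<open>v \<bottom> u\<close>. Then \<open>horo_vec u z = v / x\<^sub>-\<close>, while \<open>x\<^sub>+ / x\<^sub>-\<close> is the Cayley transform of
  \<open>cinner z u\<close>, and its real part exceeds \<open>horo_height u z\<close> by \<open>|v / x\<^sub>-|\<^sup>2 / 4\<close>. The weight \<open>\<rho>\<close> will be
  \<open>1\<close> for \<open>V = 0\<close>, and the inverse square root for \<open>V = \<aa>\<close>: since \<open>\<aa>\<close> scales \<open>horo_vec\<close> and the
  square root of \<open>horo_height\<close> by the same factor, it fixes the part of the chart orthogonal to \<open>u\<close>.\<close>

definition horo_height :: "complex^'n::finite \<Rightarrow> complex^'n \<Rightarrow> real" where
  "horo_height u z = (1 - (norm z)\<^sup>2) / (cmod (1 - cinner z u))\<^sup>2"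

definition horo_vec :: "complex^'n::finite \<Rightarrow> complex^'n \<Rightarrow> complex^'n" where
  "horo_vec u z = (2 / (1 - cinner z u)) *s (z - cinner z u *s u)"

definition horo_chart :: "complex^'n::finite \<Rightarrow> (real \<Rightarrow> real) \<Rightarrow> complex^'n \<Rightarrow> complex^'n" where
  "horo_chart u \<rho> z =
     Complex (horo_height u z) (Im ((1 + cinner z u) / (1 - cinner z u))) *s u
     + \<rho> (horo_height u z) *\<^sub>R horo_vec u z"

text \<open>Scaling the lift so that (1, -u) has coefficient 1 gives the vector (\<zeta> + 1,
  (\<zeta> - 1) u + v), and division by its time coordinate gives the point. The coefficient \<zeta>
  of (1, u) is regained from height and imaginary part by adding |v|^2 / 4.\<close>

definition horo_inv :: "complex^'n::finite \<Rightarrow> (real \<Rightarrow> real) \<Rightarrow> complex^'n \<Rightarrow> complex^'n" where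
  "horo_inv u \<rho> y =
     (let v = inverse (\<rho> (Re (cinner y u))) *\<^sub>R (y - cinner y u *s u);
          \<zeta> = cinner y u + of_real ((norm v)\<^sup>2 / 4)
      in inverse (\<zeta> + 1) *s ((\<zeta> - 1) *s u + v))"

definition halfspace :: "complex^'n::finite \<Rightarrow> (complex^'n) set" where
  "halfspace u = {y. 0 < Re (cinner y u)}"

lemma horo_height_pos: "norm u = 1 \<Longrightarrow> z \<in> CH \<Longrightarrow> horo_height u z > 0"
  using one_minus_cinner_nz[of u z] by (simp add: horo_height_def mem_CH)

lemma cinner_horo_vec: "norm u = 1 \<Longrightarrow> cinner (horo_vec u z) u = 0"
  by (simp add: horo_vec_def cinner_simps cinner_self)

lemma cinner_horo_chart:
  "norm u = 1 \<Longrightarrow> cinner (horo_chart u \<rho> z) u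
     = Complex (horo_height u z) (Im ((1 + cinner z u) / (1 - cinner z u)))"
  by (simp add: horo_chart_def cinner_simps cinner_horo_vec cinner_self)

text \<open>With c = \<open>cinner z u\<close>, the real part of the Cayley transform is (1 - |c|^2)
  / |1 - c|^2, and 1 - |c|^2 splits into 1 - |z|^2, which gives the height, and |z|^2 - |c|^2, which
  by Pythagoras gives the vector part.\<close>

lemma horo_zeta:
  assumes "norm u = 1" "z \<in> CH"
  shows "Complex (horo_height u z) (Im ((1 + cinner z u) / (1 - cinner z u)))
      + of_real ((norm (horo_vec u z))\<^sup>2 / 4) = (1 + cinner z u) / (1 - cinner z u)"
proof (rule complex_eqI)
  define c where "c = cinner z u"
  define d where "d = (cmod (1 - c))\<^sup>2"
  have d: "d > 0" using one_minus_cinner_nz[OF assms] by (simp add: d_def c_def)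
  have vec: "(norm (horo_vec u z))\<^sup>2 = 4 / d * ((norm z)\<^sup>2 - (cmod c)\<^sup>2)"
  proof -
    have "cinner (horo_vec u z) (horo_vec u z)
        = (2 / (1 - c)) * cnj (2 / (1 - c)) * cinner (z - c *s u) (z - c *s u)"
      by (simp only: horo_vec_def c_def cinner_smult_left cinner_smult_right mult_ac)
    also have "(2 / (1 - c)) * cnj (2 / (1 - c)) = of_real ((cmod (2 / (1 - c)))\<^sup>2)"
      by (simp only: complex_norm_square)
    finally have "(norm (horo_vec u z))\<^sup>2 = (cmod (2 / (1 - c)))\<^sup>2 * (norm (z - c *s u))\<^sup>2"
      unfolding cinner_self of_real_mult[symmetric] of_real_eq_iff .
    then show ?thesis
      unfolding c_def norm_cinner_decomp[OF assms(1)] unfolding c_def[symmetric]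
      by (simp add: norm_divide power_divide d_def)
  qed
  have "Re (1 + c) * Re (1 - c) + Im (1 + c) * Im (1 - c) = 1 - (cmod c)\<^sup>2"
    unfolding cmod_power2 by (simp add: power2_eq_square algebra_simps)
  then have "Re ((1 + c) / (1 - c)) = (1 - (cmod c)\<^sup>2) / d"
    by (simp only: Re_divide' d_def)
  moreover have "horo_height u z = (1 - (norm z)\<^sup>2) / d"
    by (simp add: horo_height_def c_def d_def)
  ultimately have "horo_height u z + (norm (horo_vec u z))\<^sup>2 / 4 = Re ((1 + c) / (1 - c))"
    unfolding vec using d by (simp only:) (simp add: field_simps)
  then show "Re (Complex (horo_height u z) (Im ((1 + cinner z u) / (1 - cinner z u)))
      + of_real ((norm (horo_vec u z))\<^sup>2 / 4)) = Re ((1 + cinner z u) / (1 - cinner z u))"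
    by (simp add: c_def)
qed simp

lemma horo_inv_chart:
  assumes "norm u = 1" "z \<in> CH" "\<rho> (horo_height u z) \<noteq> 0"
  shows "horo_inv u \<rho> (horo_chart u \<rho> z) = z"
proof -
  define c where "c = cinner z u"
  have nz: "1 - c \<noteq> 0" using one_minus_cinner_nz[OF assms(1,2)] by (simp add: c_def)
  let ?y = "horo_chart u \<rho> z"
  have "?y - cinner ?y u *s u = \<rho> (horo_height u z) *\<^sub>R horo_vec u z"
    unfolding cinner_horo_chart[OF assms(1)] by (simp add: horo_chart_def)
  then have v: "inverse (\<rho> (Re (cinner ?y u))) *\<^sub>R (?y - cinner ?y u *s u) = horo_vec u z"
    using assms(3) by (simp add: cinner_horo_chart[OF assms(1)])
  have \<zeta>: "cinner ?y u + of_real ((norm (horo_vec u z))\<^sup>2 / 4) = (1 + c) / (1 - c)"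
    unfolding cinner_horo_chart[OF assms(1)] horo_zeta[OF assms(1,2)] c_def ..
  have "(1 + c) / (1 - c) + 1 = 2 / (1 - c)" "(1 + c) / (1 - c) - 1 = 2 * c / (1 - c)"
    using nz by (simp_all add: field_simps)
  then have "horo_inv u \<rho> ?y = inverse (2 / (1 - c)) *s ((2 * c / (1 - c)) *s u + (2 / (1 - c)) *s (z - c *s u))"
    by (simp only: horo_inv_def v \<zeta> Let_def) (simp add: horo_vec_def c_def)
  also have "\<dots> = z"
    using nz by (simp add: vec_eq_iff field_simps)
  finally show ?thesis .
qed

text \<open>The height of the constructed point comes out as \<open>Re (cinner y u)\<close>, which
  is positive on the half-space; as the denominator of the height is a square, this forces the point
  into the ball.\<close>

lemma horo_chart_inv:
  assumes "norm u = 1" "y \<in> halfspace u" "\<rho> (Re (cinner y u)) \<noteq> 0"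
  shows "horo_inv u \<rho> y \<in> CH" "horo_chart u \<rho> (horo_inv u \<rho> y) = y"
proof -
  define v where "v = inverse (\<rho> (Re (cinner y u))) *\<^sub>R (y - cinner y u *s u)"
  define \<zeta> where "\<zeta> = cinner y u + of_real ((norm v)\<^sup>2 / 4)"
  define z where "z = horo_inv u \<rho> y"
  have uu: "cinner u u = 1" using assms(1) by (simp add: cinner_self)
  have vu: "cinner v u = 0" by (simp add: v_def cinner_simps uu)
  have Re: "Re \<zeta> > 0" using assms(2) by (simp add: \<zeta>_def halfspace_def add_pos_nonneg)
  then have nz: "\<zeta> + 1 \<noteq> 0" by (auto simp: complex_eq_iff)
  have z: "z = inverse (\<zeta> + 1) *s ((\<zeta> - 1) *s u + v)"
    by (simp only: z_def horo_inv_def Let_def v_def[symmetric] \<zeta>_def[symmetric])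
  have c: "cinner z u = (\<zeta> - 1) / (\<zeta> + 1)"
    by (simp add: z cinner_simps uu vu divide_inverse algebra_simps)
  have c1: "1 - cinner z u = 2 / (\<zeta> + 1)"
    unfolding c using nz by (simp add: field_simps)
  have "1 + cinner z u = 2 * \<zeta> / (\<zeta> + 1)"
    unfolding c using nz by (simp add: field_simps)
  then have c2: "(1 + cinner z u) / (1 - cinner z u) = \<zeta>"
    unfolding c1 using nz by simp
  have "z - cinner z u *s u = inverse (\<zeta> + 1) *s v"
    unfolding c by (simp add: z vec_eq_iff divide_inverse algebra_simps)
  moreover have "2 / (2 / (\<zeta> + 1)) = \<zeta> + 1" by simp
  ultimately have vec: "horo_vec u z = v"
    unfolding horo_vec_def c1 by (simp only: vector_smult_assoc right_inverse[OF nz] vector_smult_lid)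
  have "(norm z)\<^sup>2 = ((cmod (\<zeta> - 1))\<^sup>2 + (norm v)\<^sup>2) / (cmod (\<zeta> + 1))\<^sup>2"
  proof -
    have "cinner z z = (inverse (\<zeta> + 1) * cnj (inverse (\<zeta> + 1))) * cinner ((\<zeta> - 1) *s u + v) ((\<zeta> - 1) *s u + v)"
      by (simp only: z cinner_smult_left cinner_smult_right mult_ac)
    also have "inverse (\<zeta> + 1) * cnj (inverse (\<zeta> + 1)) = of_real ((cmod (inverse (\<zeta> + 1)))\<^sup>2)"
      by (simp only: complex_norm_square)
    finally have "(norm z)\<^sup>2 = (cmod (inverse (\<zeta> + 1)))\<^sup>2 * (norm ((\<zeta> - 1) *s u + v))\<^sup>2"
      unfolding cinner_self of_real_mult[symmetric] of_real_eq_iff .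
    then show ?thesis
      unfolding norm_add_sq_orth[OF vu assms(1)] by (simp add: norm_inverse power_inverse divide_inverse mult.commute)
  qed
  moreover have "(cmod (1 - cinner z u))\<^sup>2 = 4 / (cmod (\<zeta> + 1))\<^sup>2"
    unfolding c1 by (simp add: norm_divide power_divide)
  moreover have "(cmod (\<zeta> + 1))\<^sup>2 > 0" using nz by simp
  moreover have "(1 - (F + V) / E) / (4 / E) = (E - F - V) / 4" if "E > 0" for E F V :: real
    using that by (simp add: field_simps)
  ultimately have "horo_height u z = ((cmod (\<zeta> + 1))\<^sup>2 - (cmod (\<zeta> - 1))\<^sup>2 - (norm v)\<^sup>2) / 4"
    by (simp only: horo_height_def)
  also have "(cmod (\<zeta> + 1))\<^sup>2 - (cmod (\<zeta> - 1))\<^sup>2 = 4 * Re \<zeta>"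
    unfolding cmod_power2 by (simp add: power2_eq_square algebra_simps)
  also have "(4 * Re \<zeta> - (norm v)\<^sup>2) / 4 = Re \<zeta> - (norm v)\<^sup>2 / 4"
    by (simp add: diff_divide_distrib)
  finally have h: "horo_height u z = Re (cinner y u)"
    by (simp add: \<zeta>_def)
  have "horo_height u z > 0" using h assms(2) by (simp add: halfspace_def)
  then show "horo_inv u \<rho> y \<in> CH"
    unfolding z_def[symmetric] mem_CH horo_height_def by (simp add: zero_less_divide_iff)
  have "Im \<zeta> = Im (cinner y u)" by (simp add: \<zeta>_def)
  then have "horo_chart u \<rho> z = cinner y u *s u + \<rho> (Re (cinner y u)) *\<^sub>R v"
    unfolding horo_chart_def vec c2 h by simp
  also have "\<dots> = y" using assms(3) by (simp add: v_def)
  finally show "horo_chart u \<rho> (horo_inv u \<rho> y) = y" by (simp add: z_def)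
qed

lemma linear_cinner: "linear (\<lambda>z. cinner z u)"
  by (rule linearI) (simp_all add: cinner_simps scaleR_conv_of_real[where 'a = complex])

lemma open_halfspace: "open (halfspace u)" and convex_halfspace: "convex (halfspace u)"
proof -
  have "halfspace u = {y. u \<bullet> y > 0}"
    by (auto simp: halfspace_def Re_cinner inner_commute)
  then show "open (halfspace u)" "convex (halfspace u)"
    by (simp_all add: open_halfspace_gt convex_halfspace_gt)
qed

lemma smooth_on_horo_height:
  assumes "norm u = 1"
  shows "smooth_on CH (horo_height u)"
proof -
  have "smooth_on CH (\<lambda>z. (1 - z \<bullet> z) / ((1 - cinner z u) \<bullet> (1 - cinner z u)))"
    using one_minus_cinner_nz[OF assms]
    by (intro smooth_on_divide smooth_on_diff smooth_on_inner smooth_on_const open_CH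
        smooth_on_linear linear_cinner linear_ident) auto
  then show ?thesis
    by (simp add: horo_height_def[abs_def] power2_norm_eq_inner)
qed

lemma diffeomorphism_horo_chart:
  assumes u: "norm u = 1" and \<rho>: "smooth_on {0<..} \<rho>" "\<And>s. s > 0 \<Longrightarrow> \<rho> s > 0"
  shows "diffeomorphism CH (halfspace u) (horo_chart u \<rho>) (horo_inv u \<rho>)"
proof -
  note [intro] = smooth_on_const smooth_on_linear linear_cinner linear_ident
  have lin: "linear (\<lambda>c::complex. c *s u)" "linear Re" "linear Im" "linear complex_of_real" "linear (\<lambda>s. s *\<^sub>R \<i>)"
    by (auto intro!: linearI simp: vec_eq_iff distrib_right scaleR_add_left)
  have lu: "linear (\<lambda>z. cinner z u *s u)"
    using linear_compose[OF linear_cinner lin(1)] by (simp add: comp_def)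
  have chart: "smooth_on CH (horo_chart u \<rho>)"
  proof -
    let ?h = "horo_height u"
    have "smooth_on CH (\<lambda>z. (1 + cinner z u) / (1 - cinner z u))"
      using one_minus_cinner_nz[OF u]
      by (intro smooth_on_divide smooth_on_diff smooth_on_add open_CH) (auto simp: open_CH)
    then have "smooth_on CH (\<lambda>z. (Im ((1 + cinner z u) / (1 - cinner z u))) *\<^sub>R \<i>)"
      by (intro smooth_on_linear_compose[OF open_CH lin(5)] smooth_on_linear_compose[OF open_CH lin(3)])
    moreover have "smooth_on CH (\<lambda>z. complex_of_real (?h z))"
      by (intro smooth_on_linear_compose[OF open_CH lin(4)] smooth_on_horo_height u)
    ultimately have "smooth_on CH (\<lambda>z. complex_of_real (?h z) + (Im ((1 + cinner z u) / (1 - cinner z u))) *\<^sub>R \<i>)"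
      by (rule smooth_on_add[OF open_CH, rotated])
    then have 1: "smooth_on CH (\<lambda>z. Complex (?h z) (Im ((1 + cinner z u) / (1 - cinner z u))) *s u)"
      by (intro smooth_on_linear_compose[OF open_CH lin(1)])
        (simp add: Complex_eq scaleR_conv_of_real mult.commute)
    have "smooth_on CH (\<lambda>z. 2 / (1 - cinner z u))"
      using one_minus_cinner_nz[OF u]
      by (intro smooth_on_divide smooth_on_diff open_CH) (auto simp: open_CH)
    moreover have "smooth_on CH (\<lambda>z. z - cinner z u *s u)"
      by (intro smooth_on_diff open_CH) (auto simp: open_CH lu)
    ultimately have 2: "smooth_on CH (horo_vec u)"
      unfolding horo_vec_def[abs_def] by (rule smooth_on_bilinear[OF open_CH bounded_bilinear_smult])
    have 3: "smooth_on CH (\<lambda>z. \<rho> (?h z))"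
      using horo_height_pos[OF u]
      by (intro smooth_on_compose[OF open_CH open_greaterThan _ smooth_on_horo_height[OF u] \<rho>(1)]) auto
    show ?thesis
      unfolding horo_chart_def[abs_def]
      by (intro smooth_on_add[OF open_CH 1] smooth_on_bilinear[OF open_CH bounded_bilinear_scaleR 3 2])
  qed
  have inv: "smooth_on (halfspace u) (horo_inv u \<rho>)"
  proof -
    let ?H = "halfspace u"
    define v where "v y = inverse (\<rho> (Re (cinner y u))) *\<^sub>R (y - cinner y u *s u)" for y
    define \<zeta> where "\<zeta> y = cinner y u + of_real ((norm (v y))\<^sup>2 / 4)" for y
    have "smooth_on ?H (\<lambda>y. Re (cinner y u))"
      by (intro smooth_on_linear_compose[OF open_halfspace lin(2)]) (auto simp: open_halfspace)
    then have "smooth_on ?H (\<lambda>y. \<rho> (Re (cinner y u)))"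
      by (intro smooth_on_compose[OF open_halfspace open_greaterThan _ _ \<rho>(1)]) (auto simp: halfspace_def)
    then have 1: "smooth_on ?H (\<lambda>y. inverse (\<rho> (Re (cinner y u))))"
      using \<rho>(2) by (intro smooth_on_inverse open_halfspace) (force simp: halfspace_def)+
    have "smooth_on ?H (\<lambda>y. y - cinner y u *s u)"
      by (intro smooth_on_diff open_halfspace) (auto simp: open_halfspace lu)
    then have v: "smooth_on ?H v"
      unfolding v_def by (rule smooth_on_bilinear[OF open_halfspace bounded_bilinear_scaleR 1])
    have "smooth_on ?H (\<lambda>y. complex_of_real ((v y \<bullet> v y) / 4))"
      by (intro smooth_on_linear_compose[OF open_halfspace lin(4)] smooth_on_divide smooth_on_inner
          smooth_on_const open_halfspace v) simp
    then have \<zeta>: "smooth_on ?H \<zeta>"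
      unfolding \<zeta>_def power2_norm_eq_inner
      by (intro smooth_on_add open_halfspace) (auto simp: open_halfspace)
    have "\<zeta> y + 1 \<noteq> 0" if "y \<in> ?H" for y
    proof -
      have "Re (\<zeta> y) > 0" using that by (simp add: \<zeta>_def halfspace_def add_pos_nonneg)
      then show ?thesis by (auto simp: complex_eq_iff)
    qed
    then have "smooth_on ?H (\<lambda>y. inverse (\<zeta> y + 1))"
      by (intro smooth_on_inverse smooth_on_add open_halfspace \<zeta>) (auto simp: open_halfspace)
    moreover have "smooth_on ?H (\<lambda>y. (\<zeta> y - 1) *s u + v y)"
      by (intro smooth_on_add smooth_on_linear_compose[OF open_halfspace lin(1)] smooth_on_diff
          open_halfspace \<zeta> v) (auto simp: open_halfspace)
    ultimately have "smooth_on ?H (\<lambda>y. inverse (\<zeta> y + 1) *s ((\<zeta> y - 1) *s u + v y))"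
      by (rule smooth_on_bilinear[OF open_halfspace bounded_bilinear_smult])
    then show ?thesis
      by (simp only: horo_inv_def[abs_def] Let_def v_def \<zeta>_def)
  qed
  have nz: "\<rho> (horo_height u z) \<noteq> 0" if "z \<in> CH" for z
    using \<rho>(2)[OF horo_height_pos[OF u that]] by simp
  have nz': "\<rho> (Re (cinner y u)) \<noteq> 0" if "y \<in> halfspace u" for y
    using \<rho>(2)[of "Re (cinner y u)"] that by (simp add: halfspace_def)
  have inverse: "horo_inv u \<rho> (horo_chart u \<rho> z) = z" if "z \<in> CH" for z
    using horo_inv_chart[OF u that] nz[OF that] by blast
  have inverse': "horo_inv u \<rho> y \<in> CH" "horo_chart u \<rho> (horo_inv u \<rho> y) = y" if "y \<in> halfspace u" for y
    using horo_chart_inv[OF u that] nz'[OF that] by blast+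
  have "horo_chart u \<rho> z \<in> halfspace u" if "z \<in> CH" for z
    using horo_height_pos[OF u that] by (simp add: halfspace_def cinner_horo_chart[OF u])
  then have "homeomorphism CH (halfspace u) (horo_chart u \<rho>) (horo_inv u \<rho>)"
    using inverse inverse' smooth_on_imp_continuous_on[OF chart] smooth_on_imp_continuous_on[OF inv]
    by (intro homeomorphismI) auto
  then show ?thesis
    using chart inv by (simp add: diffeomorphism_def open_CH open_halfspace)
qed

section \<open>Foliations and sections\<close>

text \<open>The real part of a complex quotient, written with real inner products so that the real
  quotient rule can differentiate it.\<close>

lemma horo_vec_inner:
  assumes "cinner u w = 0"
  shows "horo_vec u z \<bullet> w
    = 2 * (cinner z w \<bullet> (1 - cinner z u)) / ((1 - cinner z u) \<bullet> (1 - cinner z u))"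
proof -
  have "cinner (horo_vec u z) w = 2 * (cinner z w / (1 - cinner z u))"
    using assms(1) by (simp add: horo_vec_def cinner_simps)
  then have "horo_vec u z \<bullet> w = Re (2 * (cinner z w / (1 - cinner z u)))"
    by (simp only: Re_cinner[symmetric])
  also have "Re (2 * c) = 2 * Re c" for c
    by simp
  finally show ?thesis
    by (simp only: Re_divide' power2_norm_eq_inner inner_complex_def times_divide_eq_right)
qed

lemma horo_height_inner:
  "horo_height u z = (1 - z \<bullet> z) / ((1 - cinner z u) \<bullet> (1 - cinner z u))"
  by (simp add: horo_height_def power2_norm_eq_inner)

lemma has_vector_derivative_cinner:
  "(\<gamma> has_vector_derivative q) F \<Longrightarrow> ((\<lambda>t. cinner (\<gamma> t) w) has_vector_derivative cinner q w) F"
  by (rule bounded_linear.has_vector_derivative[OF linear_cinner[unfolded linear_conv_bounded_linear]])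

lemma has_real_derivative_inner:
  assumes "(f has_vector_derivative f') (at t)" "(g has_vector_derivative g') (at t)"
  shows "((\<lambda>t. f t \<bullet> g t) has_real_derivative (f t \<bullet> g' + f' \<bullet> g t)) (at t)"
  using bounded_bilinear.has_vector_derivative[OF bounded_bilinear_inner assms]
  by (simp add: has_real_derivative_iff_has_vector_derivative)

lemma horo_denominator_derivative:
  assumes "(\<gamma> has_vector_derivative q) (at 0)" "cinner (\<gamma> 0) u = of_real x"
  shows "((\<lambda>t. (1 - cinner (\<gamma> t) u) \<bullet> (1 - cinner (\<gamma> t) u)) has_real_derivative
     - 2 * (1 - x) * (q \<bullet> u)) (at 0)"
proof -
  have "((\<lambda>t. 1 - cinner (\<gamma> t) u) has_vector_derivative (0 - cinner q u)) (at 0)"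
    by (intro has_vector_derivative_diff has_vector_derivative_const has_vector_derivative_cinner assms(1))
  from has_real_derivative_inner[OF this this] show ?thesis
    by (simp add: assms(2) inner_complex_def Re_cinner algebra_simps)
qed

text \<open>Meant for points of the future section, where \<open>cinner p u\<close> is a real number
  x: the complex denominators collapse to powers of 1 - x.\<close>

lemma horo_height_derivative:
  assumes "(\<gamma> has_vector_derivative q) (at 0)" "\<gamma> 0 = p" "cinner p u = of_real x" "x \<noteq> 1"
  shows "((\<lambda>t. horo_height u (\<gamma> t)) has_real_derivative
     2 * ((1 - (norm p)\<^sup>2) * (q \<bullet> u) - (1 - x) * (p \<bullet> q)) / (1 - x) ^ 3) (at 0)"
proof -
  have 1: "((\<lambda>t. 1 - \<gamma> t \<bullet> \<gamma> t) has_real_derivative (0 - (p \<bullet> q + q \<bullet> p))) (at 0)"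
    using has_real_derivative_inner[OF assms(1,1)] assms(2)
    by (intro DERIV_diff DERIV_const) simp
  have den: "(1 - cinner (\<gamma> 0) u) \<bullet> (1 - cinner (\<gamma> 0) u) = (1 - x)\<^sup>2"
    using assms(2,3) by (simp add: inner_complex_def power2_eq_square)
  have "((\<lambda>t. horo_height u (\<gamma> t)) has_real_derivative
     ((0 - (p \<bullet> q + q \<bullet> p)) * (1 - x)\<^sup>2 - (1 - (norm p)\<^sup>2) * (- 2 * (1 - x) * (q \<bullet> u)))
       / ((1 - x)\<^sup>2 * (1 - x)\<^sup>2)) (at 0)"
    using DERIV_divide[OF 1 horo_denominator_derivative[OF assms(1), of u x]] assms(2,3,4)
    unfolding horo_height_inner den by (simp add: power2_norm_eq_inner)
  moreover have "((0 - (p \<bullet> q + q \<bullet> p)) * (1 - x)\<^sup>2 - (1 - (norm p)\<^sup>2) * (- 2 * (1 - x) * (q \<bullet> u)))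
       / ((1 - x)\<^sup>2 * (1 - x)\<^sup>2) = 2 * ((1 - (norm p)\<^sup>2) * (q \<bullet> u) - (1 - x) * (p \<bullet> q)) / (1 - x) ^ 3"
  proof -
    define y where "y = 1 - x"
    have "y \<noteq> 0" using assms(4) by (simp add: y_def)
    then show ?thesis
      unfolding y_def[symmetric] by (simp add: field_simps inner_commute power2_eq_square power3_eq_cube)
  qed
  ultimately show ?thesis by simp
qed

text \<open>Reality of \<open>cinner p w\<close>, which a totally real section will supply, removes
  the imaginary part of \<open>cinner q u\<close> from the formula.\<close>

lemma horo_vec_derivative:
  assumes "(\<gamma> has_vector_derivative q) (at 0)" "\<gamma> 0 = p" "cinner p u = of_real x" "x \<noteq> 1"
    and "cinner u w = 0" "Im (cinner p w) = 0"
  shows "((\<lambda>t. horo_vec u (\<gamma> t) \<bullet> w) has_real_derivative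
     2 * ((1 - x) * (q \<bullet> w) + (p \<bullet> w) * (q \<bullet> u)) / (1 - x)\<^sup>2) (at 0)"
proof -
  have "((\<lambda>t. 1 - cinner (\<gamma> t) u) has_vector_derivative (0 - cinner q u)) (at 0)"
    by (intro has_vector_derivative_diff has_vector_derivative_const has_vector_derivative_cinner assms(1))
  from has_real_derivative_inner[OF has_vector_derivative_cinner[OF assms(1), of w] this]
  have 1: "((\<lambda>t. cinner (\<gamma> t) w \<bullet> (1 - cinner (\<gamma> t) u)) has_real_derivative
      ((1 - x) * (q \<bullet> w) - (p \<bullet> w) * (q \<bullet> u))) (at 0)"
    using assms(2,3,6) by (simp add: inner_complex_def Re_cinner algebra_simps)
  have den: "(1 - cinner (\<gamma> 0) u) \<bullet> (1 - cinner (\<gamma> 0) u) = (1 - x)\<^sup>2"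
    using assms(2,3) by (simp add: inner_complex_def power2_eq_square)
  have num: "cinner (\<gamma> 0) w \<bullet> (1 - cinner (\<gamma> 0) u) = (p \<bullet> w) * (1 - x)"
    using assms(2,3) by (simp add: inner_complex_def Re_cinner)
  have "((\<lambda>t. 2 * ((cinner (\<gamma> t) w \<bullet> (1 - cinner (\<gamma> t) u)) / ((1 - cinner (\<gamma> t) u) \<bullet> (1 - cinner (\<gamma> t) u))))
      has_real_derivative 2 * ((((1 - x) * (q \<bullet> w) - (p \<bullet> w) * (q \<bullet> u)) * (1 - x)\<^sup>2
        - ((p \<bullet> w) * (1 - x)) * (- 2 * (1 - x) * (q \<bullet> u))) / ((1 - x)\<^sup>2 * (1 - x)\<^sup>2))) (at 0)"
    using DERIV_divide[OF 1 horo_denominator_derivative[OF assms(1), of u x]] assms(2,3,4)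
    unfolding den num by (intro DERIV_cmult) simp
  moreover have "2 * ((((1 - x) * (q \<bullet> w) - (p \<bullet> w) * (q \<bullet> u)) * (1 - x)\<^sup>2
        - ((p \<bullet> w) * (1 - x)) * (- 2 * (1 - x) * (q \<bullet> u))) / ((1 - x)\<^sup>2 * (1 - x)\<^sup>2))
      = 2 * ((1 - x) * (q \<bullet> w) + (p \<bullet> w) * (q \<bullet> u)) / (1 - x)\<^sup>2"
  proof -
    define y where "y = 1 - x"
    have "y \<noteq> 0" using assms(4) by (simp add: y_def)
    then show ?thesis
      unfolding y_def[symmetric] by (simp add: field_simps power2_eq_square)
  qed
  ultimately have d: "((\<lambda>t. 2 * ((cinner (\<gamma> t) w \<bullet> (1 - cinner (\<gamma> t) u)) / ((1 - cinner (\<gamma> t) u) \<bullet> (1 - cinner (\<gamma> t) u))))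
      has_real_derivative 2 * ((1 - x) * (q \<bullet> w) + (p \<bullet> w) * (q \<bullet> u)) / (1 - x)\<^sup>2) (at 0)"
    by simp
  then show ?thesis
    unfolding horo_vec_inner[OF assms(5)] times_divide_eq_right .
qed

lemma DERIV_const_near_0:
  assumes "(f has_real_derivative d) (at 0)" "e > 0" "\<And>t. t \<in> {-e<..<e} \<Longrightarrow> f t = c"
  shows "d = 0"
  using assms(3)[of 0] assms(3) assms(2)
  by (intro DERIV_local_const[OF assms(1,2)]) (auto simp: abs_less_iff)

text \<open>If \<open>v\<close> and \<open>p\<close> lie in a totally real subspace, then \<open>cinner v p\<close> is real, and Euclidean
  orthogonality to that subspace implies orthogonality for the Bergman metric.\<close>

lemma CH_metric_real_orthogonal:
  assumes "Im (cinner v p) = 0" "v \<bullet> q = 0" "p \<bullet> q = 0"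
  shows "CH_metric p v q = 0"
proof -
  have "Re (complex_of_real (1 - (norm p)\<^sup>2) * cinner v q + cinner v p * cinner p q)
      = (1 - (norm p)\<^sup>2) * (v \<bullet> q) + (v \<bullet> p) * (p \<bullet> q)"
    using assms(1) by (simp add: Re_cinner[symmetric])
  then show ?thesis using assms(2,3) by (simp add: CH_metric_def)
qed

lemma subspace_projection:
  fixes W :: "'a::euclidean_space set"
  assumes "subspace W"
  obtains y where "y \<in> W" "\<And>w. w \<in> W \<Longrightarrow> y \<bullet> w = x \<bullet> w"
proof -
  obtain y z where yz: "y \<in> span W" "\<And>w. w \<in> span W \<Longrightarrow> orthogonal z w" "x = y + z"
    using orthogonal_subspace_decomp_exists[of W x] by metis
  show ?thesis
    using yz span_eq_iff[THEN iffD2, OF assms]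
    by (intro that[of y]) (auto simp: orthogonal_def inner_add_left)
qed

lemma horo_chart_inner_u: "norm u = 1 \<Longrightarrow> horo_chart u \<rho> z \<bullet> u = horo_height u z"
  using cinner_horo_chart[of u \<rho> z] by (simp add: Re_cinner[symmetric])

lemma horo_chart_inner_orth:
  assumes "cinner u w = 0"
  shows "horo_chart u \<rho> z \<bullet> w = \<rho> (horo_height u z) * (horo_vec u z \<bullet> w)"
  using assms by (simp add: horo_chart_def Re_cinner[symmetric] cinner_simps)

text \<open>Cutting the ball with a linear subspace R makes connectedness, closedness and the
  submanifold property automatic. What remains is that R meets the orbits, and orthogonality in its
  Euclidean form.\<close>

lemma polar_actionI:
  assumes "isometric_action CH CH_metric act S" and R: "subspace R"
    and Rreal: "\<And>v w. v \<in> R \<Longrightarrow> w \<in> R \<Longrightarrow> Im (cinner v w) = 0"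
    and meets: "\<And>p. p \<in> CH \<Longrightarrow> R \<inter> orbit act S p \<noteq> {}"
    and sub: "\<And>p. p \<in> CH \<Longrightarrow> orbit act S p \<subseteq> CH"
    and normal: "\<And>p \<gamma> q e v. p \<in> CH \<Longrightarrow> p \<in> R \<Longrightarrow> (\<gamma> has_vector_derivative q) (at 0) \<Longrightarrow> \<gamma> 0 = p \<Longrightarrow>
       e > (0::real) \<Longrightarrow> \<gamma> ` {-e<..<e} \<subseteq> orbit act S p \<Longrightarrow> v \<in> R \<Longrightarrow> v \<bullet> q = 0"
  shows "polar_action CH CH_metric act S"
proof -
  have "CH \<inter> R \<inter> orbit act S p \<noteq> {}" if "p \<in> CH" for p
    using meets[OF that] sub[OF that] by auto
  moreover have "connected (CH \<inter> R)"
    by (intro convex_connected convex_Int) (simp_all add: CH_def subspace_imp_convex R)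
  moreover have "closedin (top_of_set CH) (CH \<inter> R)"
    using closed_subspace[OF R] by (rule closedin_closed_Int)
  moreover have "embedded_submanifold (dim R) (CH \<inter> R)"
    by (rule embedded_submanifold_subspace_Int[OF R open_CH])
  moreover have "tangent_space (CH \<inter> R) p \<subseteq> normal_space CH_metric (orbit act S p) p" if p: "p \<in> CH \<inter> R" for p
  proof
    fix v assume "v \<in> tangent_space (CH \<inter> R) p"
    then have v: "v \<in> R" using tangent_space_subset_subspace[OF R, of "CH \<inter> R" p] by auto
    have "CH_metric p v q = 0" if q: "q \<in> tangent_space (orbit act S p) p" for q
    proof -
      obtain \<gamma> e where g: "(e::real) > 0" "\<gamma> ` {-e<..<e} \<subseteq> orbit act S p" "\<gamma> 0 = p"
        "(\<gamma> has_vector_derivative q) (at 0)"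
        using q unfolding tangent_space_def by blast
      \<comment> \<open>\<open>normal\<close> is used twice: for v, and for the base point p, which
        itself lies in R.\<close>
      show ?thesis
        using p v Rreal normal[OF _ _ g(4,3,1,2)] by (intro CH_metric_real_orthogonal) auto
    qed
    then show "v \<in> normal_space CH_metric (orbit act S p) p"
      by (simp add: normal_space_def)
  qed
  ultimately show ?thesis
    unfolding polar_action_def using assms(1)
    by (intro conjI exI[of _ "CH \<inter> R"] exI[of _ "dim R"]) auto
qed

section \<open>Foliation and section for orbits given as level sets of the invariants\<close>

context
  fixes u :: "complex^'n::finite" and W :: "(complex^'n) set"
    and S :: "(complex^('n option)^('n option)) set"
  assumes u: "norm u = 1" and W: "subspace W"
    and Wu: "\<And>w. w \<in> W \<Longrightarrow> cinner w u = 0"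
    and Wreal: "\<And>v w. v \<in> W \<Longrightarrow> w \<in> W \<Longrightarrow> Im (cinner v w) = 0"
    and iso: "isometric_action CH CH_metric CH_act S"
begin

lemma uW: "w \<in> W \<Longrightarrow> cinner u w = 0"
  using Wu[of w] cnj_cinner[of w u] by simp

text \<open>Pairing the chart of weight 1 with u returns the height, and with w in W the number
  \<open>horo_vec u z \<bullet> w\<close>. Equal invariants thus mean that the chart images differ
  by a vector orthogonal to u and W.\<close>

lemma foliation_horospherical:
  assumes orb: "\<And>p. p \<in> CH \<Longrightarrow> orbit CH_act S p =
     {q \<in> CH. horo_height u q = horo_height u p \<and> (\<forall>w\<in>W. horo_vec u q \<bullet> w = horo_vec u p \<bullet> w)}"
  shows "foliation CH (orbits CH_act S CH)"
  unfolding orbits_def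
proof (rule foliation_by_flat_leaves)
  show "diffeomorphism CH (halfspace u) (horo_chart u (\<lambda>_. 1)) (horo_inv u (\<lambda>_. 1))"
    by (intro diffeomorphism_horo_chart u smooth_on_const) auto
  show "subspace {x. x \<bullet> u = 0 \<and> (\<forall>w\<in>W. x \<bullet> w = 0)}"
    by (auto simp: subspace_def inner_add_left)
  show "orbit CH_act S p = {q \<in> CH. horo_chart u (\<lambda>_. 1) q - horo_chart u (\<lambda>_. 1) p
      \<in> {x. x \<bullet> u = 0 \<and> (\<forall>w\<in>W. x \<bullet> w = 0)}}" if "p \<in> CH" for p
    unfolding orb[OF that] mem_Collect_eq inner_diff_left horo_chart_inner_u[OF u]
    using horo_chart_inner_orth[OF uW] by auto
qed (rule convex_halfspace)

text \<open>The weight turns the pairing of the chart with w into the scale-invariant quotient in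
  \<open>orb\<close>; since the height may now vary, the leaves are parallel to the orthogonal
  complement of W alone.\<close>

lemma foliation_equidistant:
  assumes orb: "\<And>p. p \<in> CH \<Longrightarrow> orbit CH_act S p = {q \<in> CH. \<forall>w\<in>W.
     (horo_vec u q \<bullet> w) / sqrt (horo_height u q) = (horo_vec u p \<bullet> w) / sqrt (horo_height u p)}"
  shows "foliation CH (orbits CH_act S CH)"
  unfolding orbits_def
proof (rule foliation_by_flat_leaves)
  let ?\<rho> = "\<lambda>s. inverse (sqrt s)"
  have "smooth_on {0<..} ?\<rho>"
    by (intro smooth_on_inverse smooth_on_sqrt) auto
  then show "diffeomorphism CH (halfspace u) (horo_chart u ?\<rho>) (horo_inv u ?\<rho>)"
    by (intro diffeomorphism_horo_chart u) auto
  show "subspace {x. \<forall>w\<in>W. x \<bullet> w = 0}"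
    by (auto simp: subspace_def inner_add_left)
  show "orbit CH_act S p = {q \<in> CH. horo_chart u ?\<rho> q - horo_chart u ?\<rho> p \<in> {x. \<forall>w\<in>W. x \<bullet> w = 0}}"
    if "p \<in> CH" for p
    unfolding orb[OF that] mem_Collect_eq inner_diff_left
    using horo_chart_inner_orth[OF uW] by (auto simp: divide_inverse mult.commute)
qed (rule convex_halfspace)

lemma polar_horospherical:
  assumes orb: "\<And>p. p \<in> CH \<Longrightarrow> orbit CH_act S p =
     {q \<in> CH. horo_height u q = horo_height u p \<and> (\<forall>w\<in>W. horo_vec u q \<bullet> w = horo_vec u p \<bullet> w)}"
  shows "polar_action CH CH_metric CH_act S"
proof (rule polar_actionI[OF iso])
  let ?R = "{r *\<^sub>R u + w | r w. w \<in> W}"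
  have uu: "cinner u u = 1" using u by (simp add: cinner_self)
  show "subspace ?R"
    unfolding subspace_def
  proof (intro conjI ballI allI)
    show "0 \<in> ?R" using subspace_0[OF W] by (auto intro!: exI[of _ 0])
    show "x + y \<in> ?R" if xy: "x \<in> ?R" "y \<in> ?R" for x y
    proof -
      obtain r w r' w' where "x = r *\<^sub>R u + w" "y = r' *\<^sub>R u + w'" "w \<in> W" "w' \<in> W" using xy by blast
      then show ?thesis
        using subspace_add[OF W] by (intro CollectI exI[of _ "r + r'"] exI[of _ "w + w'"]) (simp add: algebra_simps)
    qed
    show "c *\<^sub>R x \<in> ?R" if x: "x \<in> ?R" for c x
    proof -
      obtain r w where "x = r *\<^sub>R u + w" "w \<in> W" using x by blast
      then show ?thesis
        using subspace_scale[OF W] by (intro CollectI exI[of _ "c * r"] exI[of _ "c *\<^sub>R w"]) (simp add: algebra_simps)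
    qed
  qed
  show "Im (cinner v w) = 0" if vw: "v \<in> ?R" "w \<in> ?R" for v w
  proof -
    obtain r x r' y where "v = r *\<^sub>R u + x" "w = r' *\<^sub>R u + y" "x \<in> W" "y \<in> W" using vw by blast
    then show ?thesis by (simp add: cinner_simps uu Wu uW Wreal)
  qed
  show "orbit CH_act S p \<subseteq> CH" if "p \<in> CH" for p using orb[OF that] by auto
  show "?R \<inter> orbit CH_act S p \<noteq> {}" if p: "p \<in> CH" for p
  proof -
    obtain w0 where w0: "w0 \<in> W" "\<And>w. w \<in> W \<Longrightarrow> w0 \<bullet> w = horo_vec u p \<bullet> w"
      using subspace_projection[OF W] by metis
    \<comment> \<open>The point is prescribed in the chart: the height of p, the W-part of its
      vector, and imaginary part 0, which will keep the preimage in the real span of u and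
      W.\<close>
    define y where "y = horo_height u p *\<^sub>R u + w0"
    have yu: "cinner y u = of_real (horo_height u p)"
      by (simp add: y_def cinner_simps uu Wu w0)
    then have y: "y \<in> halfspace u" using horo_height_pos[OF u p] by (simp add: halfspace_def)
    let ?z = "horo_inv u (\<lambda>_. 1) y"
    have z: "?z \<in> CH" "horo_chart u (\<lambda>_. 1) ?z = y"
      using horo_chart_inv[OF u y, of "\<lambda>_. 1"] by auto
    have "horo_height u ?z = horo_height u p"
      using horo_chart_inner_u[OF u, of "\<lambda>_. 1" ?z] yu unfolding z(2) by (simp add: Re_cinner[symmetric])
    moreover have "horo_vec u ?z \<bullet> w = horo_vec u p \<bullet> w" if "w \<in> W" for w
    proof -
      have "horo_vec u ?z \<bullet> w = y \<bullet> w"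
        using horo_chart_inner_orth[OF uW[OF that], of "\<lambda>_. 1" ?z] unfolding z(2) by simp
      also have "\<dots> = w0 \<bullet> w" using uW[OF that] by (simp add: y_def Re_cinner[symmetric] cinner_simps)
      finally show ?thesis using w0 that by simp
    qed
    ultimately have "?z \<in> orbit CH_act S p" using z(1) by (simp add: orb[OF p])
    moreover have "?z \<in> ?R"
    proof -
      \<comment> \<open>The value of \<zeta> at y. It is real, so \<open>horo_inv\<close> forms only
        real linear combinations of u and w0.\<close>
      define k where "k = horo_height u p + (norm w0)\<^sup>2 / 4"
      have smult: "of_real r *s x = r *\<^sub>R x" for r and x :: "complex^'n"
        by (simp add: vec_eq_iff scaleR_conv_of_real[where 'a = complex])
      have "inverse 1 *\<^sub>R (y - of_real (horo_height u p) *s u) = w0"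
        by (simp add: y_def smult)
      then have "?z = inverse (of_real k + 1) *s ((of_real k - 1) *s u + w0)"
        by (simp only: horo_inv_def Let_def yu Re_complex_of_real k_def of_real_add)
      also have "\<dots> = of_real (inverse (k + 1)) *s (of_real (k - 1) *s u + w0)"
        by simp
      also have "\<dots> = (inverse (k + 1) * (k - 1)) *\<^sub>R u + inverse (k + 1) *\<^sub>R w0"
        by (simp only: smult scaleR_add_right scaleR_scaleR)
      finally show ?thesis using subspace_scale[OF W w0(1)] by blast
    qed
    ultimately show ?thesis by blast
  qed
  show "v \<bullet> q = 0" if p: "p \<in> CH" "p \<in> ?R" and g: "(\<gamma> has_vector_derivative q) (at 0)" "\<gamma> 0 = p"
    and e: "e > (0::real)" "\<gamma> ` {-e<..<e} \<subseteq> orbit CH_act S p" and v: "v \<in> ?R" for p \<gamma> q e v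
  proof -
    obtain x y where xy: "p = x *\<^sub>R u + y" "y \<in> W" using p(2) by blast
    have px: "cinner p u = of_real x" by (simp add: xy cinner_simps uu Wu)
    have "x \<noteq> 1" using one_minus_cinner_nz[OF u p(1)] px by auto
    have const: "horo_height u (\<gamma> t) = horo_height u p"
      "\<And>w. w \<in> W \<Longrightarrow> horo_vec u (\<gamma> t) \<bullet> w = horo_vec u p \<bullet> w" if t: "t \<in> {-e<..<e}" for t
    proof -
      have "\<gamma> t \<in> orbit CH_act S p" using e(2) t by blast
      then show "horo_height u (\<gamma> t) = horo_height u p"
        "\<And>w. w \<in> W \<Longrightarrow> horo_vec u (\<gamma> t) \<bullet> w = horo_vec u p \<bullet> w"
        unfolding orb[OF p(1)] by blast+
    qed
    have real: "Im (cinner p w) = 0" if "w \<in> W" for w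
      using that xy by (simp add: cinner_simps uW Wreal)
    have "2 * ((1 - (norm p)\<^sup>2) * (q \<bullet> u) - (1 - x) * (p \<bullet> q)) / (1 - x) ^ 3 = 0"
      by (rule DERIV_const_near_0[OF horo_height_derivative[OF g px \<open>x \<noteq> 1\<close>] e(1) const(1)])
    then have 1: "(1 - (norm p)\<^sup>2) * (q \<bullet> u) = (1 - x) * (p \<bullet> q)"
      using \<open>x \<noteq> 1\<close> by simp
    have 2: "(1 - x) * (q \<bullet> w) + (p \<bullet> w) * (q \<bullet> u) = 0" if w: "w \<in> W" for w
    proof -
      have "2 * ((1 - x) * (q \<bullet> w) + (p \<bullet> w) * (q \<bullet> u)) / (1 - x)\<^sup>2 = 0"
        by (rule DERIV_const_near_0[OF horo_vec_derivative[OF g px \<open>x \<noteq> 1\<close> uW[OF w] real[OF w]]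
              e(1) const(2)[OF _ w]])
      then show ?thesis using \<open>x \<noteq> 1\<close> by simp
    qed
    have uy: "u \<bullet> y = 0" "y \<bullet> u = 0" "u \<bullet> u = 1"
      using uW[OF xy(2)] Wu[OF xy(2)] u by (simp_all add: Re_cinner[symmetric] cinner_self)
    have pp: "(norm p)\<^sup>2 = x\<^sup>2 + y \<bullet> y" "p \<bullet> y = y \<bullet> y" "p \<bullet> q = x * (q \<bullet> u) + q \<bullet> y"
      unfolding power2_norm_eq_inner xy
      by (simp_all add: inner_add_left inner_add_right uy power2_eq_square
          inner_commute[of u q] inner_commute[of y q])
    \<comment> \<open>With a = \<open>q \<bullet> u\<close>, b = \<open>q \<bullet> y\<close> and c
      = \<open>y \<bullet> y\<close>, these are the height equation and the vector equation for w =
      y. Eliminating b cancels c as well and leaves (1 - x^2) a = (1 - x) x a.\<close>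
    have "(1 - x) * a = 0" if "(1 - (x\<^sup>2 + c)) * a = (1 - x) * (x * a + b)" "(1 - x) * b + c * a = 0" for a b c
      using that by algebra
    from this[OF 1[unfolded pp] 2[OF xy(2), unfolded pp(2)]] have "(1 - x) * (q \<bullet> u) = 0" .
    then have qu: "q \<bullet> u = 0" using \<open>x \<noteq> 1\<close> by simp
    then have "q \<bullet> w = 0" if "w \<in> W" for w using 2[OF that] \<open>x \<noteq> 1\<close> by simp
    moreover obtain r w where "v = r *\<^sub>R u + w" "w \<in> W" using v by blast
    ultimately show ?thesis
      using qu by (simp add: inner_add_left inner_commute[of u q] inner_commute[of w q])
  qed
qed

lemma polar_equidistant:
  assumes orb: "\<And>p. p \<in> CH \<Longrightarrow> orbit CH_act S p = {q \<in> CH. \<forall>w\<in>W.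
     (horo_vec u q \<bullet> w) / sqrt (horo_height u q) = (horo_vec u p \<bullet> w) / sqrt (horo_height u p)}"
  shows "polar_action CH CH_metric CH_act S"
proof (rule polar_actionI[OF iso W Wreal])
  have vec: "horo_vec u p = 2 *\<^sub>R p" "horo_height u p = 1 - (norm p)\<^sup>2" if "p \<in> W" for p
    using that by (simp_all add: horo_vec_def horo_height_def Wu vec_eq_iff scaleR_conv_of_real[where 'a = complex])
  show "orbit CH_act S p \<subseteq> CH" if "p \<in> CH" for p using orb[OF that] by auto
  show "W \<inter> orbit CH_act S p \<noteq> {}" if p: "p \<in> CH" for p
  proof -
    obtain w0 where w0: "w0 \<in> W" "\<And>w. w \<in> W \<Longrightarrow> w0 \<bullet> w = (horo_vec u p /\<^sub>R sqrt (horo_height u p)) \<bullet> w"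
      using subspace_projection[OF W] by metis
    \<comment> \<open>The positive solution of 2 s = sqrt (1 - s^2 |w0|^2), which makes the
      normalised vector part of s w0 equal to w0.\<close>
    define s where "s = inverse (sqrt (4 + (norm w0)\<^sup>2))"
    let ?z = "s *\<^sub>R w0"
    have pos: "4 + (norm w0)\<^sup>2 > 0" by (simp add: add_pos_nonneg)
    then have s: "s > 0" "s\<^sup>2 = inverse (4 + (norm w0)\<^sup>2)"
      by (simp_all add: s_def power_inverse)
    have zW: "?z \<in> W" using subspace_scale[OF W w0(1)] .
    have n: "(norm ?z)\<^sup>2 = (norm w0)\<^sup>2 / (4 + (norm w0)\<^sup>2)"
      by (simp add: power_mult_distrib s(2) divide_inverse)
    then have z: "?z \<in> CH" using pos by (simp add: mem_CH)
    have "horo_height u ?z = (2 * s)\<^sup>2"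
      unfolding vec(2)[OF zW] n using pos by (simp add: power_mult_distrib s(2) field_simps)
    then have "sqrt (horo_height u ?z) = 2 * s" using s(1) by (simp add: real_sqrt_mult)
    then have "(horo_vec u ?z \<bullet> w) / sqrt (horo_height u ?z) = (horo_vec u p \<bullet> w) / sqrt (horo_height u p)"
      if "w \<in> W" for w
    proof -
      have "(horo_vec u ?z \<bullet> w) / (2 * s) = w0 \<bullet> w"
        using s(1) by (simp add: vec(1)[OF zW])
      also have "\<dots> = (horo_vec u p \<bullet> w) / sqrt (horo_height u p)"
        by (simp add: w0(2)[OF that] divide_inverse_commute)
      finally show ?thesis using \<open>sqrt (horo_height u ?z) = 2 * s\<close> by simp
    qed
    then have "?z \<in> orbit CH_act S p" using z by (simp add: orb[OF p])
    then show ?thesis using zW by blast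
  qed
  show "v \<bullet> q = 0" if p: "p \<in> CH" "p \<in> W" and g: "(\<gamma> has_vector_derivative q) (at 0)" "\<gamma> 0 = p"
    and e: "e > (0::real)" "\<gamma> ` {-e<..<e} \<subseteq> orbit CH_act S p" and v: "v \<in> W" for p \<gamma> q e v
  proof -
    have px: "cinner p u = of_real 0" using Wu[OF p(2)] by simp
    define h where "h = 1 - (norm p)\<^sup>2"
    have h: "h > 0" using p(1) by (simp add: h_def mem_CH)
    have hp: "horo_height u p = h" using vec(2)[OF p(2)] by (simp add: h_def)
    have d1: "((\<lambda>t. horo_height u (\<gamma> t)) has_real_derivative 2 * (h * (q \<bullet> u) - p \<bullet> q)) (at 0)"
      using horo_height_derivative[OF g px] by (simp add: h_def)
    have "((\<lambda>t. sqrt (horo_height u (\<gamma> t))) has_real_derivative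
        inverse (sqrt h) / 2 * (2 * (h * (q \<bullet> u) - p \<bullet> q))) (at 0)"
      using DERIV_chain2[OF DERIV_real_sqrt d1] h hp g(2) by simp
    moreover have "inverse (sqrt h) / 2 * (2 * r) = inverse (sqrt h) * r" for r
      by simp
    ultimately have d2: "((\<lambda>t. sqrt (horo_height u (\<gamma> t))) has_real_derivative
        inverse (sqrt h) * (h * (q \<bullet> u) - p \<bullet> q)) (at 0)"
      by metis
    have *: "h * (q \<bullet> w) + (p \<bullet> w) * (p \<bullet> q) = 0" if w: "w \<in> W" for w
    proof -
      \<comment> \<open>The constant value of the quotient along the orbit. Differentiating the
        numerator minus c times the root, rather than the quotient, keeps the computation
        linear.\<close>
      define c where "c = 2 * (p \<bullet> w) / sqrt h"
      have d3: "((\<lambda>t. horo_vec u (\<gamma> t) \<bullet> w) has_real_derivative 2 * ((q \<bullet> w) + (p \<bullet> w) * (q \<bullet> u))) (at 0)"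
        using horo_vec_derivative[OF g px _ uW[OF w] Wreal[OF p(2) w]] by simp
      have "2 * ((q \<bullet> w) + (p \<bullet> w) * (q \<bullet> u)) - c * (inverse (sqrt h) * (h * (q \<bullet> u) - p \<bullet> q)) = 0"
      proof (rule DERIV_const_near_0[OF DERIV_diff[OF d3 DERIV_cmult[OF d2]] e(1), of _ 0])
        fix t assume t: "t \<in> {-e<..<e}"
        have "\<gamma> t \<in> orbit CH_act S p" using e(2) t by blast
        then have "\<gamma> t \<in> CH"
          "(horo_vec u (\<gamma> t) \<bullet> w) / sqrt (horo_height u (\<gamma> t)) = (horo_vec u p \<bullet> w) / sqrt (horo_height u p)"
          unfolding orb[OF p(1)] using w by blast+
        then have "\<gamma> t \<in> CH" "(horo_vec u (\<gamma> t) \<bullet> w) / sqrt (horo_height u (\<gamma> t)) = c"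
          by (simp_all add: c_def hp vec(1)[OF p(2)])
        moreover have "sqrt (horo_height u (\<gamma> t)) > 0" using horo_height_pos[OF u \<open>\<gamma> t \<in> CH\<close>] by simp
        ultimately show "horo_vec u (\<gamma> t) \<bullet> w - c * sqrt (horo_height u (\<gamma> t)) = 0"
          by (simp add: field_simps)
      qed
      moreover have "c * inverse (sqrt h) = 2 * (p \<bullet> w) / (sqrt h * sqrt h)"
        by (simp only: c_def divide_inverse inverse_mult_distrib mult.assoc)
      then have "c * (inverse (sqrt h) * (h * (q \<bullet> u) - p \<bullet> q)) = 2 * ((p \<bullet> w) / h * (h * (q \<bullet> u) - p \<bullet> q))"
        using h by (simp add: mult.assoc[symmetric])
      ultimately have "(q \<bullet> w) + (p \<bullet> w) * (q \<bullet> u) - (p \<bullet> w) / h * (h * (q \<bullet> u) - p \<bullet> q) = 0"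
        by simp
      then show ?thesis using h by (simp add: field_simps)
    qed
    \<comment> \<open>The choice w = p gives (h + |p|^2) (p \<bullet> q) = 0, where h + |p|^2 = 1;
      then the relation for w = v reduces to h (q \<bullet> v) = 0.\<close>
    have "h * (p \<bullet> q) + (norm p)\<^sup>2 * (p \<bullet> q) = 0"
      using *[OF p(2)] by (simp add: inner_commute power2_norm_eq_inner)
    then have "p \<bullet> q = 0" by (simp add: h_def algebra_simps)
    then show ?thesis using *[OF v] h by (simp add: inner_commute)
  qed
qed

end

section \<open>Maximal abelian subspaces\<close>

lemma sum_option: "(\<Sum>i\<in>UNIV. f i) = f None + (\<Sum>j\<in>UNIV. f (Some j))"
  for f :: "'n::finite option \<Rightarrow> 'b::comm_monoid_add"
  unfolding UNIV_option_conv by (simp add: sum.reindex comp_def)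

definition herm_sign :: "'n option \<Rightarrow> complex" where
  "herm_sign i = (if i = None then -1 else 1)"

lemma herm_sign_simps [simp]: "herm_sign None = -1" "herm_sign (Some j) = 1"
  "herm_sign i * herm_sign i = 1" "cnj (herm_sign i) = herm_sign i"
  by (simp_all add: herm_sign_def)

lemma herm_form_sum: "herm_form x y = (\<Sum>i\<in>UNIV. herm_sign i * (x $ i * cnj (y $ i)))"
  by (simp add: herm_form_def sum_option)

lemma cinner_hc: "cinner (hc c z) (hc d w) = c * cnj d + cinner z w"
  by (simp add: cinner_def sum_option)

lemma cinner_adjoint: "cinner (A *v x) y = cinner x (map_matrix cnj (transpose A) *v y)"
proof -
  have "cinner (A *v x) y = (\<Sum>i\<in>UNIV. \<Sum>j\<in>UNIV. A $ i $ j * x $ j * cnj (y $ i))"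
    by (simp add: cinner_def matrix_vector_mult_def sum_distrib_right)
  also have "\<dots> = (\<Sum>j\<in>UNIV. \<Sum>i\<in>UNIV. A $ i $ j * x $ j * cnj (y $ i))"
    by (rule sum.swap)
  also have "\<dots> = cinner x (map_matrix cnj (transpose A) *v y)"
    by (simp add: cinner_def matrix_vector_mult_def sum_distrib_left map_matrix_def transpose_def mult_ac)
  finally show ?thesis .
qed

text \<open>The operator sending y to \<open>herm_form y q *s p\<close>. Its adjoint for the form is
  \<open>rank1 q p\<close>, so \<open>rank1 p q - rank1 q p\<close> is skew.\<close>

definition rank1 :: "complex^('n::finite option) \<Rightarrow> complex^('n option) \<Rightarrow> complex^('n option)^('n option)" where
  "rank1 p q = (\<chi> i j. herm_sign j * (p $ i * cnj (q $ j)))"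

lemma rank1_vec: "rank1 p q *v y = herm_form y q *s p"
  by (simp add: rank1_def matrix_vector_mult_def herm_form_sum vec_eq_iff sum_distrib_left mult_ac)

lemma trace_rank1: "trace (rank1 p q) = herm_form p q"
  by (simp add: rank1_def trace_def herm_form_sum)

lemma matrix_scaleR_vec: "(r *\<^sub>R A) *v x = r *\<^sub>R (A *v x)" "A *v (r *\<^sub>R x) = r *\<^sub>R (A *v x)"
  for A :: "complex^'m^'k"
  by (simp_all add: matrix_vector_mult_def vec_eq_iff scaleR_sum_right)

lemma smult_of_real: "of_real r *s x = r *\<^sub>R x" for x :: "complex^'m"
  by (simp add: vec_eq_iff scaleR_conv_of_real[where 'a = complex])

lemma bracket_vec: "bracket X Y *v y = X *v (Y *v y) - Y *v (X *v y)"
  by (simp add: bracket_def matrix_vector_mult_diff_rdistrib matrix_vector_mul_assoc)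

lemma su_skew: "X \<in> su \<Longrightarrow> herm_form (X *v x) y = - herm_form x (X *v y)"
  by (simp add: su_def eq_neg_iff_add_eq_0)

lemma suI: "trace X = 0 \<Longrightarrow> (\<And>x y. herm_form (X *v x) y + herm_form x (X *v y) = 0) \<Longrightarrow> X \<in> su"
  by (simp add: su_def)

lemma rank1_diff_su:
  assumes "Im (herm_form p q) = 0"
  shows "rank1 p q - rank1 q p \<in> su"
proof (rule suI)
  have "herm_form q p = herm_form p q"
    using assms cnj_herm_form[of p q] by (metis Reals_cnj_iff complex_is_Real_iff)
  then show "trace (rank1 p q - rank1 q p) = 0" by (simp add: trace_sub trace_rank1)
  show "herm_form ((rank1 p q - rank1 q p) *v x) y + herm_form x ((rank1 p q - rank1 q p) *v y) = 0" for x y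
    by (simp add: matrix_vector_mult_diff_rdistrib rank1_vec herm_form_simps cnj_herm_form)
qed

text \<open>The element of \<pp> that exchanges the time axis with the direction z;
  \<open>p_to_tangent\<close> maps it to z.\<close>

definition pmat :: "complex^'n::finite \<Rightarrow> complex^('n option)^('n option)" where
  "pmat z = rank1 (hc 1 0) (hc 0 z) - rank1 (hc 0 z) (hc 1 0)"

lemma pmat_vec: "pmat z *v hc c w = hc (cinner w z) (c *s z)"
  by (simp add: pmat_def matrix_vector_mult_diff_rdistrib rank1_vec herm_form_hc cinner_simps hc_smult
      hc_diff)

lemma hc_matrix_eqI:
  assumes "\<And>c z. A *v hc c z = B *v hc c z"
  shows "A = B"
  unfolding matrix_eq by (metis assms hc_cases)

text \<open>Elements of \<pp> are skew for \<open>herm_form\<close> and symmetric for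
  \<open>cinner\<close>. The two forms agree on space vectors and differ by a sign on the time axis,
  so both diagonal blocks vanish and X is determined by its value on the time axis.\<close>

lemma cartan_p_cases:
  assumes "X \<in> cartan_p"
  obtains z where "X = pmat z"
proof -
  have X: "X \<in> su" and "map_matrix cnj (transpose X) = X"
    using assms by (simp_all add: cartan_p_def cartan_inv_def)
  then have sym: "cinner (X *v x) y = cinner x (X *v y)" for x y
    using cinner_adjoint[of X x y] by simp
  obtain a z where az: "X *v hc 1 0 = hc a z" by (rule hc_cases)
  have "a = cnj a" "a = - cnj a"
    using sym[of "hc 1 0" "hc 1 0"] su_skew[OF X, of "hc 1 0" "hc 1 0"]
    by (simp_all add: az cinner_hc herm_form_hc cinner_simps)
  then have a: "a = 0" by simp
  have 0: "X *v hc 0 w = hc (cinner w z) 0" for w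
  proof -
    obtain b w' where bw: "X *v hc 0 w = hc b w'" by (rule hc_cases)
    have "b = cinner w z"
      using su_skew[OF X, of "hc 0 w" "hc 1 0"] by (simp add: az a bw herm_form_hc cinner_simps)
    moreover have "cinner w' w' = 0"
    proof -
      obtain d v where dv: "X *v hc 0 w' = hc d v" by (rule hc_cases)
      show ?thesis
        using sym[of "hc 0 w" "hc 0 w'"] su_skew[OF X, of "hc 0 w" "hc 0 w'"]
        by (simp add: bw dv cinner_hc herm_form_hc)
    qed
    ultimately show ?thesis using bw by (simp add: cinner_self)
  qed
  have "X *v hc c w = pmat z *v hc c w" for c w
  proof -
    have "hc c w = c *s hc 1 0 + hc 0 w" by (simp add: hc_smult hc_add)
    then have "X *v hc c w = c *s (X *v hc 1 0) + X *v hc 0 w"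
      by (simp add: matrix_vector_right_distrib matrix_vector_smult)
    then show ?thesis by (simp add: az a 0 pmat_vec hc_smult hc_add)
  qed
  then show ?thesis by (intro that[of z] hc_matrix_eqI)
qed

lemma pmat_scaleR: "pmat (r *\<^sub>R z) = r *\<^sub>R pmat z"
proof (rule hc_matrix_eqI)
  have "c *s (r *\<^sub>R z) = r *\<^sub>R (c *s z)" for c
    by (simp add: vec_eq_iff)
  then show "pmat (r *\<^sub>R z) *v hc c w = (r *\<^sub>R pmat z) *v hc c w" for c w
    by (simp add: pmat_vec matrix_scaleR_vec hc_scaleR cinner_simps scaleR_conv_of_real[where 'a = complex])
qed

text \<open>Eliminating the space part gives \<nu>^2 c = |u|^2 c for the time coordinate c; if c =
  0, then \<nu> annihilates a nonzero space part.\<close>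

lemma pmat_eigenvalue:
  assumes "pmat u *v y = of_real \<nu> *s y" "y \<noteq> 0"
  shows "\<nu> = 0 \<or> \<nu> = norm u \<or> \<nu> = - norm u"
proof -
  obtain c w where y: "y = hc c w" by (rule hc_cases)
  let ?n = "of_real ((norm u)\<^sup>2) :: complex"
  have 1: "cinner w u = of_real \<nu> * c" "c *s u = of_real \<nu> *s w"
    using assms(1) by (simp_all add: y pmat_vec hc_smult)
  have "of_real \<nu> * (of_real \<nu> * c) = cinner (of_real \<nu> *s w) u"
    by (simp add: cinner_simps 1(1))
  also have "\<dots> = ?n * c" by (simp add: 1(2)[symmetric] cinner_simps cinner_self mult.commute)
  finally have "(\<nu>\<^sup>2 - (norm u)\<^sup>2) = 0 \<or> c = 0"
    by (auto simp: power2_eq_square simp flip: of_real_mult mult.assoc)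
  moreover have "\<nu> = 0" if "c = 0"
    using 1 that assms(2) y by (auto simp: hc_0)
  ultimately show ?thesis by (auto simp: power2_eq_iff)
qed

text \<open>The eigenvalues of \<open>pmat u\<close> are \<open>0\<close> and \<open>\<plusminus>|u|\<close>, and those of \<open>bracket (pmat u)\<close> are their
  differences. As both \<open>\<alpha>\<close> and \<open>2\<alpha>\<close> are roots, this forces \<open>|u| = 1\<close> once \<open>\<alpha> (pmat u) = 1\<close>.\<close>

lemma root_value:
  assumes "bracket (pmat u) X = \<mu> *\<^sub>R X" "X \<noteq> 0" "u \<noteq> 0" "\<mu> > 0"
  shows "\<mu> = norm u \<or> \<mu> = 2 * norm u"
proof -
  let ?n = "of_real (norm u) :: complex"
  have n: "?n \<noteq> 0" "norm u > 0" using assms(3) by simp_all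
  have uu: "cinner u u = ?n * ?n" by (simp add: cinner_self power2_eq_square)
  \<comment> \<open>X carries a \<nu>-eigenvector of \<open>pmat u\<close> to one for \<nu> + \<mu>
    unless it kills it, so \<mu> is a positive difference of two eigenvalues.\<close>
  have eig: "\<mu> = norm u \<or> \<mu> = 2 * norm u"
    if y: "pmat u *v y = of_real \<nu> *s y" "X *v y \<noteq> 0" "\<nu> \<in> {norm u, - norm u, 0}" for y \<nu>
  proof -
    have "pmat u *v (X *v y) = X *v (pmat u *v y) + \<mu> *\<^sub>R (X *v y)"
      using arg_cong[OF assms(1), of "\<lambda>A. A *v y"] by (simp add: bracket_vec matrix_scaleR_vec algebra_simps)
    also have "\<dots> = of_real (\<nu> + \<mu>) *s (X *v y)"
      unfolding y(1) smult_of_real matrix_scaleR_vec by (simp add: scaleR_add_left)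
    finally have "\<nu> + \<mu> = 0 \<or> \<nu> + \<mu> = norm u \<or> \<nu> + \<mu> = - norm u"
      using y(2) by (rule pmat_eigenvalue)
    moreover have "\<nu> = norm u \<or> \<nu> = - norm u \<or> \<nu> = 0" using y(3) by blast
    ultimately show ?thesis using n(2) assms(4) by (smt (verit))
  qed
  show ?thesis
  proof (rule ccontr)
    assume neg: "\<not> ?thesis"
    \<comment> \<open>If \<mu> were neither value, X would kill the eigenvectors for |u|, -|u| and
      0, and these span everything.\<close>
    have p: "X *v hc ?n u = 0"
      using eig[of "hc ?n u" "norm u"] neg by (auto simp: pmat_vec uu hc_smult)
    have m: "X *v hc ?n (- u) = 0"
      using eig[of "hc ?n (- u)" "- norm u"] neg by (auto simp: pmat_vec uu hc_smult cinner_simps vec_eq_iff)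
    have o: "X *v hc 0 w = 0" if "cinner w u = 0" for w
      using eig[of "hc 0 w" 0] neg that by (auto simp: pmat_vec hc_0)
    have "X *v hc c z = 0 *v hc c z" for c z
    proof -
      define k where "k = cinner z u / (?n * ?n)"
      define \<beta> \<gamma> where "\<beta> = (c / ?n + k) / 2" and "\<gamma> = (c / ?n - k) / 2"
      have "\<beta> * ?n + \<gamma> * ?n = c" "k = \<beta> - \<gamma>"
        using n by (simp_all add: \<beta>_def \<gamma>_def field_simps)
      then have "hc c z = \<beta> *s hc ?n u + \<gamma> *s hc ?n (- u) + hc 0 (z - k *s u)"
        by (simp add: hc_smult hc_add)
      moreover have "cinner (z - k *s u) u = 0"
        using n by (simp add: cinner_simps uu k_def)
      ultimately show ?thesis
        by (simp add: matrix_vector_right_distrib matrix_vector_smult p m o)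
    qed
    then have "X = 0" by (rule hc_matrix_eqI)
    then show False using assms(2) by simp
  qed
qed

lemma maximal_abelian_generator:
  assumes a: "maximal_abelian_in_p \<aa>" and alpha: "restricted_root_decomposition \<aa> \<alpha>"
  obtains u where "norm u = 1" "\<aa> = range (\<lambda>r. r *\<^sub>R pmat u)" "\<alpha> (pmat u) = 1"
proof -
  have ab: "subspace \<aa>" "\<aa> \<subseteq> cartan_p" "\<And>X Y. X \<in> \<aa> \<Longrightarrow> Y \<in> \<aa> \<Longrightarrow> bracket X Y = 0"
    using a by (auto simp: maximal_abelian_in_p_def abelian_in_p_def)
  have lin: "linear \<alpha>" and root: "\<And>c. c \<in> {-2, -1, 1, 2} \<Longrightarrow> restricted_root \<aa> (\<lambda>H. c * \<alpha> H)"
    using alpha by (auto simp: restricted_root_decomposition_def)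
  obtain H where H: "H \<in> \<aa>" "\<alpha> H \<noteq> 0" using root[of 1] by (auto simp: restricted_root_def)
  obtain z where z: "H = pmat z" using cartan_p_cases[of H] ab(2) H(1) by blast
  \<comment> \<open>Dividing by \<open>\<alpha> H\<close> normalises the generator so that \<alpha>
    takes the value 1 on it.\<close>
  define u where "u = inverse (\<alpha> H) *\<^sub>R z"
  have A: "pmat u \<in> \<aa>" "\<alpha> (pmat u) = 1"
    using H ab(1) lin by (simp_all add: u_def pmat_scaleR subspace_scale linear_cmul flip: z)
  have "u \<noteq> 0"
  proof
    assume "u = 0"
    then have "pmat u = 0" using pmat_scaleR[of 0 u] by simp
    then show False using A(2) linear_0[OF lin] by simp
  qed
  have range: "\<aa> = range (\<lambda>r. r *\<^sub>R pmat u)"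
  proof
    show "range (\<lambda>r. r *\<^sub>R pmat u) \<subseteq> \<aa>" using A(1) ab(1) by (auto intro: subspace_scale)
    show "\<aa> \<subseteq> range (\<lambda>r. r *\<^sub>R pmat u)"
    proof
      fix K assume K: "K \<in> \<aa>"
      obtain x where x: "K = pmat x" using cartan_p_cases[of K] ab(2) K by blast
      \<comment> \<open>Commuting with \<open>pmat u\<close> is tested on two vectors: (1, 0) shows
        that \<open>cinner u x\<close> is real, and (0, u) that x is proportional to u.\<close>
      have br: "bracket (pmat x) (pmat u) *v y = 0" for y using ab(3)[OF K A(1)] x by simp
      have "cinner u x = cinner x u"
        using br[of "hc 1 0"] by (simp add: bracket_vec pmat_vec hc_diff cinner_simps flip: hc_0)
      then have real: "cinner u x = of_real (u \<bullet> x)"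
        using cnj_cinner[of u x] by (simp add: complex_eq_iff Re_cinner)
      have "cinner u u *s x = cinner u x *s u"
        using br[of "hc 0 u"] by (simp add: bracket_vec pmat_vec hc_diff cinner_simps flip: hc_0)
      then have "(norm u)\<^sup>2 *\<^sub>R x = (u \<bullet> x) *\<^sub>R u"
        unfolding cinner_self real smult_of_real .
      then have "inverse ((norm u)\<^sup>2) *\<^sub>R ((norm u)\<^sup>2 *\<^sub>R x) = (inverse ((norm u)\<^sup>2) * (u \<bullet> x)) *\<^sub>R u"
        by simp
      then have "x = (inverse ((norm u)\<^sup>2) * (u \<bullet> x)) *\<^sub>R u" using \<open>u \<noteq> 0\<close> by simp
      then show "K \<in> range (\<lambda>r. r *\<^sub>R pmat u)" using x pmat_scaleR by (metis rangeI)
    qed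
  qed
  have val: "c = norm u \<or> c = 2 * norm u" if c: "c \<in> {1, 2}" for c :: real
  proof -
    have "root_space \<aa> (\<lambda>H. c * \<alpha> H) \<noteq> {0}" using root[of c] c by (auto simp: restricted_root_def)
    moreover have "0 \<in> root_space \<aa> (\<lambda>H. c * \<alpha> H)"
      by (auto simp: root_space_def su_def bracket_def trace_def herm_form_simps)
    ultimately obtain X where X: "X \<in> root_space \<aa> (\<lambda>H. c * \<alpha> H)" "X \<noteq> 0" by blast
    then have "bracket (pmat u) X = c *\<^sub>R X" using A by (simp add: root_space_def)
    moreover have "c > 0" using c by auto
    ultimately show ?thesis using root_value X(2) \<open>u \<noteq> 0\<close> by blast
  qed
  \<comment> \<open>The values 1 and 2 of the two roots both lie in {|u|, 2|u|}, which leaves |u| =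
    1.\<close>
  have "norm u = 1" using val[of 1] val[of 2] by auto
  then show ?thesis using that range A(2) by blast
qed

section \<open>The Killing form\<close>

text \<open>\<open>trace_on\<close> refers to an unspecified basis of V. Precomposing f with the
  projection P leaves the trace unchanged and lets it be computed in the standard basis: expand
  \<open>f (P b)\<close> in the chosen basis and exchange the two sums.\<close>

lemma trace_on_projection:
  fixes V :: "'a::euclidean_space set"
  assumes V: "subspace V" and f: "linear f" "\<And>x. x \<in> V \<Longrightarrow> f x \<in> V"
    and P: "linear P" "\<And>x. P x \<in> V" "\<And>x. x \<in> V \<Longrightarrow> P x = x"
  shows "trace_on V f = (\<Sum>b\<in>Basis. f (P b) \<bullet> b)"
proof -
  define B where "B = (SOME B. independent B \<and> span B = V)"
  have "\<exists>B. independent B \<and> span B = V"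
    using basis_exists[of V] V by (metis span_minimal subset_antisym)
  then have B: "independent B" "span B = V"
    unfolding B_def using someI_ex[of "\<lambda>B. independent B \<and> span B = V"] by blast+
  have fin: "finite B" using B(1) by (rule finiteI_independent)
  have rep: "x = (\<Sum>\<beta>\<in>B. representation B x \<beta> *\<^sub>R \<beta>)" if "x \<in> V" for x
    using sum_representation_eq[OF B(1) _ fin, of x] that B(2) by simp
  have fP: "f (P x) \<in> V" for x using f(2) P(2) by blast
  have "(\<Sum>b\<in>Basis. f (P b) \<bullet> b) = (\<Sum>b\<in>Basis. \<Sum>\<beta>\<in>B. representation B (f (P b)) \<beta> * (\<beta> \<bullet> b))"
    by (intro sum.cong refl, subst rep[OF fP]) (simp add: inner_sum_left)
  also have "\<dots> = (\<Sum>\<beta>\<in>B. \<Sum>b\<in>Basis. (\<beta> \<bullet> b) * representation B (f (P b)) \<beta>)"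
    by (subst sum.swap) (simp add: mult.commute)
  also have "\<dots> = (\<Sum>\<beta>\<in>B. representation B (f \<beta>) \<beta>)"
  proof (rule sum.cong[OF refl])
    fix \<beta> assume "\<beta> \<in> B"
    then have "\<beta> \<in> V" using B(2) span_base by blast
    have "(\<Sum>b\<in>Basis. (\<beta> \<bullet> b) * representation B (f (P b)) \<beta>)
        = (\<Sum>b\<in>Basis. representation B ((\<beta> \<bullet> b) *\<^sub>R f (P b)) \<beta>)"
      using fP B by (simp add: representation_scale)
    also have "\<dots> = representation B (\<Sum>b\<in>Basis. (\<beta> \<bullet> b) *\<^sub>R f (P b)) \<beta>"
      using fP B V by (subst representation_sum) (auto intro: subspace_scale)
    also have "(\<Sum>b\<in>Basis. (\<beta> \<bullet> b) *\<^sub>R f (P b)) = f (P (\<Sum>b\<in>Basis. (\<beta> \<bullet> b) *\<^sub>R b))"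
      by (simp add: linear_sum[OF f(1)] linear_sum[OF P(1)] linear_cmul[OF f(1)] linear_cmul[OF P(1)])
    also have "\<dots> = f \<beta>" using P(3)[OF \<open>\<beta> \<in> V\<close>] by (simp add: euclidean_representation)
    finally show "(\<Sum>b\<in>Basis. (\<beta> \<bullet> b) * representation B (f (P b)) \<beta>) = representation B (f \<beta>) \<beta>" .
  qed
  finally show ?thesis unfolding trace_on_def B_def[symmetric] Let_def by simp
qed

lemma sum_Basis_vec: "(\<Sum>b\<in>Basis. g b) = (\<Sum>i\<in>UNIV. \<Sum>u\<in>Basis. g (axis i u))"
  for g :: "'a::euclidean_space^'m \<Rightarrow> real"
proof -
  have eq: "Basis = (\<lambda>(i, u). axis i u :: 'a^'m) ` (UNIV \<times> Basis)"
    by (auto simp: Basis_vec_def)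
  have inj: "inj_on (\<lambda>(i, u). axis i u :: 'a^'m) (UNIV \<times> Basis)"
    by (auto simp: inj_on_def axis_eq_axis)
  show ?thesis
    unfolding eq sum.reindex[OF inj] sum.cartesian_product by (simp add: case_prod_unfold)
qed

text \<open>The adjoint for \<open>herm_form\<close>; the elements of \<open>su\<close> are
  traceless and satisfy \<open>herm_adj Z = - Z\<close>.\<close>

definition herm_adj :: "complex^('n::finite option)^('n option) \<Rightarrow> complex^('n option)^('n option)" where
  "herm_adj Z = (\<chi> i j. herm_sign i * herm_sign j * cnj (Z $ j $ i))"

lemma herm_adj: "herm_form (herm_adj Z *v x) y = herm_form x (Z *v y)"
proof -
  have "herm_form (herm_adj Z *v x) y
      = (\<Sum>i\<in>UNIV. \<Sum>j\<in>UNIV. herm_sign j * (cnj (Z $ j $ i) * x $ j * cnj (y $ i)))"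
    by (simp add: herm_form_sum herm_adj_def matrix_vector_mult_def sum_distrib_left sum_distrib_right
        mult.assoc[symmetric])
  also have "\<dots> = (\<Sum>j\<in>UNIV. \<Sum>i\<in>UNIV. herm_sign j * (cnj (Z $ j $ i) * x $ j * cnj (y $ i)))"
    by (rule sum.swap)
  also have "\<dots> = herm_form x (Z *v y)"
    by (simp add: herm_form_sum matrix_vector_mult_def sum_distrib_left mult_ac)
  finally show ?thesis .
qed

lemma herm_adj': "herm_form (Z *v x) y = herm_form x (herm_adj Z *v y)"
  using arg_cong[OF herm_adj[of Z y x], of cnj] by (simp add: cnj_herm_form)

lemma subspace_su: "subspace (su :: (complex^('n::finite option)^('n option)) set)"
  unfolding subspace_def
proof (intro conjI ballI allI)
  show "0 \<in> (su :: (complex^('n option)^('n option)) set)" by (rule suI) (simp_all add: trace_def herm_form_simps)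
  show "X + Y \<in> su" if "X \<in> su" "Y \<in> su" for X Y :: "complex^('n option)^('n option)"
    using that by (intro suI)
      (simp_all add: su_skew matrix_vector_mult_add_rdistrib herm_form_simps trace_add, simp add: su_def)
  show "c *\<^sub>R X \<in> su" if "X \<in> su" for c and X :: "complex^('n option)^('n option)"
  proof (rule suI)
    have "trace X = 0" using that by (simp add: su_def)
    then show "trace (c *\<^sub>R X) = 0" unfolding trace_def by (simp flip: scaleR_sum_right)
    show "herm_form ((c *\<^sub>R X) *v x) y + herm_form x ((c *\<^sub>R X) *v y) = 0" for x y
      using su_skew[OF that, of x y]
      by (simp add: matrix_scaleR_vec herm_form_simps smult_of_real[symmetric])
  qed
qed

lemma bracket_su: "X \<in> su \<Longrightarrow> Y \<in> su \<Longrightarrow> bracket X Y \<in> su"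
proof (rule suI)
  show "trace (bracket X Y) = 0"
    by (simp add: bracket_def trace_sub trace_mul_sym[of X Y])
  show "herm_form (bracket X Y *v x) y + herm_form x (bracket X Y *v y) = 0"
    if "X \<in> su" "Y \<in> su" for x y
    using that by (simp add: bracket_vec herm_form_simps su_skew)
qed

lemma trace_linear: "linear (trace :: complex^'m^'m \<Rightarrow> complex)"
  by (rule linearI) (simp_all add: trace_def sum.distrib scaleR_sum_right)

lemma matrix_mult_linear_right: "linear (\<lambda>Z :: complex^'m^'m. A ** Z)"
  and matrix_mult_linear_left: "linear (\<lambda>Z :: complex^'m^'m. Z ** A)"
  for A :: "complex^'m^'m"
  using bounded_bilinear_matrix_mult[where 'm = 'm]
  by (auto simp: bilinear_conv_bounded_bilinear[symmetric] bilinear_def)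

text \<open>The trace over \<open>su\<close> is taken over all complex matrices, precomposed with a
  real projection onto \<open>su\<close>. The conjugate-linear half of the projection contributes
  nothing, and the rest is the trace of ad X ad Y on all matrices, evaluated on matrix
  units.\<close>

lemma killing_form_eq:
  fixes X Y :: "complex^('n::finite option)^('n option)"
  assumes X: "X \<in> su" and Y: "Y \<in> su"
  shows "killing_form X Y = 2 * real CARD('n option) * Re (trace (X ** Y))"
proof -
  define m where "m = real CARD('n option)"
  have m: "m \<noteq> 0" by (simp add: m_def)
  define f where "f Z = bracket X (bracket Y Z)" for Z
  have f_eq: "f Z = (X ** Y) ** Z - X ** Z ** Y - Y ** Z ** X + Z ** (Y ** X)" for Z
    by (rule matrix_eq[THEN iffD2])
      (simp add: f_def bracket_vec matrix_vector_mult_diff_rdistrib matrix_vector_mult_add_rdistrib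
        matrix_vector_mult_diff_distrib algebra_simps flip: matrix_vector_mul_assoc)
  have lin_f: "linear f"
    unfolding f_def bracket_def
    by (intro linear_compose_sub linear_compose[OF _ matrix_mult_linear_right, unfolded comp_def]
        linear_compose[OF _ matrix_mult_linear_left, unfolded comp_def]
        matrix_mult_linear_right matrix_mult_linear_left)
  define T where "T Z = (1 / 2) *\<^sub>R (Z - herm_adj Z)" for Z :: "complex^('n option)^('n option)"
  define s where "s Z = (\<i> * of_real (Im (trace Z) / m))" for Z :: "complex^('n option)^('n option)"
  \<comment> \<open>T takes the part that is skew for the form, and subtracting a scalar matrix
    makes it traceless. Scalars are central, so f does not see this correction.\<close>
  define P where "P Z = T Z - mat (s Z)" for Z
  have lin_P: "linear P"
    by (rule linearI)
      (simp_all add: P_def T_def s_def herm_adj_def vec_eq_iff mat_def linear_add[OF trace_linear]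
        linear_cmul[OF trace_linear] algebra_simps add_divide_distrib scaleR_conv_of_real[where 'a = complex])
  have mat_vec: "mat k *v x = k *s x" for k and x :: "complex^('n option)"
    by (simp add: mat_def matrix_vector_mult_def vec_eq_iff if_distrib[of "\<lambda>c. c * _"] cong: if_cong)
  have trace_T: "trace (T Z) = \<i> * of_real (Im (trace Z))" for Z
  proof -
    have "trace (herm_adj Z) = cnj (trace Z)" by (simp add: trace_def herm_adj_def)
    then show ?thesis
      by (simp add: T_def linear_cmul[OF trace_linear] trace_sub complex_eq_iff)
  qed
  have trace_mat: "trace (mat k :: complex^('n option)^('n option)) = of_real m * k" for k
    by (simp add: trace_def mat_def m_def)
  have P_su: "P Z \<in> su" for Z
  proof (rule suI)
    show "trace (P Z) = 0" by (simp add: P_def trace_sub trace_T trace_mat s_def m)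
    show "herm_form (P Z *v x) y + herm_form x (P Z *v y) = 0" for x y
      by (simp add: P_def T_def s_def matrix_vector_mult_diff_rdistrib matrix_scaleR_vec mat_vec
          herm_form_simps herm_adj herm_adj'[symmetric] smult_of_real[symmetric] algebra_simps)
  qed
  have P_id: "P Z = Z" if Z: "Z \<in> su" for Z
  proof -
    have "herm_adj Z = - Z"
    proof -
      have "(- Z) *v x = - (Z *v x)" for x
        by (simp add: matrix_vector_mult_def vec_eq_iff sum_negf)
      then have "herm_form (herm_adj Z *v x) y = herm_form ((- Z) *v x) y" for x y
        using su_skew[OF Z, of x y] herm_form_diff_left[of 0 "Z *v x" y]
        by (simp add: herm_adj herm_form_simps)
      then have *: "herm_form (herm_adj Z *v x - (- Z) *v x) y = 0" for x y
        by (simp add: herm_form_simps)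
      have "v = 0" if v: "\<And>y. herm_form v y = 0" for v :: "complex^('n option)"
      proof -
        obtain c z where cz: "v = hc c z" by (rule hc_cases)
        show ?thesis using v[of "hc (- c) z"] v[of "hc 0 z"]
          by (simp add: cz herm_form_hc cinner_self hc_0)
      qed
      then have "herm_adj Z *v x - (- Z) *v x = 0" for x using * by blast
      then show ?thesis by (simp add: matrix_eq)
    qed
    moreover have "trace Z = 0" using Z by (simp add: su_def)
    ultimately show ?thesis by (simp add: P_def T_def s_def mat_def vec_eq_iff)
  qed
  have f_su: "f Z \<in> su" if "Z \<in> su" for Z using that X Y by (simp add: f_def bracket_su)
  have f_mat: "f (mat k) = 0" for k
    by (rule matrix_eq[THEN iffD2]) (simp add: f_def bracket_vec mat_vec matrix_vector_smult)
  have fP: "f (P Z) = (1 / 2) *\<^sub>R (f Z - f (herm_adj Z))" for Z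
    by (simp add: P_def T_def linear_diff[OF lin_f] linear_cmul[OF lin_f] f_mat)
  define E where "E i j = (axis i (axis j 1) :: complex^('n option)^('n option))" for i j
  define F where "F i j k l = f (E i j) $ k $ l" for i j k l
  have E_nth: "E i j $ k $ l = (if k = i \<and> l = j then 1 else 0)" for i j k l
    by (simp add: E_def axis_def)
  have f_smult: "f (\<chi> k l. c * Z $ k $ l) = (\<chi> k l. c * f Z $ k $ l)" for c Z
    unfolding f_eq by (simp add: vec_eq_iff matrix_matrix_mult_def sum_distrib_left algebra_simps)
  have ax: "axis i (axis j c) = (\<chi> k l. c * E i j $ k $ l)" for i j and c :: complex
    by (simp add: vec_eq_iff E_nth) (simp add: axis_def)
  have adj: "herm_adj (axis i (axis j c)) = (\<chi> k l. (herm_sign i * herm_sign j * cnj c) * E j i $ k $ l)"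
    for i j :: "'n option" and c
    by (simp add: vec_eq_iff E_nth herm_adj_def) (simp add: axis_def)
  have summand: "f (P (axis i (axis j c))) \<bullet> axis i (axis j c)
      = (1 / 2) * ((c * F i j i j) \<bullet> c - (herm_sign i * herm_sign j * cnj c * F j i i j) \<bullet> c)" for i j c
  proof -
    have "f (P (axis i (axis j c))) \<bullet> axis i (axis j c) = f (P (axis i (axis j c))) $ i $ j \<bullet> c"
      by (simp only: inner_axis)
    also have "f (P (axis i (axis j c))) $ i $ j
        = (1 / 2) *\<^sub>R (c * F i j i j - herm_sign i * herm_sign j * cnj c * F j i i j)"
      unfolding fP adj unfolding ax f_smult by (simp add: F_def)
    finally show ?thesis by (simp only: inner_scaleR_left inner_diff_left)
  qed
  have "killing_form X Y = (\<Sum>b\<in>Basis. f (P b) \<bullet> b)"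
    unfolding killing_form_def f_def[symmetric]
    by (rule trace_on_projection[OF subspace_su lin_f f_su lin_P P_su P_id])
  also have "\<dots> = (\<Sum>i\<in>UNIV. \<Sum>j\<in>UNIV. Re (F i j i j))"
    unfolding sum_Basis_vec summand
  proof (intro sum.cong refl)
    fix i j :: "'n option"
    \<comment> \<open>The real basis of the complex numbers is 1 and \<i>: the terms with
      \<open>cnj c\<close> have opposite signs for the two and cancel, while the others add
      up.\<close>
    have "Im (herm_sign i * herm_sign j) = 0" by (simp add: herm_sign_def)
    then show "(\<Sum>c\<in>Basis. 1 / 2 * ((c * F i j i j) \<bullet> c - (herm_sign i * herm_sign j * cnj c * F j i i j) \<bullet> c))
        = Re (F i j i j)"
      by (simp add: Basis_complex_def inner_complex_def algebra_simps)
  qed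
  also have "\<dots> = Re (\<Sum>i\<in>UNIV. \<Sum>j\<in>UNIV. F i j i j)" by simp
  also have "(\<Sum>i\<in>UNIV. \<Sum>j\<in>UNIV. F i j i j)
      = (\<Sum>i\<in>UNIV. \<Sum>j\<in>UNIV. (X ** Y) $ i $ i - X $ i $ i * Y $ j $ j - Y $ i $ i * X $ j $ j + (Y ** X) $ j $ j)"
  proof (intro sum.cong refl)
    fix i j :: "'n option"
    have l: "(A ** E i j) $ k $ l = (if l = j then A $ k $ i else 0)" for A k l
      by (simp add: matrix_matrix_mult_def E_nth if_distrib cong: if_cong)
    have r: "(E i j ** A) $ k $ l = (if k = i then A $ j $ l else 0)" for A k l
      by (simp add: matrix_matrix_mult_def E_nth if_distrib[of "\<lambda>c. c * _"] cong: if_cong)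
    have lr: "(A ** E i j ** B) $ k $ l = A $ k $ i * B $ j $ l" for A B k l
      by (subst matrix_matrix_mult_def) (simp add: l if_distrib[of "\<lambda>c. c * _"] cong: if_cong)
    show "F i j i j = (X ** Y) $ i $ i - X $ i $ i * Y $ j $ j - Y $ i $ i * X $ j $ j + (Y ** X) $ j $ j"
      by (simp add: F_def f_eq l r lr)
  qed
  also have "\<dots> = of_real m * trace (X ** Y) - trace X * trace Y - trace Y * trace X + of_real m * trace (Y ** X)"
    by (simp add: sum.distrib sum_subtractf trace_def m_def flip: sum_distrib_left sum_distrib_right)
  also have "\<dots> = of_real (2 * m) * trace (X ** Y)"
    using X Y trace_mul_sym[of X Y] by (simp add: su_def)
  finally show ?thesis by (simp add: m_def)
qed

section \<open>Root spaces\<close>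

text \<open>The root space \<open>\<gg>\<^sub>\<alpha>\<close> consists of the \<open>zmat u b\<close> with \<open>b \<bottom> u\<close>, where \<open>zmat u b\<close> maps \<open>(1, -u)\<close> to
  \<open>(0, b)\<close> and kills \<open>(1, u)\<close>; \<open>qmat u\<close> spans \<open>\<gg>\<^sub>2\<^sub>\<alpha>\<close>.\<close>

definition zmat :: "complex^'n::finite \<Rightarrow> complex^'n \<Rightarrow> complex^('n option)^('n option)" where
  "zmat u b = (1 / 2) *\<^sub>R (rank1 (hc 1 u) (hc 0 b) - rank1 (hc 0 b) (hc 1 u))"

definition qmat :: "complex^'n::finite \<Rightarrow> complex^('n option)^('n option)" where
  "qmat u = rank1 (\<i> *s hc 1 u) (hc 1 u)"

lemma zmat_vec:
  "zmat u b *v hc c w = hc (cinner w b / 2) ((cinner w b / 2) *s u + ((c - cinner w u) / 2) *s b)"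
  by (simp add: zmat_def matrix_scaleR_vec matrix_vector_mult_diff_rdistrib rank1_vec herm_form_hc
      hc_smult hc_diff hc_scaleR scaleR_conv_of_real[where 'a = complex])
    (simp add: vec_eq_iff scaleR_conv_of_real[where 'a = complex] field_simps)

lemma qmat_vec: "qmat u *v y = (\<i> * herm_form y (hc 1 u)) *s hc 1 u"
  by (simp add: qmat_def rank1_vec vector_smult_assoc mult.commute)

lemma zmat_su:
  assumes "cinner b u = 0"
  shows "zmat u b \<in> su"
proof -
  have "cinner u b = 0" using assms cnj_cinner[of b u] by simp
  then have "Im (herm_form (hc 1 u) (hc 0 b)) = 0" by (simp add: herm_form_hc)
  then show ?thesis
    unfolding zmat_def by (intro subspace_scale[OF subspace_su] rank1_diff_su)
qed

lemma zmat_bracket: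
  assumes "norm u = 1" "cinner b u = 0"
  shows "bracket (pmat u) (zmat u b) = zmat u b"
proof (rule hc_matrix_eqI)
  have uu: "cinner u u = 1" using assms(1) by (simp add: cinner_self)
  have ub: "cinner u b = 0" using assms(2) cnj_cinner[of b u] by simp
  show "bracket (pmat u) (zmat u b) *v hc c w = zmat u b *v hc c w" for c w
    by (simp add: bracket_vec pmat_vec zmat_vec hc_diff cinner_simps uu ub assms(2))
      (simp add: vec_eq_iff field_simps)
qed

lemma qmat_su:
  assumes "norm u = 1"
  shows "qmat u \<in> su"
proof (rule suI)
  have "herm_form (hc 1 u) (hc 1 u) = 0" using assms by (simp add: herm_form_hc cinner_self)
  then show "trace (qmat u) = 0" by (simp add: qmat_def trace_rank1 herm_form_simps)
  show "herm_form (qmat u *v x) y + herm_form x (qmat u *v y) = 0" for x y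
    by (simp add: qmat_vec herm_form_simps cnj_herm_form)
qed

lemma pmat_su: "pmat u \<in> su"
  unfolding pmat_def by (rule rank1_diff_su) (simp add: herm_form_hc cinner_simps)

lemma qmat_bracket:
  assumes "norm u = 1"
  shows "bracket (pmat u) (qmat u) = 2 *\<^sub>R qmat u"
proof (rule matrix_eq[THEN iffD2, rule_format])
  fix y
  have p: "pmat u *v hc 1 u = hc 1 u" using assms by (simp add: pmat_vec cinner_self)
  then have "herm_form (pmat u *v y) (hc 1 u) = - herm_form y (hc 1 u)"
    using su_skew[OF pmat_su, of u y "hc 1 u"] by simp
  then have "bracket (pmat u) (qmat u) *v y = (2 * (\<i> * herm_form y (hc 1 u))) *s hc 1 u"
    by (simp add: bracket_vec qmat_vec matrix_vector_smult p) (simp add: vec_eq_iff)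
  also have "\<dots> = (2 *\<^sub>R qmat u) *v y"
    by (simp add: matrix_scaleR_vec qmat_vec smult_of_real[symmetric] vector_smult_assoc)
  finally show "bracket (pmat u) (qmat u) *v y = (2 *\<^sub>R qmat u) *v y" .
qed

lemma root_shift:
  assumes "bracket (pmat u) X = of_real \<mu> *\<^sub>R X" "pmat u *v y = of_real \<nu> *s y"
  shows "pmat u *v (X *v y) = of_real (\<nu> + \<mu>) *s (X *v y)"
proof -
  have "pmat u *v (X *v y) = X *v (pmat u *v y) + \<mu> *\<^sub>R (X *v y)"
    using arg_cong[OF assms(1), of "\<lambda>A. A *v y"] by (simp add: bracket_vec matrix_scaleR_vec algebra_simps)
  then show ?thesis
    unfolding assms(2) smult_of_real matrix_scaleR_vec by (simp add: scaleR_add_left)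
qed

lemma hc_horo_decomp:
  "hc c w = ((c + cinner w u) / 2) *s hc 1 u + ((c - cinner w u) / 2) *s hc 1 (- u)
      + hc 0 (w - cinner w u *s u)"
  by (simp add: hc_smult hc_add) (simp add: vec_eq_iff field_simps)

text \<open>The null vector (1, u) has the top eigenvalue 1, and 1 + \<mu> exceeds every eigenvalue
  of \<open>pmat u\<close>.\<close>

lemma root_kills_fplus:
  assumes "norm u = 1" "bracket (pmat u) X = \<mu> *\<^sub>R X" "\<mu> > 0"
  shows "X *v hc 1 u = 0"
proof (rule ccontr)
  assume "X *v hc 1 u \<noteq> 0"
  moreover have "pmat u *v (X *v hc 1 u) = of_real (1 + \<mu>) *s (X *v hc 1 u)"
    using assms by (intro root_shift) (simp_all add: pmat_vec cinner_self)
  ultimately show False using pmat_eigenvalue[of u "X *v hc 1 u" "1 + \<mu>"] assms(1,3) by simp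
qed

text \<open>X raises the grading by \<open>pmat u\<close> one step: (1, -u) goes to some (0, b),
  vectors orthogonal to u go to multiples of (1, u), and (1, u) goes to 0. Skewness expresses the
  second map through b.\<close>

lemma root_alpha_cases:
  assumes u: "norm u = 1" and X: "X \<in> su" "bracket (pmat u) X = X"
  obtains b where "cinner b u = 0" "X = zmat u b"
proof -
  have uu: "cinner u u = 1" using u by (simp add: cinner_self)
  have br: "bracket (pmat u) X = of_real 1 *\<^sub>R X" using X(2) by simp
  have p: "X *v hc 1 u = 0" using root_kills_fplus[OF u, of X 1] X(2) by simp
  obtain a b where ab: "X *v hc 1 (- u) = hc a b" by (rule hc_cases)
  have "pmat u *v (X *v hc 1 (- u)) = of_real (- 1 + 1) *s (X *v hc 1 (- u))"
    by (rule root_shift[OF br]) (simp add: pmat_vec cinner_simps uu hc_smult vec_eq_iff)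
  then have "hc (cinner b u) (a *s u) = hc 0 0"
    by (simp add: ab pmat_vec hc_smult)
  then have bu: "cinner b u = 0" and "a *s u = 0" by simp_all
  then have "cinner (a *s u) u = 0" by (simp only: cinner_0_left)
  then have a: "a = 0" by (simp add: cinner_smult_left uu)
  have ub: "cinner u b = 0" using bu cnj_cinner[of b u] by simp
  have o: "X *v hc 0 w = (cinner w b / 2) *s hc 1 u" if w: "cinner w u = 0" for w
  proof -
    obtain d z where dz: "X *v hc 0 w = hc d z" by (rule hc_cases)
    have "pmat u *v (X *v hc 0 w) = of_real (0 + 1) *s (X *v hc 0 w)"
      by (rule root_shift[OF br]) (simp add: pmat_vec w hc_smult hc_0)
    then have z: "z = d *s u" by (simp add: dz pmat_vec)
    have "herm_form (X *v hc 0 w) (hc 1 (- u)) = - herm_form (hc 0 w) (X *v hc 1 (- u))"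
      by (rule su_skew[OF X(1)])
    then have "d = cinner w b / 2"
      by (simp add: dz ab a z herm_form_hc cinner_simps uu mult.commute)
    then show ?thesis by (simp add: dz z hc_smult)
  qed
  have "X = zmat u b"
  proof (rule hc_matrix_eqI)
    fix c w
    have "cinner (w - cinner w u *s u) u = 0" by (simp add: cinner_simps uu)
    then have "X *v hc c w = ((c - cinner w u) / 2) *s hc 0 b
        + (cinner (w - cinner w u *s u) b / 2) *s hc 1 u"
      by (subst hc_horo_decomp[of c w u])
        (simp add: matrix_vector_right_distrib matrix_vector_smult p ab a o)
    then show "X *v hc c w = zmat u b *v hc c w"
      by (simp add: zmat_vec hc_smult hc_add cinner_simps ub add.commute)
  qed
  then show ?thesis using bu by (intro that)
qed

lemma trace_rank1_mult: "trace (rank1 p q ** B) = herm_form (B *v p) q"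
proof -
  have "trace (rank1 p q ** B) = (\<Sum>i\<in>UNIV. \<Sum>k\<in>UNIV. herm_sign k * (B $ k $ i * p $ i * cnj (q $ k)))"
    by (simp add: trace_def matrix_matrix_mult_def rank1_def mult_ac)
  also have "\<dots> = (\<Sum>k\<in>UNIV. \<Sum>i\<in>UNIV. herm_sign k * (B $ k $ i * p $ i * cnj (q $ k)))"
    by (rule sum.swap)
  also have "\<dots> = herm_form (B *v p) q"
    by (simp add: herm_form_sum matrix_vector_mult_def sum_distrib_left sum_distrib_right)
  finally show ?thesis .
qed

lemma cartan_inv_rank1:
  "cartan_inv (rank1 (hc c z) (hc d w)) = - rank1 (hc (- d) w) (hc (- c) z)"
proof -
  have "cartan_inv (rank1 (hc c z) (hc d w)) $ i $ j = (- rank1 (hc (- d) w) (hc (- c) z)) $ i $ j" for i j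
    by (cases i; cases j) (simp_all add: cartan_inv_def rank1_def map_matrix_def transpose_def)
  then show ?thesis by (simp add: vec_eq_iff)
qed

text \<open>Up to sign \<theta> replaces u by -u; for b orthogonal to u this exchanges the root
  spaces of \<alpha> and -\<alpha>.\<close>

lemma cartan_inv_zmat:
  "cartan_inv (zmat u b) = (1 / 2) *\<^sub>R (rank1 (hc 0 b) (hc 1 (- u)) - rank1 (hc 1 (- u)) (hc 0 b))"
proof -
  have "cartan_inv (r *\<^sub>R (A - B)) = r *\<^sub>R (cartan_inv A - cartan_inv B)"
    for r and A B :: "complex^('a option)^('a option)"
    by (simp add: cartan_inv_def vec_eq_iff map_matrix_def transpose_def algebra_simps)
  moreover have "hc (- 1) u = - hc 1 (- u)" for u :: "complex^'a"
    by (simp add: vec_option_eq_iff)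
  moreover have "rank1 (- p) q = - rank1 p q" "rank1 p (- q) = - rank1 p q"
    for p q :: "complex^('a option)"
    by (simp_all add: rank1_def vec_eq_iff)
  ultimately show ?thesis
    unfolding zmat_def by (simp add: cartan_inv_rank1)
qed

text \<open>The parts along u cancel, leaving the element of \<pp> with tangent vector b. This is
  how J becomes multiplication by \<i> on b.\<close>

lemma zmat_minus_cartan_inv: "zmat u b - cartan_inv (zmat u b) = pmat b"
proof (rule hc_matrix_eqI)
  show "(zmat u b - cartan_inv (zmat u b)) *v hc c w = pmat b *v hc c w" for c w
    unfolding cartan_inv_zmat matrix_vector_mult_diff_rdistrib zmat_vec matrix_scaleR_vec rank1_vec pmat_vec
    by (simp add: herm_form_hc hc_smult hc_diff hc_scaleR cinner_simps scaleR_conv_of_real[where 'a = complex])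
      (simp add: vec_eq_iff scaleR_conv_of_real[where 'a = complex] field_simps)
qed

text \<open>Being a positive multiple of the Euclidean product of the parameters, \<open>ip\<close>
  turns complements in the root space into complements in the space orthogonal to u.\<close>

lemma ip_zmat:
  fixes b b' u :: "complex^'n::finite"
  assumes u: "norm u = 1" and b: "cinner b u = 0" "cinner b' u = 0"
  shows "ip (zmat u b) (zmat u b') = 2 * real CARD('n option) * (b \<bullet> b')"
proof -
  have uu: "cinner u u = 1" using u by (simp add: cinner_self)
  have ub: "cinner u b = 0" "cinner u b' = 0" using b cnj_cinner[of _ u] by (metis complex_cnj_zero)+
  let ?R = "rank1 (hc 0 b) (hc 1 (- u)) - rank1 (hc 1 (- u)) (hc 0 b)"
  have "cartan_inv (zmat u b) \<in> su"
    unfolding cartan_inv_zmat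
    by (intro subspace_scale[OF subspace_su] rank1_diff_su) (simp add: herm_form_hc cinner_simps b)
  then have "killing_form (cartan_inv (zmat u b)) (zmat u b')
      = 2 * real CARD('n option) * Re (trace (cartan_inv (zmat u b) ** zmat u b'))"
    by (rule killing_form_eq[OF _ zmat_su[OF b(2)]])
  also have "trace (cartan_inv (zmat u b) ** zmat u b')
      = (1 / 2) *\<^sub>R (trace (rank1 (hc 0 b) (hc 1 (- u)) ** zmat u b') - trace (rank1 (hc 1 (- u)) (hc 0 b) ** zmat u b'))"
    unfolding cartan_inv_zmat
    by (simp only: linear_cmul[OF matrix_mult_linear_left] linear_diff[OF matrix_mult_linear_left]
        linear_cmul[OF trace_linear] trace_sub)
  also have "\<dots> = - (1 / 2) *\<^sub>R (cinner b b' + cinner b' b)"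
    by (simp add: trace_rank1_mult zmat_vec herm_form_hc cinner_simps uu ub b
        scaleR_conv_of_real[where 'a = complex] field_simps)
  finally show ?thesis
    by (simp add: ip_def Re_cinner inner_commute[of b' b])
qed

lemma mexp_0_vec: "mexp (0 *\<^sub>R X) *v y = y"
proof -
  have "(mexp (0 *\<^sub>R X) *v y) $ i = y $ i" for i
    using mexp_eigenfunctional[of "\<lambda>v. v $ i" "0 *\<^sub>R X" 0 y] by (simp add: linear_iff)
  then show ?thesis by (simp add: vec_eq_iff)
qed

text \<open>At t = 0 the time coordinate of the lifted curve is 1 with derivative 0, so dividing by
  it does not change the velocity.\<close>

lemma p_to_tangent_pmat:
  fixes b :: "complex^'n::finite"
  shows "p_to_tangent (pmat b) = b"
proof -
  let ?y = "\<lambda>t. mexp (t *\<^sub>R pmat b) *v hc 1 0"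
  have y: "(?y has_vector_derivative hc 0 b) (at 0)"
    using mexp_has_vector_derivative[of "pmat b" "hc 1 0"] by (simp add: pmat_vec cinner_simps)
  have lin: "linear (\<lambda>x :: complex^('n option). \<chi> j. x $ Some j)"
    by (auto intro!: linearI simp: vec_eq_iff)
  have N: "((\<lambda>t. ?y t $ None) has_vector_derivative 0) (at 0)"
    using bounded_linear.has_vector_derivative[OF bounded_linear_vec_nth y, of None] by simp
  have "((\<lambda>t. \<chi> j. ?y t $ Some j) has_vector_derivative (\<chi> j. hc 0 b $ Some j)) (at 0)"
    using bounded_linear.has_vector_derivative[OF lin[unfolded linear_conv_bounded_linear] y] .
  then have S: "((\<lambda>t. \<chi> j. ?y t $ Some j) has_vector_derivative b) (at 0)"
    by simp
  have I: "((\<lambda>t. inverse (?y t $ None)) has_vector_derivative 0) (at 0)"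
    using Deriv.has_derivative_inverse[OF _ N[unfolded has_vector_derivative_def]]
    by (simp add: has_vector_derivative_def mexp_0_vec[simplified])
  have "((\<lambda>t. inverse (?y t $ None) *s (\<chi> j. ?y t $ Some j)) has_vector_derivative b) (at 0)"
    using bounded_bilinear.has_vector_derivative[OF bounded_bilinear_smult I S]
    by (simp add: mexp_0_vec[simplified])
  then show ?thesis
    unfolding p_to_tangent_def by (simp add: CH_act_altdef vector_derivative_at)
qed

section \<open>Orbits\<close>

text \<open>Here \<open>s\<close> is the \<open>\<aa>\<close>-part of an element of \<open>AN\<close>, and \<open>\<beta>\<close> the translation in the direction of \<open>w\<close>.\<close>

lemma horo_action:
  assumes u: "norm u = 1" and w: "cinner w u = 0" and M: "M \<in> SU" and z: "z \<in> CH"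
    and lm: "herm_form (M *v hc 1 z) (hc 1 u) = of_real (exp (- s)) * herm_form (hc 1 z) (hc 1 u)"
    and lw: "herm_form (M *v hc 1 z) (hc 0 w)
      = herm_form (hc 1 z) (hc 0 w) - \<beta> / 2 * herm_form (hc 1 z) (hc 1 u)"
  shows "cinner (horo_vec u (CH_act M z)) w = of_real (exp s) * (cinner (horo_vec u z) w + \<beta>)"
proof -
  obtain k where k: "k \<noteq> 0" "M *v hc 1 z = k *s hc 1 (CH_act M z)" "CH_act M z \<in> CH"
    using CH_act_lift[OF M z] by metis
  let ?z = "CH_act M z"
  have uw: "cinner u w = 0" using w cnj_cinner[of w u] by simp
  have nz: "1 - cinner z u \<noteq> 0" "1 - cinner ?z u \<noteq> 0"
    using one_minus_cinner_nz[OF u] z k(3) by blast+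
  define e where "e = complex_of_real (exp s)"
  have e: "complex_of_real (exp (- s)) = inverse e" "e \<noteq> 0"
    by (simp_all add: e_def exp_minus)
  have 1: "k * (1 - cinner ?z u) = inverse e * (1 - cinner z u)"
    using lm unfolding k(2) e by (simp add: herm_form_simps herm_form_hc algebra_simps)
  have "k * cinner ?z w = cinner z w - \<beta> / 2 * (cinner z u - 1)"
    using lw unfolding k(2) by (simp add: herm_form_simps herm_form_hc)
  then have 2: "k * cinner ?z w = cinner z w + \<beta> / 2 * (1 - cinner z u)"
    by (simp add: algebra_simps diff_divide_distrib)
  have h: "cinner (horo_vec u x) w = 2 * cinner x w / (1 - cinner x u)" for x
    using uw by (simp add: horo_vec_def cinner_simps)
  \<comment> \<open>The lift factor k is unknown, but numerator and denominator are pairings with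
    the same lift, so both may be multiplied by k.\<close>
  have "cinner (horo_vec u ?z) w = 2 * (k * cinner ?z w) / (k * (1 - cinner ?z u))"
    using k(1) by (simp add: h)
  also have "\<dots> = e * (2 * cinner z w / (1 - cinner z u) + \<beta>)"
    unfolding 1 2 using nz(1) e(2) by (simp add: field_simps)
  finally show ?thesis by (simp add: h e_def)
qed

text \<open>For any lift x the height is minus \<open>herm_form x x\<close> over the squared modulus
  of \<open>herm_form x (hc 1 u)\<close>. The numerator is invariant under \<open>SU\<close>, and
  the denominator is scaled by exp (- 2 s).\<close>

lemma horo_action_height:
  assumes u: "norm u = 1" and M: "M \<in> SU" and z: "z \<in> CH"
    and lm: "herm_form (M *v hc 1 z) (hc 1 u) = of_real (exp (- s)) * herm_form (hc 1 z) (hc 1 u)"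
  shows "horo_height u (CH_act M z) = (exp s)\<^sup>2 * horo_height u z"
proof -
  obtain k where k: "k \<noteq> 0" "M *v hc 1 z = k *s hc 1 (CH_act M z)" "CH_act M z \<in> CH"
    using CH_act_lift[OF M z] by metis
  let ?z = "CH_act M z"
  have "cmod (1 - cinner z u) \<noteq> 0" "cmod (1 - cinner ?z u) \<noteq> 0"
    using one_minus_cinner_nz[OF u] z k(3) by simp_all
  moreover have "k * (1 - cinner ?z u) = of_real (exp (- s)) * (1 - cinner z u)"
    using lm unfolding k(2) by (simp add: herm_form_simps herm_form_hc algebra_simps)
  then have "cmod k * cmod (1 - cinner ?z u) = exp (- s) * cmod (1 - cinner z u)"
    by (metis norm_mult norm_of_real abs_exp_cancel)
  then have "cmod (1 - cinner z u) = exp s * (cmod k * cmod (1 - cinner ?z u))"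
    by (simp add: exp_minus)
  moreover have "1 - (norm z)\<^sup>2 = (cmod k)\<^sup>2 * (1 - (norm ?z)\<^sup>2)"
  proof -
    have "of_real ((norm z)\<^sup>2 - 1) = k * cnj k * of_real ((norm ?z)\<^sup>2 - 1)"
      using SU_herm_form[OF M, of "hc 1 z" "hc 1 z"] unfolding k(2)
      by (simp only: herm_form_smult_left herm_form_smult_right herm_form_point mult_ac)
    then show ?thesis
      unfolding complex_norm_square[symmetric] of_real_mult[symmetric] of_real_eq_iff
      by (simp add: algebra_simps)
  qed
  ultimately show ?thesis
    using k(1) by (simp add: horo_height_def power_mult_distrib)
qed

text \<open>Neither 3 nor 2 is an eigenvalue of \<open>pmat u\<close>, so Q kills (1, u) and every
  (0, w) with w orthogonal to u; skewness moves Q onto these arguments.\<close>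

lemma root_2alpha_herm:
  assumes u: "norm u = 1" and Q: "Q \<in> su" "bracket (pmat u) Q = 2 *\<^sub>R Q"
  shows "herm_form (Q *v y) (hc 1 u) = 0" "cinner w u = 0 \<Longrightarrow> herm_form (Q *v y) (hc 0 w) = 0"
proof -
  have "Q *v hc 1 u = 0" by (rule root_kills_fplus[OF u Q(2)]) simp
  then show "herm_form (Q *v y) (hc 1 u) = 0"
    by (simp add: su_skew[OF Q(1)] herm_form_simps)
  show "herm_form (Q *v y) (hc 0 w) = 0" if w: "cinner w u = 0"
  proof -
    have "pmat u *v (Q *v hc 0 w) = of_real (0 + 2) *s (Q *v hc 0 w)"
      by (rule root_shift) (use Q(2) w in \<open>simp_all add: pmat_vec hc_smult hc_0\<close>)
    then have "Q *v hc 0 w = 0"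
      using pmat_eigenvalue[of u "Q *v hc 0 w" 2] u by auto
    then show ?thesis by (simp add: su_skew[OF Q(1)] herm_form_simps)
  qed
qed

text \<open>The triangular system for the two functionals, found by moving X to the second argument.
  It is the input for \<open>mexp_eigenfunctional\<close> and
  \<open>mexp_second_order_functional\<close>.\<close>

lemma an_herm:
  fixes s :: real
  assumes u: "norm u = 1" and b: "cinner b u = 0" and Q: "Q \<in> su" "bracket (pmat u) Q = 2 *\<^sub>R Q"
  defines "X \<equiv> s *\<^sub>R pmat u + zmat u b + Q"
  shows "herm_form (X *v y) (hc 1 u) = of_real (- s) * herm_form y (hc 1 u)"
    and "cinner w u = 0 \<Longrightarrow> herm_form (X *v y) (hc 0 w) = (- cinner b w / 2) * herm_form y (hc 1 u)"
proof -
  have uu: "cinner u u = 1" using u by (simp add: cinner_self)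
  have X: "herm_form (X *v y) v = of_real s * herm_form (pmat u *v y) v + herm_form (zmat u b *v y) v
      + herm_form (Q *v y) v" for v
    by (simp add: X_def matrix_vector_mult_add_rdistrib matrix_scaleR_vec herm_form_simps)
  have "pmat u *v hc 1 u = hc 1 u" "zmat u b *v hc 1 u = 0"
    using b cnj_cinner[of b u] by (simp_all add: pmat_vec zmat_vec uu hc_0)
  then show "herm_form (X *v y) (hc 1 u) = of_real (- s) * herm_form y (hc 1 u)"
    unfolding X by (simp add: root_2alpha_herm[OF u Q] su_skew[OF pmat_su] su_skew[OF zmat_su[OF b]] herm_form_simps)
  show "herm_form (X *v y) (hc 0 w) = (- cinner b w / 2) * herm_form y (hc 1 u)" if w: "cinner w u = 0"
  proof -
    have "pmat u *v hc 0 w = 0" "zmat u b *v hc 0 w = (cinner w b / 2) *s hc 1 u"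
      by (simp_all add: pmat_vec zmat_vec w hc_0 hc_smult)
    then show ?thesis
      unfolding X by (simp add: root_2alpha_herm[OF u Q] w su_skew[OF pmat_su] su_skew[OF zmat_su[OF b]]
          herm_form_simps cnj_cinner)
  qed
qed

lemma an_flow:
  fixes s :: real
  assumes u: "norm u = 1" and b: "cinner b u = 0" and Q: "Q \<in> su" "bracket (pmat u) Q = 2 *\<^sub>R Q"
  defines "X \<equiv> s *\<^sub>R pmat u + zmat u b + Q"
  assumes M: "mexp X \<in> SU" and z: "z \<in> CH"
  shows "horo_height u (CH_act (mexp X) z) = (exp s)\<^sup>2 * horo_height u z"
    and "cinner w u = 0 \<Longrightarrow> cinner (horo_vec u (CH_act (mexp X) z)) w
      = of_real (exp s) * (cinner (horo_vec u z) w + of_real (exp_quot (- s)) * cinner b w)"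
proof -
  note X = an_herm[OF u b Q, where s = s, folded X_def]
  have lm: "herm_form (mexp X *v hc 1 z) (hc 1 u) = of_real (exp (- s)) * herm_form (hc 1 z) (hc 1 u)"
    using mexp_eigenfunctional[OF linear_herm_form X(1), of "hc 1 z"] by (simp only: exp_of_real)
  show "horo_height u (CH_act (mexp X) z) = (exp s)\<^sup>2 * horo_height u z"
    by (rule horo_action_height[OF u M z lm])
  show "cinner (horo_vec u (CH_act (mexp X) z)) w
      = of_real (exp s) * (cinner (horo_vec u z) w + of_real (exp_quot (- s)) * cinner b w)"
    if w: "cinner w u = 0"
  proof (rule horo_action[OF u w M z lm])
    have "herm_form (mexp X *v hc 1 z) (hc 0 w) = herm_form (hc 1 z) (hc 0 w)
        + of_real (exp_quot (- s)) * ((- cinner b w / 2) * herm_form (hc 1 z) (hc 1 u))"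
      by (rule mexp_second_order_functional[OF linear_herm_form X(2)[OF w] X(1)])
    then show "herm_form (mexp X *v hc 1 z) (hc 0 w)
      = herm_form (hc 1 z) (hc 0 w) - of_real (exp_quot (- s)) * cinner b w / 2 * herm_form (hc 1 z) (hc 1 u)"
      by simp
  qed
qed

text \<open>The Cayley transform is the quotient of the pairings with (1, -u) and (1, u).
  \<open>qmat u\<close> annihilates the second functional and sends the first to -2 \<i> times the
  second, so its flow is a translation in the imaginary direction.\<close>

lemma qmat_flow:
  assumes u: "norm u = 1" and M: "mexp (t *\<^sub>R qmat u) \<in> SU" and z: "z \<in> CH"
  defines "z' \<equiv> CH_act (mexp (t *\<^sub>R qmat u)) z"
  shows "(1 + cinner z' u) / (1 - cinner z' u) = (1 + cinner z u) / (1 - cinner z u) - 2 * \<i> * of_real t"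
proof -
  let ?X = "t *\<^sub>R qmat u"
  have uu: "cinner u u = 1" using u by (simp add: cinner_self)
  obtain k where k: "k \<noteq> 0" "mexp ?X *v hc 1 z = k *s hc 1 z'" "z' \<in> CH"
    unfolding z'_def using CH_act_lift[OF M z] by metis
  have vec: "?X *v y = (of_real t * \<i> * herm_form y (hc 1 u)) *s hc 1 u" for y
    by (simp add: matrix_scaleR_vec qmat_vec smult_of_real[symmetric] vector_smult_assoc mult.assoc)
  have X: "herm_form (?X *v y) (hc 1 u) = of_real 0 * herm_form y (hc 1 u)"
    "herm_form (?X *v y) (hc 1 (- u)) = (- 2 * \<i> * of_real t) * herm_form y (hc 1 u)" for y
    unfolding vec herm_form_smult_left by (simp_all add: herm_form_hc cinner_simps uu)
  have 1: "herm_form (k *s hc 1 z') (hc 1 u) = herm_form (hc 1 z) (hc 1 u)"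
    using mexp_eigenfunctional[OF linear_herm_form X(1), of "hc 1 z"] unfolding k(2) by simp
  have 2: "herm_form (k *s hc 1 z') (hc 1 (- u)) = herm_form (hc 1 z) (hc 1 (- u))
      + (- 2 * \<i> * of_real t) * herm_form (hc 1 z) (hc 1 u)"
    using mexp_second_order_functional[OF linear_herm_form X(2) X(1), of "hc 1 z"] unfolding k(2)
    by (simp add: exp_quot_0)
  have nz: "1 - cinner z u \<noteq> 0" using one_minus_cinner_nz[OF u z] .
  have "k * (1 - cinner z' u) = 1 - cinner z u"
    using 1 by (simp add: herm_form_simps herm_form_hc algebra_simps)
  moreover have "k * (1 + cinner z' u) = (1 + cinner z u) - 2 * \<i> * of_real t * (1 - cinner z u)"
    using 2 by (simp add: herm_form_simps herm_form_hc cinner_simps algebra_simps)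
  moreover have "(1 + cinner z' u) / (1 - cinner z' u) = (k * (1 + cinner z' u)) / (k * (1 - cinner z' u))"
    using k(1) by simp
  ultimately show ?thesis using nz by (simp add: diff_divide_distrib)
qed

lemma cinner_nondegenerate:
  assumes "cinner x u = 0" "\<And>w. cinner w u = 0 \<Longrightarrow> cinner x w = 0"
  shows "x = 0"
  using assms(2)[OF assms(1)] by (simp add: cinner_self)

lemma horo_point_eqI:
  assumes u: "norm u = 1" and z: "z \<in> CH" "z' \<in> CH"
    and "horo_height u z = horo_height u z'" "horo_vec u z = horo_vec u z'"
    and "Im ((1 + cinner z u) / (1 - cinner z u)) = Im ((1 + cinner z' u) / (1 - cinner z' u))"
  shows "z = z'"
proof -
  have "horo_chart u (\<lambda>_. 1) z = horo_chart u (\<lambda>_. 1) z'"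
    using assms(4-6) by (simp add: horo_chart_def)
  moreover have "horo_inv u (\<lambda>_. 1) (horo_chart u (\<lambda>_. 1) x) = x" if "x \<in> CH" for x
    using horo_inv_chart[OF u that, of "\<lambda>_. 1"] by simp
  ultimately show ?thesis using z by metis
qed

lemma mexp_mem: "X \<in> lie_algebra S \<Longrightarrow> mexp X \<in> S"
  by (auto simp: lie_algebra_def dest: spec[of _ 1])

text \<open>The group in coordinates: V collects the coefficients of \<open>pmat u\<close>, and W
  the directions removed from the translations. \<open>lie\<close> bounds the Lie algebra from
  above, for invariance along orbits; the last three assumptions bound it from below, for
  transitivity on level sets.\<close>

locale horospherical_group =
  fixes u :: "complex^'n::finite" and W :: "(complex^'n) set" and V :: "real set"
    and S :: "(complex^('n option)^('n option)) set"
  assumes u: "norm u = 1"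
    and Wu: "\<And>w. w \<in> W \<Longrightarrow> cinner w u = 0"
    and S: "connected_lie_subgroup SU S"
    and lie: "\<And>X. X \<in> lie_algebra S \<Longrightarrow> \<exists>s b Q. X = s *\<^sub>R pmat u + zmat u b + Q \<and> s \<in> V \<and> cinner b u = 0 \<and>
        (\<forall>w\<in>W. b \<bullet> w = 0) \<and> Q \<in> su \<and> bracket (pmat u) Q = 2 *\<^sub>R Q"
    and lie_p: "\<And>s. s \<in> V \<Longrightarrow> s *\<^sub>R pmat u \<in> lie_algebra S"
    and lie_z: "\<And>b. cinner b u = 0 \<Longrightarrow> (\<And>w. w \<in> W \<Longrightarrow> b \<bullet> w = 0) \<Longrightarrow> zmat u b \<in> lie_algebra S"
    and lie_q: "\<And>t. t *\<^sub>R qmat u \<in> lie_algebra S"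
begin

lemma S_SU: "A \<in> S \<Longrightarrow> A \<in> SU"
  and S_mult: "A \<in> S \<Longrightarrow> B \<in> S \<Longrightarrow> A ** B \<in> S"
  and S_1: "mat 1 \<in> S"
  and S_generated: "A \<in> S \<Longrightarrow> \<exists>Xs. set Xs \<subseteq> lie_algebra S \<and> A = foldr (**) (map mexp Xs) (mat 1)"
  using S by (auto simp: connected_lie_subgroup_def)

lemma orbit_trans:
  assumes "p \<in> CH" "A \<in> S" "q \<in> orbit CH_act S (CH_act A p)"
  shows "q \<in> orbit CH_act S p"
proof -
  obtain B where B: "B \<in> S" "q = CH_act B (CH_act A p)" using assms(3) by (auto simp: orbit_def)
  then have "q = CH_act (B ** A) p" using CH_act_mult[OF S_SU S_SU] assms(1,2) by simp
  then show ?thesis using S_mult[OF B(1) assms(2)] by (simp add: orbit_def)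
qed

text \<open>Elements of S are finite products of exponentials, so a reflexive and transitive
  relation that holds across single exponentials holds along the whole orbit.\<close>

lemma orbit_invariant:
  assumes refl: "\<And>p. p \<in> CH \<Longrightarrow> P p p" and trans: "\<And>p q r. P p q \<Longrightarrow> P q r \<Longrightarrow> P p r"
    and step: "\<And>X p. X \<in> lie_algebra S \<Longrightarrow> p \<in> CH \<Longrightarrow> P p (CH_act (mexp X) p)"
    and p: "p \<in> CH" and q: "q \<in> orbit CH_act S p"
  shows "q \<in> CH \<and> P p q"
proof -
  have "foldr (**) (map mexp Xs) (mat 1) \<in> S \<and> P p (CH_act (foldr (**) (map mexp Xs) (mat 1)) p)"
    if "set Xs \<subseteq> lie_algebra S" for Xs
    using that
  proof (induction Xs)
    case Nil
    then show ?case using refl[OF p] S_1 by (simp add: CH_act_mat_1)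
  next
    case (Cons X Xs)
    let ?A = "foldr (**) (map mexp Xs) (mat 1)"
    have A: "?A \<in> S" "P p (CH_act ?A p)" and X: "X \<in> lie_algebra S" using Cons by auto
    have "CH_act (mexp X ** ?A) p = CH_act (mexp X) (CH_act ?A p)"
      by (rule CH_act_mult[OF S_SU[OF mexp_mem[OF X]] S_SU[OF A(1)] p])
    moreover have "P (CH_act ?A p) (CH_act (mexp X) (CH_act ?A p))"
      by (rule step[OF X CH_act_mem[OF S_SU[OF A(1)] p]])
    ultimately show ?case using A trans S_mult[OF mexp_mem[OF X] A(1)] by auto
  qed
  moreover obtain A where "A \<in> S" "q = CH_act A p" using q by (auto simp: orbit_def)
  ultimately show ?thesis using S_generated CH_act_mem[OF S_SU p] by metis
qed

lemma flow:
  assumes X: "X \<in> lie_algebra S" and p: "p \<in> CH"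
  shows "\<exists>s\<in>V. horo_height u (CH_act (mexp X) p) = (exp s)\<^sup>2 * horo_height u p \<and>
    (\<forall>w\<in>W. horo_vec u (CH_act (mexp X) p) \<bullet> w = exp s * (horo_vec u p \<bullet> w))"
proof -
  obtain s b Q where X': "X = s *\<^sub>R pmat u + zmat u b + Q" and s: "s \<in> V" and b: "cinner b u = 0"
    "\<And>w. w \<in> W \<Longrightarrow> b \<bullet> w = 0" and Q: "Q \<in> su" "bracket (pmat u) Q = 2 *\<^sub>R Q"
    using lie[OF X] by metis
  have M: "mexp (s *\<^sub>R pmat u + zmat u b + Q) \<in> SU" using S_SU[OF mexp_mem[OF X]] X' by simp
  \<comment> \<open>b is orthogonal to w in the real sense, so \<open>cinner b w\<close> may still
    be imaginary; taking real parts removes the translation.\<close>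
  have "horo_vec u (CH_act (mexp X) p) \<bullet> w = exp s * (horo_vec u p \<bullet> w)" if w: "w \<in> W" for w
    using arg_cong[OF an_flow(2)[OF u b(1) Q M p Wu[OF w]], of Re] b(2)[OF w]
    by (simp add: X' Re_cinner)
  then show ?thesis
    using s an_flow(1)[OF u b(1) Q M p] X' by auto
qed

text \<open>An exponential of \<open>zmat u b\<close> matches the vector parts and one of
  \<open>qmat u\<close> the imaginary parts; height, vector and imaginary part determine a
  point.\<close>

lemma orbit_same_height:
  assumes p: "p \<in> CH" and q: "q \<in> CH" and h: "horo_height u q = horo_height u p"
    and v: "\<And>w. w \<in> W \<Longrightarrow> horo_vec u q \<bullet> w = horo_vec u p \<bullet> w"
  shows "q \<in> orbit CH_act S p"
proof -
  \<comment> \<open>Without \<aa>-part the translation factor is \<open>exp_quot 0\<close>, which is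
    1, so the plain difference is the right parameter.\<close>
  define b where "b = horo_vec u q - horo_vec u p"
  have b: "cinner b u = 0" "\<And>w. w \<in> W \<Longrightarrow> b \<bullet> w = 0"
    using v by (simp_all add: b_def cinner_simps cinner_horo_vec[OF u] inner_diff_left)
  have 0: "0 \<in> su" "bracket (pmat u) 0 = 2 *\<^sub>R (0 :: complex^('n option)^('n option))"
    using subspace_0[OF subspace_su] by (simp_all add: bracket_def matrix_eq flip: matrix_vector_mul_assoc)
  have mem: "mexp (0 *\<^sub>R pmat u + zmat u b + 0) \<in> S" using mexp_mem[OF lie_z[OF b]] by simp
  define p1 where "p1 = CH_act (mexp (0 *\<^sub>R pmat u + zmat u b + 0)) p"
  note fl = an_flow[OF u b(1) 0 S_SU[OF mem] p, folded p1_def]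
  have p1: "p1 \<in> CH" unfolding p1_def by (rule CH_act_mem[OF S_SU[OF mem] p])
  have h1: "horo_height u p1 = horo_height u q" using fl(1) h by simp
  have "horo_vec u p1 - horo_vec u q = 0"
  proof (rule cinner_nondegenerate)
    show "cinner (horo_vec u p1 - horo_vec u q) u = 0" by (simp add: cinner_simps cinner_horo_vec[OF u])
    show "cinner (horo_vec u p1 - horo_vec u q) w = 0" if "cinner w u = 0" for w
      using fl(2)[OF that] by (simp add: exp_quot_0 b_def cinner_simps)
  qed
  then have v1: "horo_vec u p1 = horo_vec u q" by simp
  \<comment> \<open>Half the difference, since the flow of \<open>qmat u\<close> shifts the
    imaginary part by -2 t.\<close>
  define t where "t = (Im ((1 + cinner p1 u) / (1 - cinner p1 u)) - Im ((1 + cinner q u) / (1 - cinner q u))) / 2"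
  have tmem: "mexp (t *\<^sub>R qmat u) \<in> S" by (rule mexp_mem[OF lie_q])
  define p2 where "p2 = CH_act (mexp (t *\<^sub>R qmat u)) p1"
  have tq: "t *\<^sub>R qmat u \<in> su" "bracket (pmat u) (t *\<^sub>R qmat u) = 2 *\<^sub>R (t *\<^sub>R qmat u)"
  proof -
    show "t *\<^sub>R qmat u \<in> su" by (rule subspace_scale[OF subspace_su qmat_su[OF u]])
    have "bracket (pmat u) (t *\<^sub>R qmat u) = t *\<^sub>R bracket (pmat u) (qmat u)"
      by (rule matrix_eq[THEN iffD2]) (simp add: bracket_vec matrix_scaleR_vec scaleR_diff_right)
    then show "bracket (pmat u) (t *\<^sub>R qmat u) = 2 *\<^sub>R (t *\<^sub>R qmat u)" by (simp add: qmat_bracket[OF u])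
  qed
  have z0: "zmat u 0 = 0" by (rule hc_matrix_eqI) (simp add: zmat_vec cinner_simps hc_0)
  have eq: "0 *\<^sub>R pmat u + zmat u 0 + t *\<^sub>R qmat u = t *\<^sub>R qmat u" by (simp add: z0)
  note fl2 = an_flow[OF u cinner_0_left tq, where s = 0, unfolded eq, OF S_SU[OF tmem] p1, folded p2_def]
  have "p2 \<in> CH" unfolding p2_def by (rule CH_act_mem[OF S_SU[OF tmem] p1])
  moreover have "horo_height u p2 = horo_height u q" using fl2(1) h1 by simp
  moreover have "horo_vec u p2 - horo_vec u q = 0"
  proof (rule cinner_nondegenerate)
    show "cinner (horo_vec u p2 - horo_vec u q) u = 0" by (simp add: cinner_simps cinner_horo_vec[OF u])
    show "cinner (horo_vec u p2 - horo_vec u q) w = 0" if "cinner w u = 0" for w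
      using fl2(2)[OF that] v1 by (simp add: cinner_simps)
  qed
  moreover have "Im ((1 + cinner p2 u) / (1 - cinner p2 u)) = Im ((1 + cinner q u) / (1 - cinner q u))"
    unfolding p2_def qmat_flow[OF u S_SU[OF tmem] p1] by (simp add: t_def)
  ultimately have "p2 = q" by (intro horo_point_eqI[OF u _ q]) simp_all
  have "p2 \<in> orbit CH_act S p1" using tmem by (simp add: orbit_def p2_def)
  then show ?thesis
    using orbit_trans[OF p mem] unfolding p1_def \<open>p2 = q\<close> by blast
qed

lemma orbit_horospherical:
  assumes V: "V = {0}" and p: "p \<in> CH"
  shows "orbit CH_act S p = {q \<in> CH. horo_height u q = horo_height u p \<and>
     (\<forall>w\<in>W. horo_vec u q \<bullet> w = horo_vec u p \<bullet> w)}"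
proof
  show "orbit CH_act S p \<subseteq> {q \<in> CH. horo_height u q = horo_height u p \<and>
     (\<forall>w\<in>W. horo_vec u q \<bullet> w = horo_vec u p \<bullet> w)}"
  proof
    fix q assume q: "q \<in> orbit CH_act S p"
    let ?P = "\<lambda>p q. horo_height u q = horo_height u p \<and> (\<forall>w\<in>W. horo_vec u q \<bullet> w = horo_vec u p \<bullet> w)"
    have "q \<in> CH \<and> ?P p q"
    proof (rule orbit_invariant[OF _ _ _ p q])
      fix X and x :: "complex^'n" assume X: "X \<in> lie_algebra S" and x: "x \<in> CH"
      obtain s where "s \<in> V" "horo_height u (CH_act (mexp X) x) = (exp s)\<^sup>2 * horo_height u x"
        "\<And>w. w \<in> W \<Longrightarrow> horo_vec u (CH_act (mexp X) x) \<bullet> w = exp s * (horo_vec u x \<bullet> w)"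
        using flow[OF X x] by blast
      then show "?P x (CH_act (mexp X) x)" using V by simp
    qed auto
    then show "q \<in> {q \<in> CH. ?P p q}" by simp
  qed
  show "{q \<in> CH. horo_height u q = horo_height u p \<and>
     (\<forall>w\<in>W. horo_vec u q \<bullet> w = horo_vec u p \<bullet> w)} \<subseteq> orbit CH_act S p"
    using orbit_same_height[OF p] by auto
qed

lemma orbit_equidistant:
  assumes V: "V = UNIV" and p: "p \<in> CH"
  shows "orbit CH_act S p = {q \<in> CH. \<forall>w\<in>W.
     (horo_vec u q \<bullet> w) / sqrt (horo_height u q) = (horo_vec u p \<bullet> w) / sqrt (horo_height u p)}"
proof
  let ?P = "\<lambda>p q. \<forall>w\<in>W. (horo_vec u q \<bullet> w) / sqrt (horo_height u q) = (horo_vec u p \<bullet> w) / sqrt (horo_height u p)"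
  show "orbit CH_act S p \<subseteq> {q \<in> CH. ?P p q}"
  proof
    fix q assume q: "q \<in> orbit CH_act S p"
    have "q \<in> CH \<and> ?P p q"
    proof (rule orbit_invariant[OF _ _ _ p q])
      fix X and x :: "complex^'n" assume X: "X \<in> lie_algebra S" and x: "x \<in> CH"
      obtain s where "s \<in> V" "horo_height u (CH_act (mexp X) x) = (exp s)\<^sup>2 * horo_height u x"
        "\<And>w. w \<in> W \<Longrightarrow> horo_vec u (CH_act (mexp X) x) \<bullet> w = exp s * (horo_vec u x \<bullet> w)"
        using flow[OF X x] by blast
      then show "?P x (CH_act (mexp X) x)" by (simp add: real_sqrt_mult)
    qed auto
    then show "q \<in> {q \<in> CH. ?P p q}" by simp
  qed
  show "{q \<in> CH. ?P p q} \<subseteq> orbit CH_act S p"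
  proof
    fix q assume "q \<in> {q \<in> CH. ?P p q}"
    then have q: "q \<in> CH" "?P p q" by auto
    have pos: "horo_height u p > 0" "horo_height u q > 0" using horo_height_pos[OF u] p q by auto
    \<comment> \<open>The flow of \<open>pmat u\<close> multiplies the square root of the height by
      exp s, so this s equalises the heights and leaves the case of
      \<open>orbit_same_height\<close>.\<close>
    define s where "s = ln (sqrt (horo_height u q) / sqrt (horo_height u p))"
    have s: "exp s = sqrt (horo_height u q) / sqrt (horo_height u p)" using pos by (simp add: s_def)
    have z0: "zmat u 0 = 0" by (rule hc_matrix_eqI) (simp add: zmat_vec cinner_simps hc_0)
    have eq: "s *\<^sub>R pmat u + zmat u 0 + 0 = s *\<^sub>R pmat u" by (simp add: z0)
    have mem: "mexp (s *\<^sub>R pmat u) \<in> S" using lie_p V by (intro mexp_mem) simp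
    have 0: "0 \<in> su" "bracket (pmat u) 0 = 2 *\<^sub>R (0 :: complex^('n option)^('n option))"
      using subspace_0[OF subspace_su] by (simp_all add: bracket_def matrix_eq flip: matrix_vector_mul_assoc)
    define p1 where "p1 = CH_act (mexp (s *\<^sub>R pmat u)) p"
    note fl = an_flow[OF u cinner_0_left 0, where s = s, unfolded eq, OF S_SU[OF mem] p, folded p1_def]
    have p1: "p1 \<in> CH" unfolding p1_def by (rule CH_act_mem[OF S_SU[OF mem] p])
    have "q \<in> orbit CH_act S p1"
    proof (rule orbit_same_height[OF p1 q(1)])
      show "horo_height u q = horo_height u p1" using fl(1) pos by (simp add: s power_divide)
      show "horo_vec u q \<bullet> w = horo_vec u p1 \<bullet> w" if w: "w \<in> W" for w
      proof -
        have "horo_vec u p1 \<bullet> w = exp s * (horo_vec u p \<bullet> w)"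
          using arg_cong[OF fl(2)[OF Wu[OF w]], of Re] by (simp add: cinner_simps Re_cinner)
        also have "\<dots> = sqrt (horo_height u q) * ((horo_vec u p \<bullet> w) / sqrt (horo_height u p))"
          by (simp add: s)
        also have "\<dots> = horo_vec u q \<bullet> w"
          unfolding bspec[OF q(2) w, symmetric] using pos by simp
        finally show ?thesis ..
      qed
    qed
    then show "q \<in> orbit CH_act S p" using orbit_trans[OF p mem] unfolding p1_def by blast
  qed
qed

end

text \<open>Uniqueness in the definite description holds because each element of the root space is
  some \<open>zmat u c\<close>, and its tangent vector returns c.\<close>

lemma root_J_zmat:
  fixes u :: "complex^'n::finite"
  assumes u: "norm u = 1"
    and root: "root_space \<aa> \<alpha> = {X \<in> su. bracket (pmat u) X = X}"
    and b: "cinner b u = 0"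
  shows "root_J \<aa> \<alpha> (zmat u b) = zmat u (\<i> *s b)"
  unfolding root_J_def
proof (rule the_equality)
  have "cinner (\<i> *s b) u = 0" using b by (simp add: cinner_simps)
  then show "zmat u (\<i> *s b) \<in> root_space \<aa> \<alpha> \<and>
      p_to_tangent (zmat u (\<i> *s b) - cartan_inv (zmat u (\<i> *s b))) = \<i> *s p_to_tangent (zmat u b - cartan_inv (zmat u b))"
    by (simp add: root zmat_su zmat_bracket[OF u] zmat_minus_cartan_inv p_to_tangent_pmat)
  fix Y assume Y: "Y \<in> root_space \<aa> \<alpha> \<and>
      p_to_tangent (Y - cartan_inv Y) = \<i> *s p_to_tangent (zmat u b - cartan_inv (zmat u b))"
  then obtain c where "Y = zmat u c" using root_alpha_cases[OF u, of Y] root by blast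
  then show "Y = zmat u (\<i> *s b)" using Y by (simp add: zmat_minus_cartan_inv p_to_tangent_pmat)
qed

lemma zmat_linear: "zmat u (b + c) = zmat u b + zmat u c" "zmat u (r *\<^sub>R b) = r *\<^sub>R zmat u b"
proof -
  show "zmat u (b + c) = zmat u b + zmat u c"
    by (rule hc_matrix_eqI)
      (simp add: zmat_vec matrix_vector_mult_add_rdistrib hc_add cinner_simps add_divide_distrib
        vec_eq_iff algebra_simps)
  show "zmat u (r *\<^sub>R b) = r *\<^sub>R zmat u b"
    by (rule hc_matrix_eqI)
      (simp add: zmat_vec matrix_scaleR_vec hc_scaleR cinner_simps vec_option_eq_iff
        scaleR_conv_of_real[where 'a = complex] algebra_simps)
qed

theorem theorem3p2:
  fixes \<aa> V \<ww> AN S :: "(complex^('n::finite option)^('n option)) set"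
    and \<alpha> :: "complex^('n option)^('n option) \<Rightarrow> real"
  assumes n: "CARD('n) \<ge> 2"
    and a: "maximal_abelian_in_p \<aa>"
    and alpha: "restricted_root_decomposition \<aa> \<alpha>"
    and AN: "connected_lie_subgroup SU AN" "lie_algebra AN = an_algebra \<aa> \<alpha>"
    and w: "real_root_subspace \<aa> \<alpha> \<ww>"
    and V: "subspace V" "V \<subseteq> \<aa>"
    and S: "connected_lie_subgroup AN S" "lie_algebra S = s_algebra \<aa> \<alpha> V \<ww>"
  shows "foliation (CH :: (complex^'n) set) (orbits CH_act S CH) \<and>
         polar_action (CH :: (complex^'n) set) CH_metric CH_act S"
proof -
  obtain u where u: "norm u = 1" and range: "\<aa> = range (\<lambda>r. r *\<^sub>R pmat u)" and \<alpha>u: "\<alpha> (pmat u) = 1"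
    using maximal_abelian_generator[OF a alpha] by metis
  have lin: "linear \<alpha>" using alpha by (simp add: restricted_root_decomposition_def)
  have br: "bracket (r *\<^sub>R pmat u) X = r *\<^sub>R bracket (pmat u) X" for r X
    by (rule matrix_eq[THEN iffD2]) (simp add: bracket_vec matrix_scaleR_vec scaleR_diff_right)
  \<comment> \<open>Every H in \<aa> is a multiple of \<open>pmat u\<close> and both sides are
    linear in H, so the condition at \<open>pmat u\<close> is enough.\<close>
  have root: "root_space \<aa> (\<lambda>H. c * \<alpha> H) = {X \<in> su. bracket (pmat u) X = c *\<^sub>R X}" for c
  proof -
    have "(\<forall>H\<in>\<aa>. bracket H X = (c * \<alpha> H) *\<^sub>R X) \<longleftrightarrow> bracket (pmat u) X = c *\<^sub>R X" for X
      unfolding range using \<alpha>u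
      by (auto simp: br linear_cmul[OF lin] mult.commute dest: spec[of _ 1])
    then show ?thesis by (auto simp: root_space_def)
  qed
  have root1: "root_space \<aa> \<alpha> = {X \<in> su. bracket (pmat u) X = X}" using root[of 1] by simp
  define W where "W = {b. cinner b u = 0 \<and> zmat u b \<in> \<ww>}"
  have ww: "subspace \<ww>" "\<ww> \<subseteq> root_space \<aa> \<alpha>"
    and wJ: "\<And>X Y. X \<in> \<ww> \<Longrightarrow> Y \<in> \<ww> \<Longrightarrow> ip (root_J \<aa> \<alpha> X) Y = 0"
    using w by (auto simp: real_root_subspace_def)
  have Wu: "cinner b u = 0" if "b \<in> W" for b using that by (simp add: W_def)
  have "zmat u 0 = 0" using zmat_linear(2)[of u 0 0] by simp
  then have W: "subspace W"
    using ww(1) by (auto simp: W_def subspace_def cinner_simps zmat_linear)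
  \<comment> \<open>The condition on J becomes (\<i> b) \<bullet> c = 0, and this real product is
    minus the imaginary part of \<open>cinner b c\<close>.\<close>
  have Wreal: "Im (cinner b c) = 0" if "b \<in> W" "c \<in> W" for b c
  proof -
    have bc: "cinner b u = 0" "cinner c u = 0" "zmat u b \<in> \<ww>" "zmat u c \<in> \<ww>"
      using that by (auto simp: W_def)
    have "ip (zmat u (\<i> *s b)) (zmat u c) = 0"
      using wJ[OF bc(3,4)] root_J_zmat[OF u root1 bc(1)] by simp
    then have "(\<i> *s b) \<bullet> c = 0"
      using ip_zmat[OF u _ bc(2), of "\<i> *s b"] bc(1) by (simp add: cinner_simps)
    then show ?thesis by (simp add: Re_cinner[symmetric] cinner_simps)
  qed
  have ominus: "ominus (root_space \<aa> \<alpha>) \<ww> = {zmat u b | b. cinner b u = 0 \<and> (\<forall>w\<in>W. b \<bullet> w = 0)}"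
  proof
    have ip: "ip (zmat u b) (zmat u c) = 0 \<longleftrightarrow> b \<bullet> c = 0" if "cinner b u = 0" "cinner c u = 0" for b c
      using ip_zmat[OF u that] by simp
    show "ominus (root_space \<aa> \<alpha>) \<ww> \<subseteq> {zmat u b | b. cinner b u = 0 \<and> (\<forall>w\<in>W. b \<bullet> w = 0)}"
    proof
      fix X assume X: "X \<in> ominus (root_space \<aa> \<alpha>) \<ww>"
      then obtain b where b: "cinner b u = 0" "X = zmat u b"
        using root_alpha_cases[OF u, of X] by (auto simp: ominus_def root1)
      then have "\<forall>w\<in>W. b \<bullet> w = 0" using X ip[OF b(1)] by (auto simp: ominus_def W_def)
      then show "X \<in> {zmat u b | b. cinner b u = 0 \<and> (\<forall>w\<in>W. b \<bullet> w = 0)}" using b by blast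
    qed
    show "{zmat u b | b. cinner b u = 0 \<and> (\<forall>w\<in>W. b \<bullet> w = 0)} \<subseteq> ominus (root_space \<aa> \<alpha>) \<ww>"
    proof clarify
      fix b assume b: "cinner b u = 0" "\<forall>w\<in>W. b \<bullet> w = 0"
      have "ip (zmat u b) Y = 0" if Y: "Y \<in> \<ww>" for Y
      proof -
        obtain c where c: "cinner c u = 0" "Y = zmat u c"
          using root_alpha_cases[OF u, of Y] Y ww(2) by (auto simp: root1)
        then show ?thesis using ip[OF b(1) c(1)] b(2) Y by (auto simp: W_def)
      qed
      then show "zmat u b \<in> ominus (root_space \<aa> \<alpha>) \<ww>"
        using b(1) by (simp add: ominus_def root1 zmat_su zmat_bracket[OF u])
    qed
  qed
  have SU_S: "connected_lie_subgroup SU S"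
    using S(1) AN(1) by (auto simp: connected_lie_subgroup_def)
  \<comment> \<open>V as a set of real coefficients; as a subspace of a line it is either {0} or
    everything, which gives the two cases at the end.\<close>
  define V' where "V' = {s. s *\<^sub>R pmat u \<in> V}"
  have lieS: "X \<in> lie_algebra S \<longleftrightarrow> (\<exists>s b Q. X = s *\<^sub>R pmat u + zmat u b + Q \<and> s \<in> V' \<and> cinner b u = 0 \<and>
        (\<forall>w\<in>W. b \<bullet> w = 0) \<and> Q \<in> su \<and> bracket (pmat u) Q = 2 *\<^sub>R Q)" (is "_ \<longleftrightarrow> ?R X") for X
  proof
    assume "X \<in> lie_algebra S"
    then obtain v U Q where X: "X = v + U + Q" "v \<in> V" "U \<in> ominus (root_space \<aa> \<alpha>) \<ww>"
      "Q \<in> root_space \<aa> (\<lambda>H. 2 * \<alpha> H)"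
      unfolding S(2) s_algebra_def by (auto elim!: set_plus_elim)
    obtain s where s: "v = s *\<^sub>R pmat u" using X(2) V(2) range by blast
    obtain b where b: "U = zmat u b" "cinner b u = 0" "\<forall>w\<in>W. b \<bullet> w = 0"
      using X(3) unfolding ominus by blast
    show "?R X"
      using X(2,4) b(2,3) unfolding X(1) s b(1) root[of 2] V'_def
      by (intro exI[of _ s] exI[of _ b] exI[of _ Q]) simp
  next
    assume "?R X"
    then obtain s b Q where X: "X = s *\<^sub>R pmat u + zmat u b + Q" "s \<in> V'" "cinner b u = 0"
      "\<forall>w\<in>W. b \<bullet> w = 0" "Q \<in> su" "bracket (pmat u) Q = 2 *\<^sub>R Q"
      by blast
    have "zmat u b \<in> ominus (root_space \<aa> \<alpha>) \<ww>" using X(3,4) unfolding ominus by blast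
    moreover have "Q \<in> root_space \<aa> (\<lambda>H. 2 * \<alpha> H)" using X(5,6) unfolding root[of 2] by simp
    ultimately show "X \<in> lie_algebra S"
      using X(2) unfolding S(2) s_algebra_def X(1) V'_def by (auto intro!: set_plus_intro)
  qed
  have zero: "zmat u 0 = 0" "cinner 0 u = 0" "0 \<in> V'" "0 \<in> su" "bracket (pmat u) 0 = 0"
    using \<open>zmat u 0 = 0\<close> subspace_0[OF V(1)] subspace_0[OF subspace_su]
    by (simp_all add: V'_def cinner_simps bracket_def matrix_eq flip: matrix_vector_mul_assoc)
  interpret horospherical_group u W V' S
  proof
    show "\<exists>s b Q. X = s *\<^sub>R pmat u + zmat u b + Q \<and> s \<in> V' \<and> cinner b u = 0 \<and>
        (\<forall>w\<in>W. b \<bullet> w = 0) \<and> Q \<in> su \<and> bracket (pmat u) Q = 2 *\<^sub>R Q" if "X \<in> lie_algebra S" for X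
      using that lieS by blast
    show "s *\<^sub>R pmat u \<in> lie_algebra S" if "s \<in> V'" for s
      unfolding lieS using that zero by (intro exI[of _ s] exI[of _ 0]) simp
    show "zmat u b \<in> lie_algebra S" if "cinner b u = 0" "\<And>w. w \<in> W \<Longrightarrow> b \<bullet> w = 0" for b
      unfolding lieS using that zero by (intro exI[of _ 0] exI[of _ b]) simp
    show "t *\<^sub>R qmat u \<in> lie_algebra S" for t
    proof -
      have "bracket (pmat u) (t *\<^sub>R qmat u) = t *\<^sub>R bracket (pmat u) (qmat u)"
        by (rule matrix_eq[THEN iffD2]) (simp add: bracket_vec matrix_scaleR_vec scaleR_diff_right)
      then have "bracket (pmat u) (t *\<^sub>R qmat u) = 2 *\<^sub>R (t *\<^sub>R qmat u)" by (simp add: qmat_bracket[OF u])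
      then show ?thesis
        unfolding lieS using zero subspace_scale[OF subspace_su qmat_su[OF u]]
        by (intro exI[of _ 0] exI[of _ "t *\<^sub>R qmat u"]) simp
    qed
  qed (use u Wu SU_S in auto)
  have iso: "isometric_action CH CH_metric CH_act S"
    by (rule isometric_action_CH[OF SU_S subset_refl])
  show ?thesis
  proof (cases "V' = {0}")
    case True
    then show ?thesis
      using foliation_horospherical[OF u W Wu Wreal iso orbit_horospherical]
        polar_horospherical[OF u W Wu Wreal iso orbit_horospherical] by blast
  next
    case False
    then obtain s where s: "s \<noteq> 0" "s *\<^sub>R pmat u \<in> V" using zero(3) by (auto simp: V'_def)
    have "r *\<^sub>R pmat u \<in> V" for r
      using subspace_scale[OF V(1) s(2), of "r / s"] s(1) by simp
    then have "V' = UNIV" by (auto simp: V'_def)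
    then show ?thesis
      using foliation_equidistant[OF u W Wu Wreal iso orbit_equidistant]
        polar_equidistant[OF u W Wu Wreal iso orbit_equidistant] by blast
  qed
qed

end
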